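(* Suppose $M>0$ and $0<\delta\le\frac14$. For any $\epsilon'>0$ and $D'>0$ we have, for all large enough $N$, $$\mathbb P\Big(\max_{1\le i,j\le N}\Big|G_{ij}(z)-\delta_{ij}\cdot\frac{1}{\lambda v_i-z-m_N(z)}\Big|\le N^{\epsilon'-\frac12}|\mathrm{Im}\,z|^{-3}\ \text{ for all } z\in D_\delta(M)\Big)>1-N^{-D'},$$ where $D_\delta(M)=\{x+\mathrm i y:\ |x|\le M,\ N^{-\delta}<|y|\le3\}$ and $\delta_{ij}$ is the Kronecker delta.
   Context: Setting. For each $N\ge1$ let $W=(W_{ij})$ be an $N\times N$ real symmetric random matrix (Wigner matrix): the entries $\{W_{ij}: i\le j\}$ are independent and real-valued, $\mathbb E[W_{ij}]=0$, $\mathbb E[W_{ij}^2]=\frac{1+\delta_{ij}}{N}$, and there are constants $\theta>1,\theta'>0$ (independent of $N,i,j$) with $\mathbb P(\sqrt N|W_{ij}|>x)\le\theta'\exp(-x^{1/\theta})$ for all $x\ge0$, all $N$, and all $i,j$. Let $\mu$ be a centered Jacobi measure on $[-1,1]$, i.e. a probability measure with density $Z^{-1}d(x)(1+x)^a(1-x)^b\mathbf 1_{[-1,1]}(x)$, where $a,b>-1$, $d\in C^1([-1,1])$, $d>0$ on $[-1,1]$, $Z$ is the normalization constant, and $\int x\,d\mu(x)=0$. Let $V=\mathrm{diag}(v_1,\dots,v_N)$ with $v_i$ i.i.d. of law $\mu$, independent of $W$, and let $\lambda>0$ be a constant. Let $\lambda_1\ge\dots\ge\lambda_N$ be the eigenvalues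 of $W+\lambda V$. For $z\in\mathbb C\setminus\mathbb R$ set $G(z)=(W+\lambda V-z)^{-1}$ and $m_N(z)=\frac1N\sum_{i=1}^N\frac{1}{\lambda_i-z}$. *)

theory Defs
  imports
    "HOL-Probability.Probability"
    "Jordan_Normal_Form.Char_Poly"
    "Jordan_Normal_Form.Gauss_Jordan_Elimination"
begin

text \<open>
  Matrices are the matrices of \<^typ>\<open>'a mat\<close>, so rows and columns of an \<open>N \<times> N\<close> matrix are
  numbered \<open>0, \<dots>, N - 1\<close>.
\<close>

definition wigner_matrix ::
    "'a measure \<Rightarrow> nat \<Rightarrow> real \<Rightarrow> real \<Rightarrow> ('a \<Rightarrow> real mat) \<Rightarrow> bool" where
  "wigner_matrix P N \<theta> \<theta>' W \<longleftrightarrow>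
     prob_space P \<and>
     (\<forall>\<omega>\<in>space P. W \<omega> \<in> carrier_mat N N \<and> transpose_mat (W \<omega>) = W \<omega>) \<and>
     prob_space.indep_vars P (\<lambda>_. borel) (\<lambda>p \<omega>. W \<omega> $$ p) {(i, j). i \<le> j \<and> j < N} \<and>
     (\<forall>i<N. \<forall>j<N.
        prob_space.expectation P (\<lambda>\<omega>. W \<omega> $$ (i, j)) = 0 \<and>
        prob_space.expectation P (\<lambda>\<omega>. (W \<omega> $$ (i, j))\<^sup>2) = (1 + (if i = j then 1 else 0)) / real N \<and>
        (\<forall>x\<ge>0. prob_space.prob P {\<omega>\<in>space P. sqrt (real N) * \<bar>W \<omega> $$ (i, j)\<bar> > x}
                  \<le> \<theta>' * exp (- (x powr (1 / \<theta>)))))"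

text \<open>
  A function is \<open>C\<^sup>1\<close> on a closed interval if it is differentiable there, one-sidedly at the
  end points, with a continuous derivative; its values outside the interval are irrelevant.
\<close>

definition C1_on :: "real set \<Rightarrow> (real \<Rightarrow> real) \<Rightarrow> bool" where
  "C1_on S d \<longleftrightarrow>
     (\<exists>d'. (\<forall>x\<in>S. (d has_real_derivative d' x) (at x within S)) \<and> continuous_on S d')"

definition jacobi_measure :: "(real \<Rightarrow> real) \<Rightarrow> real \<Rightarrow> real \<Rightarrow> real measure" where
  "jacobi_measure d a b =
     (let Z = (LINT x:{-1..1}|lborel. d x * (1 + x) powr a * (1 - x) powr b)
      in density lborel
           (\<lambda>x. ennreal (indicator {-1..1} x * (d x * (1 + x) powr a * (1 - x) powr b) / Z)))"

definition centered_jacobi_measure :: "real measure \<Rightarrow> bool" where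
  "centered_jacobi_measure \<mu> \<longleftrightarrow>
     (\<exists>d a b. a > -1 \<and> b > -1 \<and> C1_on {-1..1} d \<and> (\<forall>x\<in>{-1..1}. d x > 0) \<and>
        \<mu> = jacobi_measure d a b) \<and>
     (LINT x|\<mu>. x) = 0"

definition iid_with_law ::
    "'a measure \<Rightarrow> nat \<Rightarrow> real measure \<Rightarrow> (nat \<Rightarrow> 'a \<Rightarrow> real) \<Rightarrow> bool" where
  "iid_with_law P N \<mu> v \<longleftrightarrow>
     prob_space.indep_vars P (\<lambda>_. borel) v {..<N} \<and> (\<forall>i<N. distr P borel (v i) = \<mu>)"

text \<open>
  Independence of the random matrices \<open>W\<close> and \<open>diag(v\<^sub>0, \<dots>, v\<^sub>N\<^sub>-\<^sub>1)\<close>. As \<open>W\<close> is symmetric, it is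
  represented by the random vector of its entries on and above the diagonal; independence is
  that of the generated sigma-algebras.
\<close>

definition matrix_indep_of_diag ::
    "'a measure \<Rightarrow> nat \<Rightarrow> ('a \<Rightarrow> real mat) \<Rightarrow> (nat \<Rightarrow> 'a \<Rightarrow> real) \<Rightarrow> bool" where
  "matrix_indep_of_diag P N W v \<longleftrightarrow>
     prob_space.indep_set P
       (sets (vimage_algebra (space P) (\<lambda>\<omega>. \<lambda>p\<in>{(i, j). i \<le> j \<and> j < N}. W \<omega> $$ p)
          (Pi\<^sub>M {(i, j). i \<le> j \<and> j < N} (\<lambda>_. borel))))
       (sets (vimage_algebra (space P) (\<lambda>\<omega>. \<lambda>i\<in>{..<N}. v i \<omega>)
          (Pi\<^sub>M {..<N} (\<lambda>_. borel))))"

definition deformed_wigner :: "nat \<Rightarrow> real \<Rightarrow> real mat \<Rightarrow> (nat \<Rightarrow> real) \<Rightarrow> real mat" where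
  "deformed_wigner N lam W v = W + lam \<cdot>\<^sub>m mat_diag N v"

text \<open>
  The real roots of the characteristic polynomial with multiplicity, in decreasing order. For
  a real symmetric \<open>N \<times> N\<close> matrix these are all \<open>N\<close> eigenvalues.
\<close>

definition ordered_eigenvalues :: "real mat \<Rightarrow> real list" where
  "ordered_eigenvalues A = rev (sorted_list_of_multiset (proots (char_poly A)))"

definition stieltjes :: "nat \<Rightarrow> real mat \<Rightarrow> complex \<Rightarrow> complex" where
  "stieltjes N A z =
     1 / of_nat N * (\<Sum>i<N. 1 / (complex_of_real (ordered_eigenvalues A ! i) - z))"

text \<open>
  \<open>(A - z)\<^sup>-\<^sup>1\<close>; the inverse exists whenever \<open>A\<close> is symmetric and \<open>z\<close> is not real.
\<close>

definition resolvent :: "nat \<Rightarrow> real mat \<Rightarrow> complex \<Rightarrow> complex mat" where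
  "resolvent N A z = the (mat_inverse (map_mat complex_of_real A - z \<cdot>\<^sub>m 1\<^sub>m N))"

definition spectral_domain :: "nat \<Rightarrow> real \<Rightarrow> real \<Rightarrow> complex set" where
  "spectral_domain N \<delta> M =
     {z. \<bar>Re z\<bar> \<le> M \<and> real N powr (- \<delta>) < \<bar>Im z\<bar> \<and> \<bar>Im z\<bar> \<le> 3}"

end

theory Submission
  imports Defs "HOL-Real_Asymp.Real_Asymp"
begin

text \<open>
  Fix \<open>z\<close> with \<open>\<eta> = \<bar>Im z\<bar>\<close> and let \<open>H\<close> be the resolvent of \<open>A = W + lam V\<close> with its \<open>i\<close>-th row and
  column removed. By the Schur complement formula \<open>G\<^sub>i\<^sub>i\<close> is the inverse of
  \<open>lam v\<^sub>i - z - m + E\<^sub>i\<close>, where \<open>E\<^sub>i\<close> collects \<open>W\<^sub>i\<^sub>i\<close>, the difference \<open>m - N\<^sup>-\<^sup>1 Tr H\<close>, which the Ward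
  identity bounds by \<open>2 / (N \<eta>)\<close>, and the fluctuation of the quadratic form
  \<open>\<Sum> W\<^sub>i\<^sub>k H\<^sub>k\<^sub>l W\<^sub>l\<^sub>i\<close> around \<open>N\<^sup>-\<^sup>1 Tr H\<close>; likewise \<open>G\<^sub>i\<^sub>j = - G\<^sub>i\<^sub>i \<Sum> W\<^sub>i\<^sub>k H\<^sub>k\<^sub>j\<close> for \<open>i \<noteq> j\<close>. Since row \<open>i\<close> of \<open>W\<close> is
  independent of \<open>H\<close>, one may freeze \<open>H\<close>, and even moments of arbitrarily high order bound these
  forms by their \<open>l\<^sup>2\<close> size, which is again controlled by the Ward identity. As both \<open>\<bar>G\<^sub>i\<^sub>i\<bar>\<close> and
  \<open>\<bar>lam v\<^sub>i - z - m\<bar>\<^sup>-\<^sup>1\<close> are at most \<open>1 / \<eta>\<close>, no a priori information on \<open>m\<close> or on the law of the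
  \<open>v\<^sub>i\<close> is needed. A polynomially fine net makes the bound uniform in \<open>z\<close>.
\<close>

section \<open>Resolvents of real symmetric matrices\<close>

text \<open>For a diagonal entry the three powers of 1 / |Im z| come from G_ii, from the reciprocal
  of lam v_i - z - m, and from the l^2 size of the resolvent of the minor. The second factor calls
  for no stability analysis of a self-consistent equation: Im m never has the sign opposite to that
  of Im z, so the two cannot cancel. The rest is a question of how small the failure probability can
  be made. Stretched exponential tails bound the entry moments of every order uniformly in N, and
  Markov's inequality for a 2p-th moment at level T = N^(eps'/2) yields N^(-eps' p). This has to
  beat about N^10 net points (mesh N^(-5), against a Lipschitz constant of order N^4) times N^2
  entries, which dictates p in terms of D' and eps'. The moments of forms are estimated by
  integrating out one variable at a time; every step returns a p-th power of a sum of squares, so no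
  combinatorics of index pairings arises. The diagonal v is frozen just like the minor: the
  estimates hold for each deterministic v with the same constants.\<close>

definition symmetric_mat :: "nat \<Rightarrow> real mat \<Rightarrow> bool" where
  "symmetric_mat N A \<longleftrightarrow> A \<in> carrier_mat N N \<and> transpose_mat A = A"

lemma symmetric_matD:
  assumes "symmetric_mat N A"
  shows "A \<in> carrier_mat N N" "dim_row A = N" "dim_col A = N"
    "i < N \<Longrightarrow> j < N \<Longrightarrow> A $$ (j, i) = A $$ (i, j)"
proof -
  show c: "A \<in> carrier_mat N N" "dim_row A = N" "dim_col A = N"
    using assms by (auto simp: symmetric_mat_def)
  assume ij: "i < N" "j < N"
  have "A $$ (j, i) = transpose_mat A $$ (i, j)" using c ij by simp
  also have "transpose_mat A = A" using assms by (simp add: symmetric_mat_def)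
  finally show "A $$ (j, i) = A $$ (i, j)" .
qed

text \<open>An eigenvector \<open>u\<close> for \<open>z\<close> would give the Hermitian form of
  \<open>A\<close> at \<open>u\<close> the value \<open>z\<close> times the squared norm of
  \<open>u\<close>, whereas for real symmetric \<open>A\<close> this form is real.\<close>

lemma symmetric_mat_char_poly_nonzero:
  assumes A: "symmetric_mat N A" and z: "Im z \<noteq> 0"
  shows "poly (char_poly (map_mat complex_of_real A)) z \<noteq> 0"
proof
  let ?A = "map_mat complex_of_real A"
  note sA = symmetric_matD[OF A]
  have cA: "?A \<in> carrier_mat N N" using sA by auto
  assume "poly (char_poly ?A) z = 0"
  then have "eigenvalue ?A z" using eigenvalue_root_char_poly[OF cA] by simp
  then obtain u where u: "u \<in> carrier_vec N" "u \<noteq> 0\<^sub>v N" and eq: "?A *\<^sub>v u = z \<cdot>\<^sub>v u"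
    unfolding eigenvalue_def eigenvector_def using cA by auto
  have row: "(\<Sum>k<N. A $$ (i, k) * vec_index u k) = z * vec_index u i" if "i < N" for i
    using arg_cong[OF eq, of "\<lambda>w. vec_index w i"] that u sA
    by (simp add: scalar_prod_def lessThan_atLeast0)
  let ?S = "\<Sum>i<N. \<Sum>k<N. cnj (vec_index u i) * (A $$ (i, k) * vec_index u k)"
  have S: "?S = z * of_real (\<Sum>i<N. (cmod (vec_index u i))\<^sup>2)"
  proof -
    have "?S = (\<Sum>i<N. cnj (vec_index u i) * (z * vec_index u i))"
      using row by (simp add: sum_distrib_left[symmetric])
    also have "\<dots> = z * of_real (\<Sum>i<N. (cmod (vec_index u i))\<^sup>2)"
      by (simp add: sum_distrib_left complex_norm_square of_real_sum mult_ac del: of_real_power)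
    finally show ?thesis .
  qed
  have "cnj ?S = ?S"
  proof -
    have "cnj ?S = (\<Sum>i<N. \<Sum>k<N. cnj (vec_index u k) * (A $$ (i, k) * vec_index u i))"
      by (simp add: mult_ac)
    also have "\<dots> = (\<Sum>k<N. \<Sum>i<N. cnj (vec_index u k) * (A $$ (i, k) * vec_index u i))"
      by (rule sum.swap)
    also have "\<dots> = ?S" by (intro sum.cong refl) (simp add: sA(4))
    finally show ?thesis .
  qed
  then have "?S \<in> \<real>" by (simp only: Reals_cnj_iff)
  then have "Im ?S = 0" by (simp only: complex_is_Real_iff)
  then have "Im z * (\<Sum>i<N. (cmod (vec_index u i))\<^sup>2) = 0" by (simp only: S times_complex.sel complex.sel Im_complex_of_real Re_complex_of_real mult_zero_right add_0_left)
  then have "(\<Sum>i<N. (cmod (vec_index u i))\<^sup>2) = 0" using z by simp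
  then have "\<forall>i<N. vec_index u i = 0" by (subst (asm) sum_nonneg_eq_0_iff) auto
  then have "u = 0\<^sub>v N" using u(1) by (intro eq_vecI) auto
  with u(2) show False by simp
qed

definition shifted_mat :: "nat \<Rightarrow> real mat \<Rightarrow> complex \<Rightarrow> complex mat" where
  "shifted_mat N A z = map_mat complex_of_real A - z \<cdot>\<^sub>m 1\<^sub>m N"

lemma shifted_mat_carrier: "symmetric_mat N A \<Longrightarrow> shifted_mat N A z \<in> carrier_mat N N"
  by (auto simp: shifted_mat_def dest: symmetric_matD)

lemma shifted_mat_index:
  assumes "symmetric_mat N A" "i < N" "j < N"
  shows "shifted_mat N A z $$ (i, j) = complex_of_real (A $$ (i, j)) - (if i = j then z else 0)"
  using assms symmetric_matD[OF assms(1)] by (auto simp: shifted_mat_def)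

lemma det_shifted_mat:
  assumes A: "A \<in> carrier_mat N N"
  shows "Determinant.det (map_mat complex_of_real A - z \<cdot>\<^sub>m 1\<^sub>m N)
      = (-1) ^ N * poly (char_poly (map_mat complex_of_real A)) z"
proof -
  let ?S = "map_mat complex_of_real A - z \<cdot>\<^sub>m 1\<^sub>m N"
  have c: "map_mat complex_of_real A \<in> carrier_mat N N" using A by auto
  have "- char_matrix (map_mat complex_of_real A) z = (-1) \<cdot>\<^sub>m ?S"
    using A by (intro eq_matI) (auto simp: char_matrix_def)
  then have "poly (char_poly (map_mat complex_of_real A)) z = (-1) ^ N * Determinant.det ?S"
    using A by (simp add: char_poly_matrix[OF c])
  then show ?thesis by (simp add: power_mult_distrib[symmetric] mult.assoc[symmetric])
qed

lemma det_shifted_mat_nonzero: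
  assumes "symmetric_mat N A" "Im z \<noteq> 0"
  shows "Determinant.det (shifted_mat N A z) \<noteq> 0"
  using symmetric_mat_char_poly_nonzero[OF assms] det_shifted_mat[OF symmetric_matD(1)[OF assms(1)]]
  by (simp add: shifted_mat_def)

lemma resolvent_inverse:
  assumes A: "symmetric_mat N A" and z: "Im z \<noteq> 0"
  shows "resolvent N A z \<in> carrier_mat N N"
    "shifted_mat N A z * resolvent N A z = 1\<^sub>m N"
    "resolvent N A z * shifted_mat N A z = 1\<^sub>m N"
proof -
  note c = shifted_mat_carrier[OF A, of z]
  have "shifted_mat N A z \<in> Units (ring_mat TYPE(complex) N ())"
    using det_non_zero_imp_unit[OF c det_shifted_mat_nonzero[OF A z]] .
  then obtain B where "mat_inverse (shifted_mat N A z) = Some B"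
    using mat_inverse(1)[OF c, where b = "()"] by (cases "mat_inverse (shifted_mat N A z)") auto
  then show "resolvent N A z \<in> carrier_mat N N"
    "shifted_mat N A z * resolvent N A z = 1\<^sub>m N"
    "resolvent N A z * shifted_mat N A z = 1\<^sub>m N"
    using mat_inverse(2)[OF c, of B] by (auto simp: resolvent_def shifted_mat_def)
qed

lemma resolvent_eqI:
  assumes A: "symmetric_mat N A" and z: "Im z \<noteq> 0"
    and B: "B \<in> carrier_mat N N" "shifted_mat N A z * B = 1\<^sub>m N"
  shows "B = resolvent N A z"
proof -
  note r = resolvent_inverse[OF A z]
  note c = shifted_mat_carrier[OF A, of z]
  have "B = (resolvent N A z * shifted_mat N A z) * B" using r B by simp
  also have "\<dots> = resolvent N A z * (shifted_mat N A z * B)"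
    by (rule assoc_mult_mat[OF r(1) c B(1)])
  finally show ?thesis using B r by simp
qed

text \<open>Cramer's rule makes every entry a rational function of the entries of \<open>A\<close>.
  Both the measurability of the resolvent and the evaluation of its trace rest on this form.\<close>

lemma resolvent_adj_mat:
  assumes A: "symmetric_mat N A" and z: "Im z \<noteq> 0" and ij: "i < N" "j < N"
  shows "resolvent N A z $$ (i, j)
    = cofactor (shifted_mat N A z) j i / Determinant.det (shifted_mat N A z)"
proof -
  note c = shifted_mat_carrier[OF A, of z]
  let ?d = "Determinant.det (shifted_mat N A z)"
  have d: "?d \<noteq> 0" by (rule det_shifted_mat_nonzero[OF A z])
  have "inverse ?d \<cdot>\<^sub>m adj_mat (shifted_mat N A z) = resolvent N A z"
    using adj_mat[OF c] d
    by (intro resolvent_eqI[OF A z]) (auto simp: mult_smult_distrib[OF c] intro!: eq_matI)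
  from arg_cong[OF this, of "\<lambda>B. B $$ (i, j)"] show ?thesis
    using c ij by (simp add: adj_mat_def divide_inverse mult.commute)
qed

lemma resolvent_sym:
  assumes A: "symmetric_mat N A" and z: "Im z \<noteq> 0" and ij: "i < N" "j < N"
  shows "resolvent N A z $$ (j, i) = resolvent N A z $$ (i, j)"
proof -
  note r = resolvent_inverse[OF A z]
  note c = shifted_mat_carrier[OF A, of z]
  have t: "transpose_mat (shifted_mat N A z) = shifted_mat N A z"
    using c by (intro eq_matI) (auto simp: shifted_mat_index[OF A] symmetric_matD(4)[OF A])
  have "transpose_mat (resolvent N A z) = resolvent N A z"
    using transpose_mult[OF r(1) c] r t by (intro resolvent_eqI[OF A z]) auto
  then show ?thesis using r(1) ij by (metis carrier_matD index_transpose_mat(1))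
qed

lemma resolvent_cnj:
  assumes A: "symmetric_mat N A" and z: "Im z \<noteq> 0" and ij: "i < N" "j < N"
  shows "resolvent N A (cnj z) $$ (i, j) = cnj (resolvent N A z $$ (i, j))"
proof -
  note r = resolvent_inverse[OF A z]
  note c = shifted_mat_carrier[OF A, of z]
  have s: "shifted_mat N A (cnj z) = map_mat cnj (shifted_mat N A z)"
    using c shifted_mat_carrier[OF A, of "cnj z"] by (intro eq_matI) (auto simp: shifted_mat_index[OF A])
  have "map_mat cnj (shifted_mat N A z) * map_mat cnj (resolvent N A z)
      = map_mat cnj (shifted_mat N A z * resolvent N A z)"
    using c r(1) by (intro eq_matI) (auto simp: scalar_prod_def)
  also have "\<dots> = 1\<^sub>m N" using r by (auto intro!: eq_matI)
  finally have "map_mat cnj (resolvent N A z) = resolvent N A (cnj z)"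
    using r z by (intro resolvent_eqI[OF A]) (auto simp: s)
  then show ?thesis using r(1) ij by (metis carrier_matD index_map_mat(1))
qed

lemma resolvent_mult_index:
  assumes A: "symmetric_mat N A" and z: "Im z \<noteq> 0" and ij: "i < N" "j < N"
  shows "(\<Sum>k<N. resolvent N A z $$ (i, k) * A $$ (k, j)) - z * resolvent N A z $$ (i, j)
      = (if i = j then 1 else 0)"
    and "(\<Sum>k<N. A $$ (i, k) * resolvent N A z $$ (k, j)) - z * resolvent N A z $$ (i, j)
      = (if i = j then 1 else 0)"
proof -
  note r = resolvent_inverse[OF A z]
  note c = shifted_mat_carrier[OF A, of z]
  from arg_cong[OF r(3), of "\<lambda>B. B $$ (i, j)"]
  have "(\<Sum>k<N. resolvent N A z $$ (i, k) * shifted_mat N A z $$ (k, j)) = (if i = j then 1 else 0)"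
    using r(1) c ij by (simp add: scalar_prod_def lessThan_atLeast0)
  moreover have "(\<Sum>k<N. resolvent N A z $$ (i, k) * shifted_mat N A z $$ (k, j))
      = (\<Sum>k<N. resolvent N A z $$ (i, k) * A $$ (k, j) - (if k = j then z * resolvent N A z $$ (i, j) else 0))"
    using ij by (intro sum.cong) (auto simp: shifted_mat_index[OF A] algebra_simps)
  ultimately show "(\<Sum>k<N. resolvent N A z $$ (i, k) * A $$ (k, j)) - z * resolvent N A z $$ (i, j)
      = (if i = j then 1 else 0)" using ij by (simp add: sum_subtractf)
  from arg_cong[OF r(2), of "\<lambda>B. B $$ (i, j)"]
  have "(\<Sum>k<N. shifted_mat N A z $$ (i, k) * resolvent N A z $$ (k, j)) = (if i = j then 1 else 0)"
    using r(1) c ij by (simp add: scalar_prod_def lessThan_atLeast0)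
  moreover have "(\<Sum>k<N. shifted_mat N A z $$ (i, k) * resolvent N A z $$ (k, j))
      = (\<Sum>k<N. A $$ (i, k) * resolvent N A z $$ (k, j) - (if k = i then z * resolvent N A z $$ (i, j) else 0))"
    using ij by (intro sum.cong) (auto simp: shifted_mat_index[OF A] algebra_simps)
  ultimately show "(\<Sum>k<N. A $$ (i, k) * resolvent N A z $$ (k, j)) - z * resolvent N A z $$ (i, j)
      = (if i = j then 1 else 0)" using ij by (simp add: sum_subtractf)
qed

text \<open>Entrywise form of G - H = G ((B - w) - (A - z)) H. The case \<open>A = B\<close> gives
  the Ward identity and the Lipschitz bounds; the case \<open>z = w\<close> compares a matrix with
  its minor.\<close>

lemma resolvent_identity:
  assumes A: "symmetric_mat N A" and B: "symmetric_mat N B"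
    and z: "Im z \<noteq> 0" and w: "Im w \<noteq> 0" and ij: "i < N" "j < N"
  shows "resolvent N A z $$ (i, j) - resolvent N B w $$ (i, j)
    = (\<Sum>k<N. \<Sum>l<N. resolvent N A z $$ (i, k) * of_real (B $$ (k, l) - A $$ (k, l)) * resolvent N B w $$ (l, j))
      + (z - w) * (\<Sum>k<N. resolvent N A z $$ (i, k) * resolvent N B w $$ (k, j))"
proof -
  let ?G = "\<lambda>i j. resolvent N A z $$ (i, j)"
  let ?H = "\<lambda>i j. resolvent N B w $$ (i, j)"
  have "(\<Sum>k<N. \<Sum>l<N. ?G i k * of_real (B $$ (k, l) - A $$ (k, l)) * ?H l j)
     = (\<Sum>k<N. \<Sum>l<N. ?G i k * (B $$ (k, l) * ?H l j)) - (\<Sum>k<N. \<Sum>l<N. ?G i k * A $$ (k, l) * ?H l j)"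
    by (simp add: algebra_simps sum_subtractf)
  also have "(\<Sum>k<N. \<Sum>l<N. ?G i k * (B $$ (k, l) * ?H l j))
      = (\<Sum>k<N. ?G i k * (w * ?H k j + (if k = j then 1 else 0)))"
    using resolvent_mult_index(2)[OF B w _ ij(2)]
    by (intro sum.cong refl) (simp add: sum_distrib_left[symmetric] diff_eq_eq add.commute)
  also have "(\<Sum>k<N. \<Sum>l<N. ?G i k * A $$ (k, l) * ?H l j)
      = (\<Sum>l<N. \<Sum>k<N. ?G i k * A $$ (k, l) * ?H l j)" by (rule sum.swap)
  also have "\<dots> = (\<Sum>l<N. (z * ?G i l + (if i = l then 1 else 0)) * ?H l j)"
    using resolvent_mult_index(1)[OF A z ij(1)]
    by (intro sum.cong refl) (simp add: sum_distrib_right[symmetric] diff_eq_eq add.commute)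
  also have "(\<Sum>k<N. ?G i k * (w * ?H k j + (if k = j then 1 else 0)))
      = w * (\<Sum>k<N. ?G i k * ?H k j) + ?G i j"
  proof -
    have "?G i k * (w * ?H k j + (if k = j then 1 else 0))
        = w * (?G i k * ?H k j) + (if k = j then ?G i k else 0)" for k
      by (simp add: algebra_simps)
    then show ?thesis using ij by (simp add: sum.distrib sum_distrib_left)
  qed
  also have "(\<Sum>l<N. (z * ?G i l + (if i = l then 1 else 0)) * ?H l j)
      = z * (\<Sum>k<N. ?G i k * ?H k j) + ?H i j"
  proof -
    have "(z * ?G i l + (if i = l then 1 else 0)) * ?H l j
        = z * (?G i l * ?H l j) + (if l = i then ?H l j else 0)" for l
      by (simp add: algebra_simps)
    then show ?thesis using ij by (simp add: sum.distrib sum_distrib_left)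
  qed
  finally show ?thesis by (simp add: algebra_simps)
qed

text \<open>With \<open>w = cnj z\<close> in the resolvent identity the second factor is, by
  symmetry, the conjugate of the first, and the sum becomes one of squared moduli.\<close>

lemma resolvent_ward:
  assumes A: "symmetric_mat N A" and z: "Im z \<noteq> 0" and i: "i < N"
  shows "Im z * (\<Sum>k<N. (cmod (resolvent N A z $$ (i, k)))\<^sup>2) = Im (resolvent N A z $$ (i, i))"
proof -
  let ?G = "\<lambda>i j. resolvent N A z $$ (i, j)"
  have z': "Im (cnj z) \<noteq> 0" using z by simp
  have "?G i i - cnj (?G i i) = (z - cnj z) * (\<Sum>k<N. ?G i k * cnj (?G k i))"
    using resolvent_identity[OF A A z z' i i] by (simp add: resolvent_cnj[OF A z] i)
  also have "(\<Sum>k<N. ?G i k * cnj (?G k i)) = of_real (\<Sum>k<N. (cmod (?G i k))\<^sup>2)"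
    unfolding of_real_sum
    by (intro sum.cong refl) (simp add: resolvent_sym[OF A z i] complex_norm_square del: of_real_power)
  finally have "Im (?G i i - cnj (?G i i)) = Im ((z - cnj z) * of_real (\<Sum>k<N. (cmod (?G i k))\<^sup>2))"
    by (rule arg_cong)
  then show ?thesis by simp
qed

text \<open>Since the row sum contains |G_ii|^2, the Ward identity yields |G_ii|^2 <= |G_ii| / |Im
  z|, hence |G_ii| <= 1 / |Im z|. The first bound retains |G_ii| because
  \<open>resolvent_trace_minor\<close> has to cancel that factor.\<close>

lemma resolvent_row_norm:
  assumes A: "symmetric_mat N A" and z: "Im z \<noteq> 0" and i: "i < N"
  shows "(\<Sum>k<N. (cmod (resolvent N A z $$ (i, k)))\<^sup>2) \<le> cmod (resolvent N A z $$ (i, i)) / \<bar>Im z\<bar>"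
    and "(\<Sum>k<N. (cmod (resolvent N A z $$ (i, k)))\<^sup>2) \<le> 1 / (Im z)\<^sup>2"
    and "j < N \<Longrightarrow> cmod (resolvent N A z $$ (i, j)) \<le> 1 / \<bar>Im z\<bar>"
proof -
  let ?G = "\<lambda>i j. resolvent N A z $$ (i, j)"
  let ?S = "\<Sum>k<N. (cmod (?G i k))\<^sup>2"
  have pos: "\<bar>Im z\<bar> > 0" using z by simp
  have "\<bar>Im z\<bar> * ?S = \<bar>Im z * ?S\<bar>" by (simp add: abs_mult sum_nonneg)
  also have "\<dots> \<le> cmod (?G i i)" unfolding resolvent_ward[OF A z i] by (rule abs_Im_le_cmod)
  finally show S: "?S \<le> cmod (?G i i) / \<bar>Im z\<bar>" using pos by (simp add: field_simps)
  have entry: "(cmod (?G i j))\<^sup>2 \<le> ?S" if "j < N" for j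
    using that by (intro member_le_sum) auto
  have "(cmod (?G i i))\<^sup>2 \<le> cmod (?G i i) / \<bar>Im z\<bar>" using entry[OF i] S by simp
  then have "cmod (?G i i) * (\<bar>Im z\<bar> * cmod (?G i i)) \<le> cmod (?G i i) * 1"
    using pos by (simp add: field_simps power2_eq_square)
  then have d: "\<bar>Im z\<bar> * cmod (?G i i) \<le> 1"
    by (metis mult_le_cancel_left_pos norm_ge_zero less_eq_real_def mult_zero_right zero_le_one)
  then have "cmod (?G i i) / \<bar>Im z\<bar> \<le> (1 / \<bar>Im z\<bar>) / \<bar>Im z\<bar>"
    using pos by (intro divide_right_mono) (auto simp: field_simps)
  then show S2: "?S \<le> 1 / (Im z)\<^sup>2" using S by (simp add: power2_eq_square)
  show "cmod (?G i j) \<le> 1 / \<bar>Im z\<bar>" if "j < N"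
  proof (rule power2_le_imp_le)
    show "(cmod (?G i j))\<^sup>2 \<le> (1 / \<bar>Im z\<bar>)\<^sup>2" using entry[OF that] S2 by (simp add: power_divide)
  qed auto
qed

text \<open>Cauchy-Schwarz between a row at \<open>z\<close> and a column at \<open>w\<close>, each
  controlled by the Ward identity, keeps the constant free of \<open>N\<close>.\<close>

lemma resolvent_lipschitz:
  assumes A: "symmetric_mat N A" and z: "Im z \<noteq> 0" and w: "Im w \<noteq> 0" and ij: "i < N" "j < N"
  shows "cmod (resolvent N A z $$ (i, j) - resolvent N A w $$ (i, j)) \<le> cmod (z - w) / (\<bar>Im z\<bar> * \<bar>Im w\<bar>)"
proof -
  let ?G = "\<lambda>z i j. resolvent N A z $$ (i, j)"
  have "(\<Sum>k<N. cmod (?G z i k) * cmod (?G w k j))\<^sup>2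
      \<le> (\<Sum>k<N. (cmod (?G z i k))\<^sup>2) * (\<Sum>k<N. (cmod (?G w k j))\<^sup>2)"
    by (rule Cauchy_Schwarz_ineq_sum)
  also have "(\<Sum>k<N. (cmod (?G w k j))\<^sup>2) = (\<Sum>k<N. (cmod (?G w j k))\<^sup>2)"
    by (intro sum.cong refl) (simp add: resolvent_sym[OF A w ij(2)])
  also have "(\<Sum>k<N. (cmod (?G z i k))\<^sup>2) * \<dots> \<le> (1 / (Im z)\<^sup>2) * (1 / (Im w)\<^sup>2)"
    using resolvent_row_norm(2)[OF A z ij(1)] resolvent_row_norm(2)[OF A w ij(2)]
    by (intro mult_mono) (auto simp: sum_nonneg)
  also have "\<dots> = (1 / (\<bar>Im z\<bar> * \<bar>Im w\<bar>))\<^sup>2" by (simp add: power_mult_distrib power_divide)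
  finally have "(\<Sum>k<N. cmod (?G z i k) * cmod (?G w k j)) \<le> 1 / (\<bar>Im z\<bar> * \<bar>Im w\<bar>)"
    by (rule power2_le_imp_le) simp
  moreover have "cmod (\<Sum>k<N. ?G z i k * ?G w k j) \<le> (\<Sum>k<N. cmod (?G z i k) * cmod (?G w k j))"
    by (intro sum_norm_le) (simp add: norm_mult)
  ultimately have b: "cmod (\<Sum>k<N. ?G z i k * ?G w k j) \<le> 1 / (\<bar>Im z\<bar> * \<bar>Im w\<bar>)" by linarith
  have "?G z i j - ?G w i j = (z - w) * (\<Sum>k<N. ?G z i k * ?G w k j)"
    using resolvent_identity[OF A A z w ij] by simp
  then have "cmod (?G z i j - ?G w i j) = cmod (z - w) * cmod (\<Sum>k<N. ?G z i k * ?G w k j)"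
    by (simp add: norm_mult)
  also have "\<dots> \<le> cmod (z - w) * (1 / (\<bar>Im z\<bar> * \<bar>Im w\<bar>))" using b by (intro mult_left_mono) auto
  finally show ?thesis by simp
qed

text \<open>Up to sign, the diagonal cofactors of \<open>A - z\<close> are the characteristic
  polynomials of the principal minors at \<open>z\<close>, and these sum to the derivative of the
  characteristic polynomial. This ties the trace to the eigenvalues without diagonalizing
  \<open>A\<close>.\<close>

lemma trace_resolvent_char_poly:
  assumes A: "symmetric_mat N A" and z: "Im z \<noteq> 0"
  defines "p \<equiv> char_poly (map_mat complex_of_real A)"
  shows "(\<Sum>i<N. resolvent N A z $$ (i, i)) = - poly (pderiv p) z / poly p z"
proof -
  have cA: "A \<in> carrier_mat N N" "map_mat complex_of_real A \<in> carrier_mat N N"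
    using symmetric_matD[OF A] by auto
  have p0: "poly p z \<noteq> 0" unfolding p_def by (rule symmetric_mat_char_poly_nonzero[OF A z])
  have "resolvent N A z $$ (i, i)
      = - poly (char_poly (mat_delete (map_mat complex_of_real A) i i)) z / poly p z" if i: "i < N" for i
  proof -
    have e: "mat_delete (shifted_mat N A z) i i
        = map_mat complex_of_real (mat_delete A i i) - z \<cdot>\<^sub>m 1\<^sub>m (N - 1)"
      using cA i by (intro eq_matI) (auto simp: mat_delete_def shifted_mat_def)
    have d: "mat_delete A i i \<in> carrier_mat (N - 1) (N - 1)" using cA by (auto simp: mat_delete_def)
    have m: "map_mat complex_of_real (mat_delete A i i) = mat_delete (map_mat complex_of_real A) i i"
      using cA by (intro eq_matI) (auto simp: mat_delete_def)
    have s: "(-1 :: complex) ^ N = - ((-1) ^ (N - 1))" using i by (cases N) auto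
    have minor: "Determinant.det (mat_delete (shifted_mat N A z) i i)
        = (-1) ^ (N - 1) * poly (char_poly (mat_delete (map_mat complex_of_real A) i i)) z"
      using det_shifted_mat[OF d, of z] unfolding e m[symmetric] .
    have "Determinant.det (shifted_mat N A z) = - ((-1) ^ (N - 1)) * poly p z"
      using det_shifted_mat[OF cA(1), of z] unfolding shifted_mat_def p_def s .
    then show ?thesis using p0
      unfolding resolvent_adj_mat[OF A z i i] cofactor_def minor by simp
  qed
  then have "(\<Sum>i<N. resolvent N A z $$ (i, i))
      = - (\<Sum>i<N. poly (char_poly (mat_delete (map_mat complex_of_real A) i i)) z) / poly p z"
    by (simp add: sum_divide_distrib sum_negf)
  then show ?thesis by (simp add: p_def pderiv_char_poly[OF cA(2)] poly_sum)
qed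

lemma logarithmic_derivative_linear_factors:
  fixes z :: "'a :: field"
  assumes "z \<notin> set es"
  shows "poly (\<Prod>e\<leftarrow>es. [:- e, 1:]) z \<noteq> 0"
    and "poly (pderiv (\<Prod>e\<leftarrow>es. [:- e, 1:])) z / poly (\<Prod>e\<leftarrow>es. [:- e, 1:]) z = (\<Sum>e\<leftarrow>es. 1 / (z - e))"
proof -
  have "poly (\<Prod>e\<leftarrow>es. [:- e, 1:]) z \<noteq> 0 \<and>
    poly (pderiv (\<Prod>e\<leftarrow>es. [:- e, 1:])) z / poly (\<Prod>e\<leftarrow>es. [:- e, 1:]) z = (\<Sum>e\<leftarrow>es. 1 / (z - e))"
    using assms
  proof (induction es)
    case (Cons a es)
    define P where "P = (\<Prod>e\<leftarrow>es. [:- e, 1:])"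
    have P: "poly P z \<noteq> 0" "poly (pderiv P) z / poly P z = (\<Sum>e\<leftarrow>es. 1 / (z - e))" and a: "z - a \<noteq> 0"
      using Cons by (auto simp: P_def)
    have v: "poly ([:- a, 1:] * P) z = (z - a) * poly P z" by (simp add: algebra_simps)
    have d: "poly (pderiv ([:- a, 1:] * P)) z = (z - a) * poly (pderiv P) z + poly P z"
      unfolding pderiv_mult by (simp add: pderiv_pCons algebra_simps)
    have q: "((z - a) * poly (pderiv P) z + poly P z) / ((z - a) * poly P z)
        = 1 / (z - a) + poly (pderiv P) z / poly P z"
      using P(1) a by (simp add: add_divide_distrib add.commute)
    show ?case
      unfolding list.map prod_list.Cons sum_list.Cons P_def[symmetric] v d q P(2) using P(1) a by simp
  qed simp
  then show "poly (\<Prod>e\<leftarrow>es. [:- e, 1:]) z \<noteq> 0"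
    "poly (pderiv (\<Prod>e\<leftarrow>es. [:- e, 1:])) z / poly (\<Prod>e\<leftarrow>es. [:- e, 1:]) z = (\<Sum>e\<leftarrow>es. 1 / (z - e))"
    by blast+
qed

text \<open>\<open>stieltjes\<close> only sees the real roots of a real polynomial. Over the complex
  numbers the characteristic polynomial splits; its roots are real, so the real polynomial splits as
  well and its roots form the whole spectrum. Logarithmic differentiation then matches the trace
  formula.\<close>

lemma stieltjes_eq_trace:
  assumes A: "symmetric_mat N A" and z: "Im z \<noteq> 0"
  shows "stieltjes N A z = (\<Sum>i<N. resolvent N A z $$ (i, i)) / of_nat N"
proof -
  have cA: "A \<in> carrier_mat N N" "map_mat complex_of_real A \<in> carrier_mat N N"
    using symmetric_matD[OF A] by auto
  interpret h: map_poly_inj_idom_hom complex_of_real ..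
  obtain es where es: "char_poly (map_mat complex_of_real A) = (\<Prod>e\<leftarrow>es. [:- e, 1:])" "length es = N"
    using char_poly_factorized[OF cA(2)] by blast
  have real: "Im e = 0" if "e \<in> set es" for e
  proof (rule ccontr)
    assume "Im e \<noteq> 0"
    from symmetric_mat_char_poly_nonzero[OF A this] that show False
      by (auto simp: es poly_prod_list prod_list_zero_iff)
  qed
  define rs where "rs = map Re es"
  have es_rs: "es = map complex_of_real rs"
    using real unfolding rs_def by (simp add: map_idI complex_eq_iff o_def)
  have "map_poly complex_of_real (char_poly A) = (\<Prod>e\<leftarrow>es. [:- e, 1:])"
    using es(1) of_real_hom.char_poly_hom[OF cA(1), where ?'a = complex] by simp
  also have "\<dots> = map_poly complex_of_real (\<Prod>r\<leftarrow>rs. [:- r, 1:])"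
    unfolding es_rs by (induction rs) (simp_all add: h.hom_mult del: mult_pCons_left)
  finally have cp: "char_poly A = (\<Prod>r\<leftarrow>rs. [:- r, 1:])" by (rule h.injectivity)
  have nz: "(\<Prod>r\<leftarrow>rs. [:- r, 1:]) \<noteq> (0 :: real poly)" for rs
    by (auto simp: prod_list_zero_iff)
  have "proots (\<Prod>r\<leftarrow>rs. [:- r, 1:]) = mset rs" for rs :: "real list"
  proof (induction rs)
    case (Cons a rs)
    have "proots ([:- a, 1:] * (\<Prod>r\<leftarrow>rs. [:- r, 1:])) = {#a#} + mset rs"
      using nz[of rs] Cons by (subst proots_mult) auto
    then show ?case by (simp del: mult_pCons_left)
  qed simp
  then have m: "mset (ordered_eigenvalues A) = mset rs" by (simp add: ordered_eigenvalues_def cp)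
  \<comment> \<open>This keeps the accesses \<open>! i\<close> with \<open>i < N\<close> in
    \<open>stieltjes\<close> within the list.\<close>
  have len: "length (ordered_eigenvalues A) = N"
    using mset_eq_length[OF m] es(2) by (simp add: rs_def)
  have "(\<Sum>i<N. 1 / (complex_of_real (ordered_eigenvalues A ! i) - z))
      = (\<Sum>x\<leftarrow>ordered_eigenvalues A. 1 / (complex_of_real x - z))"
    using len by (simp add: sum_list_sum_nth lessThan_atLeast0)
  also have "\<dots> = (\<Sum>x\<leftarrow>rs. 1 / (complex_of_real x - z))"
    using m by (metis mset_map sum_mset_sum_list)
  also have "\<dots> = - (\<Sum>e\<leftarrow>es. 1 / (z - e))"
    unfolding es_rs by (induction rs) (auto simp: minus_divide_right)
  also have "\<dots> = (\<Sum>i<N. resolvent N A z $$ (i, i))"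
  proof -
    have "z \<notin> set es" using real z by auto
    from logarithmic_derivative_linear_factors(2)[OF this] show ?thesis
      unfolding trace_resolvent_char_poly[OF A z] es(1) by simp
  qed
  finally show ?thesis unfolding stieltjes_def by simp
qed

lemma stieltjes_Im_sign:
  assumes A: "symmetric_mat N A" and z: "Im z \<noteq> 0"
  shows "Im z * Im (stieltjes N A z) \<ge> 0"
proof -
  have "Im z * Im (stieltjes N A z) = (\<Sum>i<N. Im z * Im (resolvent N A z $$ (i, i))) / N"
    by (simp add: stieltjes_eq_trace[OF A z] sum_distrib_left)
  also have "\<dots> = (\<Sum>i<N. (Im z)\<^sup>2 * (\<Sum>k<N. (cmod (resolvent N A z $$ (i, k)))\<^sup>2)) / N"
    by (simp add: resolvent_ward[OF A z, symmetric] power2_eq_square mult.assoc)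
  also have "\<dots> \<ge> 0" by (intro divide_nonneg_nonneg sum_nonneg mult_nonneg_nonneg) auto
  finally show ?thesis .
qed

lemma stieltjes_lipschitz:
  assumes A: "symmetric_mat N A" and z: "Im z \<noteq> 0" and w: "Im w \<noteq> 0" and N: "N > 0"
  shows "cmod (stieltjes N A z - stieltjes N A w) \<le> cmod (z - w) / (\<bar>Im z\<bar> * \<bar>Im w\<bar>)"
proof -
  have "cmod (\<Sum>i<N. resolvent N A z $$ (i, i) - resolvent N A w $$ (i, i))
     \<le> (\<Sum>i<N. cmod (z - w) / (\<bar>Im z\<bar> * \<bar>Im w\<bar>))"
    by (intro sum_norm_le resolvent_lipschitz[OF A z w]) auto
  then show ?thesis using N
    unfolding stieltjes_eq_trace[OF A z] stieltjes_eq_trace[OF A w] diff_divide_distrib[symmetric]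
      sum_subtractf[symmetric] norm_divide by (simp add: field_simps)
qed

text \<open>The imaginary part of the denominator is \<open>- (Im z + Im m)\<close>, and the two
  summands never have opposite signs. The bound is uniform in the real number
  \<open>d\<close>.\<close>

lemma subordination_denominator:
  assumes A: "symmetric_mat N A" and z: "Im z \<noteq> 0"
  shows "\<bar>Im z\<bar> \<le> cmod (complex_of_real d - z - stieltjes N A z)"
proof -
  have "\<bar>Im z\<bar> \<le> \<bar>Im z + Im (stieltjes N A z)\<bar>"
    using stieltjes_Im_sign[OF A z] by (auto simp: zero_le_mult_iff)
  also have "\<dots> = \<bar>Im (complex_of_real d - z - stieltjes N A z)\<bar>" by simp
  also have "\<dots> \<le> cmod (complex_of_real d - z - stieltjes N A z)" by (rule abs_Im_le_cmod)
  finally show ?thesis .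
qed

section \<open>Removing one row and column\<close>

text \<open>
  Row and column \<open>i\<close> are set to zero instead of being deleted, which avoids renumbering the
  remaining indices: away from \<open>i\<close> the resolvent of this matrix is that of the minor.
\<close>

definition isolate_index :: "nat \<Rightarrow> nat \<Rightarrow> real mat \<Rightarrow> real mat" where
  "isolate_index N i A = mat N N (\<lambda>(k, l). if k = i \<or> l = i then 0 else A $$ (k, l))"

lemma symmetric_isolate_index:
  assumes "symmetric_mat N A"
  shows "symmetric_mat N (isolate_index N i A)"
  using symmetric_matD[OF assms] unfolding symmetric_mat_def isolate_index_def
  by (auto intro!: eq_matI)

context
  fixes N i :: nat and A :: "real mat" and z :: complex and G H :: "nat \<Rightarrow> nat \<Rightarrow> complex"
  assumes A: "symmetric_mat N A" and z: "Im z \<noteq> 0" and i: "i < N"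
  defines "G \<equiv> \<lambda>k l. resolvent N A z $$ (k, l)"
    and "H \<equiv> \<lambda>k l. resolvent N (isolate_index N i A) z $$ (k, l)"
begin

text \<open>Row \<open>i\<close> of the isolated matrix vanishes, so row \<open>i\<close> of the
  resolvent equation reads \<open>- z * H i j = 0\<close>.\<close>

lemma isolated_resolvent_row:
  assumes j: "j < N" "j \<noteq> i"
  shows "H i j = 0"
proof -
  have "z \<noteq> 0" using z by auto
  have "(\<Sum>k<N. isolate_index N i A $$ (i, k) * H k j) - z * H i j = 0"
    using resolvent_mult_index(2)[OF symmetric_isolate_index[OF A] z i j(1)] j(2) unfolding H_def by simp
  moreover have "(\<Sum>k<N. isolate_index N i A $$ (i, k) * H k j) = 0"
    by (intro sum.neutral) (auto simp: isolate_index_def i)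
  ultimately show ?thesis using \<open>z \<noteq> 0\<close> by simp
qed

text \<open>\<open>A\<close> and its isolated version differ only in row and column
  \<open>i\<close>. In the resolvent identity the entries of column \<open>i\<close> meet the factor
  \<open>H i j = 0\<close>, so only row \<open>i\<close> contributes.\<close>

lemma resolvent_minor_expansion:
  assumes k: "k < N" and j: "j < N" "j \<noteq> i"
  shows "G k j = H k j - G k i * (\<Sum>l\<in>{..<N} - {i}. A $$ (i, l) * H l j)"
proof -
  have "G k j - H k j = (\<Sum>k'<N. \<Sum>l<N. G k k' * of_real (isolate_index N i A $$ (k', l) - A $$ (k', l)) * H l j)"
    using resolvent_identity[OF A symmetric_isolate_index[OF A] z z k j(1)] unfolding G_def H_def by simp
  also have "\<dots> = (\<Sum>k'<N. if k' = i then (\<Sum>l<N. if l = i then 0 else - (G k i * (A $$ (i, l) * H l j))) else 0)"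
  proof (intro sum.cong refl)
    fix k' assume k': "k' \<in> {..<N}"
    show "(\<Sum>l<N. G k k' * of_real (isolate_index N i A $$ (k', l) - A $$ (k', l)) * H l j)
      = (if k' = i then (\<Sum>l<N. if l = i then 0 else - (G k i * (A $$ (i, l) * H l j))) else 0)"
    proof (cases "k' = i")
      case True
      then show ?thesis using k'
        by (auto intro!: sum.cong simp: isolate_index_def isolated_resolvent_row[OF j])
    next
      case False
      have "(\<Sum>l<N. G k k' * of_real (isolate_index N i A $$ (k', l) - A $$ (k', l)) * H l j) = 0"
        using k' False by (intro sum.neutral) (auto simp: isolate_index_def isolated_resolvent_row[OF j])
      then show ?thesis using False by simp
    qed
  qed
  also have "\<dots> = (\<Sum>l<N. if l = i then 0 else - (G k i * (A $$ (i, l) * H l j)))"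
    using i by simp
  also have "\<dots> = (\<Sum>l\<in>{..<N} - {i}. - (G k i * (A $$ (i, l) * H l j)))"
    by (intro sum.mono_neutral_cong_right) auto
  finally show ?thesis by (simp add: sum_negf sum_distrib_left diff_eq_eq)
qed

lemma resolvent_offdiag:
  assumes j: "j < N" "j \<noteq> i"
  shows "G i j = - G i i * (\<Sum>l\<in>{..<N} - {i}. A $$ (i, l) * H l j)"
  using resolvent_minor_expansion[OF i j] isolated_resolvent_row[OF j] by simp

text \<open>The Schur complement formula, obtained by inserting the off-diagonal entries into entry
  \<open>(i, i)\<close> of \<open>G (A - z) = 1\<close>.\<close>

lemma resolvent_diag:
  "G i i * (A $$ (i, i) - z - (\<Sum>k\<in>{..<N} - {i}. \<Sum>l\<in>{..<N} - {i}. A $$ (i, k) * A $$ (i, l) * H l k)) = 1"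
proof -
  let ?I = "{..<N} - {i}"
  have "1 = (\<Sum>k<N. G i k * A $$ (k, i)) - z * G i i"
    using resolvent_mult_index(1)[OF A z i i] unfolding G_def by simp
  also have "(\<Sum>k<N. G i k * A $$ (k, i)) = G i i * A $$ (i, i) + (\<Sum>k\<in>?I. G i k * A $$ (k, i))"
    using i by (simp add: sum.remove)
  also have "(\<Sum>k\<in>?I. G i k * A $$ (k, i)) = (\<Sum>k\<in>?I. - G i i * (\<Sum>l\<in>?I. A $$ (i, l) * H l k) * A $$ (i, k))"
    by (intro sum.cong refl) (auto simp: resolvent_offdiag symmetric_matD(4)[OF A i])
  finally show ?thesis
    by (simp add: algebra_simps sum_distrib_left sum_negf)
qed

text \<open>Away from \<open>i\<close>, \<open>G i i * (G j j - H j j) = (G i j)^2\<close>, and the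
  squares sum to at most \<open>|G i i| / |Im z|\<close>; cancelling \<open>|G i i|\<close> leaves
  one \<open>1 / |Im z|\<close>. The second one bounds the term \<open>G i i\<close> of the full
  trace.\<close>

lemma resolvent_trace_minor:
  "cmod ((\<Sum>j<N. G j j) - (\<Sum>j\<in>{..<N} - {i}. H j j)) \<le> 2 / \<bar>Im z\<bar>"
proof -
  let ?I = "{..<N} - {i}"
  have G0: "G i i \<noteq> 0" using resolvent_diag by auto
  have pos: "\<bar>Im z\<bar> > 0" using z by simp
  have e: "G i i * (G j j - H j j) = (G i j)\<^sup>2" if "j \<in> ?I" for j
  proof -
    have j: "j < N" "j \<noteq> i" using that by auto
    have "G j i = G i j" unfolding G_def by (rule resolvent_sym[OF A z i j(1)])
    then show ?thesis using resolvent_minor_expansion[OF j(1) j] resolvent_offdiag[OF j]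
      by (simp add: power2_eq_square)
  qed
  have "cmod (G i i) * cmod (\<Sum>j\<in>?I. G j j - H j j) = cmod (\<Sum>j\<in>?I. (G i j)\<^sup>2)"
    unfolding norm_mult[symmetric] sum_distrib_left using e by simp
  also have "\<dots> \<le> (\<Sum>j\<in>?I. (cmod (G i j))\<^sup>2)" by (intro sum_norm_le) (simp add: norm_power)
  also have "\<dots> \<le> (\<Sum>j<N. (cmod (G i j))\<^sup>2)" by (intro sum_mono2) auto
  also have "\<dots> \<le> cmod (G i i) * (1 / \<bar>Im z\<bar>)"
    using resolvent_row_norm(1)[OF A z i] unfolding G_def by simp
  finally have "cmod (\<Sum>j\<in>?I. G j j - H j j) \<le> 1 / \<bar>Im z\<bar>"
    using G0 by (subst (asm) mult_le_cancel_left_pos) auto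
  moreover have "cmod (G i i) \<le> 1 / \<bar>Im z\<bar>"
    unfolding G_def by (rule resolvent_row_norm(3)[OF A z i i])
  moreover have "(\<Sum>j<N. G j j) - (\<Sum>j\<in>?I. H j j) = G i i + (\<Sum>j\<in>?I. G j j - H j j)"
    using i by (simp add: sum.remove sum_subtractf)
  ultimately show ?thesis using norm_triangle_ineq[of "G i i" "\<Sum>j\<in>?I. G j j - H j j"] by simp
qed

lemma resolvent_offdiag_bound:
  assumes j: "j < N" "j \<noteq> i"
  shows "cmod (G i j) \<le> cmod (\<Sum>l\<in>{..<N} - {i}. A $$ (i, l) * H l j) / \<bar>Im z\<bar>"
  unfolding resolvent_offdiag[OF j] norm_mult norm_minus_cancel
  using mult_right_mono[OF resolvent_row_norm(3)[OF A z i i], of "cmod (\<Sum>l\<in>{..<N} - {i}. A $$ (i, l) * H l j)"]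
  by (simp add: G_def)

text \<open>If \<open>D\<close> is the denominator and \<open>E\<close> the error on the right, then
  \<open>G i i = 1 / (D + E)\<close>, so the difference is \<open>- G i i * E / D\<close>. Each of
  \<open>|G i i|\<close> and \<open>1 / |D|\<close> costs one \<open>1 / |Im z|\<close>.\<close>

lemma resolvent_diag_bound:
  fixes d :: real
  shows "cmod (G i i - 1 / (complex_of_real d - z - stieltjes N A z))
    \<le> cmod (A $$ (i, i) - d + stieltjes N A z
        - (\<Sum>k\<in>{..<N} - {i}. \<Sum>l\<in>{..<N} - {i}. A $$ (i, k) * A $$ (i, l) * H l k)) / (Im z)\<^sup>2"
proof -
  let ?m = "stieltjes N A z"
  let ?S = "\<Sum>k\<in>{..<N} - {i}. \<Sum>l\<in>{..<N} - {i}. A $$ (i, k) * A $$ (i, l) * H l k"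
  let ?D = "complex_of_real d - z - ?m"
  let ?E = "A $$ (i, i) - d + ?m - ?S"
  have den: "\<bar>Im z\<bar> \<le> cmod ?D" by (rule subordination_denominator[OF A z])
  have pos: "\<bar>Im z\<bar> > 0" using z by simp
  have D0: "?D \<noteq> 0" using den pos by auto
  have "G i i * (?D + ?E) = 1" using resolvent_diag by (simp add: algebra_simps)
  then have "G i i - 1 / ?D = - (G i i * ?E * (1 / ?D))" using D0 by (simp add: field_simps)
  then have "cmod (G i i - 1 / ?D) = cmod ?E * (cmod (G i i) * (1 / cmod ?D))"
    by (simp add: norm_mult norm_divide)
  also have "\<dots> \<le> cmod ?E * ((1 / \<bar>Im z\<bar>) * (1 / \<bar>Im z\<bar>))"
    using den pos resolvent_row_norm(3)[OF A z i i] unfolding G_def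
    by (intro mult_left_mono mult_mono frac_le) auto
  finally show ?thesis by (simp add: power2_eq_square)
qed

end

section \<open>Measurability\<close>

lemma measurable_eqI:
  assumes "g \<in> measurable M N" and "\<And>x. x \<in> space M \<Longrightarrow> f x = g x"
  shows "f \<in> measurable M N"
  using assms by (subst measurable_cong)

lemma borel_measurable_det:
  fixes B :: "'a \<Rightarrow> complex mat"
  assumes c: "\<And>\<omega>. \<omega> \<in> space S \<Longrightarrow> B \<omega> \<in> carrier_mat n n"
    and m: "\<And>i j. i < n \<Longrightarrow> j < n \<Longrightarrow> (\<lambda>\<omega>. B \<omega> $$ (i, j)) \<in> borel_measurable S"
  shows "(\<lambda>\<omega>. Determinant.det (B \<omega>)) \<in> borel_measurable S"
proof -
  have "(\<lambda>\<omega>. \<Sum>p | p permutes {0..<n}. signof p * (\<Prod>i = 0..<n. B \<omega> $$ (i, p i))) \<in> borel_measurable S"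
    by (intro borel_measurable_sum borel_measurable_times borel_measurable_const borel_measurable_prod m)
      (auto dest: permutes_in_image[THEN iffD2])
  then show ?thesis by (rule measurable_eqI) (rule det_def'[OF c])
qed

text \<open>The definition of \<open>resolvent\<close> runs an elimination procedure and gives no
  access to measurability. Cramer's rule replaces it by a quotient of determinants, which are
  polynomials in the entries.\<close>

lemma borel_measurable_resolvent:
  assumes A: "\<And>\<omega>. \<omega> \<in> space S \<Longrightarrow> symmetric_mat N (A \<omega>)"
    and m: "\<And>i j. i < N \<Longrightarrow> j < N \<Longrightarrow> (\<lambda>\<omega>. A \<omega> $$ (i, j)) \<in> borel_measurable S"
    and z: "Im z \<noteq> 0" and ij: "i < N" "j < N"
  shows "(\<lambda>\<omega>. resolvent N (A \<omega>) z $$ (i, j)) \<in> borel_measurable S"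
proof -
  have sm: "(\<lambda>\<omega>. shifted_mat N (A \<omega>) z $$ (k, l)) \<in> borel_measurable S" if "k < N" "l < N" for k l
  proof -
    have "(\<lambda>\<omega>. complex_of_real (A \<omega> $$ (k, l)) - (if k = l then z else 0)) \<in> borel_measurable S"
      using m[OF that] by (intro borel_measurable_diff borel_measurable_of_real) auto
    then show ?thesis by (rule measurable_eqI) (rule shifted_mat_index[OF A that])
  qed
  have 1: "(\<lambda>\<omega>. Determinant.det (shifted_mat N (A \<omega>) z)) \<in> borel_measurable S"
    by (intro borel_measurable_det[where n = N] sm shifted_mat_carrier A)
  have "(\<lambda>\<omega>. mat_delete (shifted_mat N (A \<omega>) z) j i $$ (k, l)) \<in> borel_measurable S"
    if kl: "k < N - 1" "l < N - 1" for k l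
  proof -
    have "mat_delete (shifted_mat N (A \<omega>) z) j i $$ (k, l)
        = shifted_mat N (A \<omega>) z $$ (if k < j then k else Suc k, if l < i then l else Suc l)"
      if "\<omega> \<in> space S" for \<omega>
      using shifted_mat_carrier[OF A[OF that], of z] kl by (auto simp: mat_delete_def)
    note e = this
    have "(\<lambda>\<omega>. shifted_mat N (A \<omega>) z $$ (if k < j then k else Suc k, if l < i then l else Suc l))
        \<in> borel_measurable S"
      using kl by (intro sm) auto
    then show ?thesis by (rule measurable_eqI) (rule e)
  qed
  then have 2: "(\<lambda>\<omega>. Determinant.det (mat_delete (shifted_mat N (A \<omega>) z) j i)) \<in> borel_measurable S"
    by (intro borel_measurable_det[where n = "N - 1"] mat_delete_carrier[where m = N and n = N] shifted_mat_carrier A)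
  have "(\<lambda>\<omega>. cofactor (shifted_mat N (A \<omega>) z) j i / Determinant.det (shifted_mat N (A \<omega>) z)) \<in> borel_measurable S"
    unfolding cofactor_def by (intro borel_measurable_divide borel_measurable_times borel_measurable_const 1 2)
  then show ?thesis by (rule measurable_eqI) (rule resolvent_adj_mat[OF A z ij])
qed

lemma borel_measurable_stieltjes:
  assumes A: "\<And>\<omega>. \<omega> \<in> space S \<Longrightarrow> symmetric_mat N (A \<omega>)"
    and m: "\<And>i j. i < N \<Longrightarrow> j < N \<Longrightarrow> (\<lambda>\<omega>. A \<omega> $$ (i, j)) \<in> borel_measurable S"
    and z: "Im z \<noteq> 0"
  shows "(\<lambda>\<omega>. stieltjes N (A \<omega>) z) \<in> borel_measurable S"
proof -
  have "(\<lambda>\<omega>. (\<Sum>i<N. resolvent N (A \<omega>) z $$ (i, i)) / of_nat N) \<in> borel_measurable S"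
    by (intro borel_measurable_divide borel_measurable_sum borel_measurable_const
        borel_measurable_resolvent[OF A m z]) auto
  then show ?thesis by (rule measurable_eqI) (rule stieltjes_eq_trace[OF A z])
qed

section \<open>Even moments of linear and quadratic forms\<close>

text \<open>The constant and linear terms in \<open>y\<close> are kept exact, because the linear one
  integrates to zero for centered \<open>y\<close>. The remaining monomials are interpolated between
  the two extreme ones, and their binomial coefficients sum to at most 2^(2p) = 4^p.\<close>

lemma even_power_expansion_le:
  fixes a y :: real
  assumes p: "p \<ge> 1"
  shows "(a + y) ^ (2 * p) \<le> a ^ (2 * p) + 2 * real p * a ^ (2 * p - 1) * y
    + 4 ^ p * (a ^ (2 * p - 2) * y\<^sup>2 + y ^ (2 * p))"
proof -
  define m where "m = 2 * p - 2"
  have n: "2 * p = Suc (Suc m)" using p by (simp add: m_def)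
  have ev: "even m" using p by (simp add: m_def)
  \<comment> \<open>Trading the surplus powers of the smaller of |y| and |a| for powers of the
    larger leads to one of the two extreme monomials.\<close>
  have monomial: "y ^ (k + 2) * a ^ (m - k) \<le> a ^ m * y\<^sup>2 + y ^ Suc (Suc m)" if k: "k \<le> m" for k
  proof -
    have "y ^ (k + 2) * a ^ (m - k) \<le> \<bar>y\<bar> ^ (k + 2) * \<bar>a\<bar> ^ (m - k)"
      by (metis abs_ge_self abs_mult power_abs)
    also have "\<dots> \<le> \<bar>a\<bar> ^ m * \<bar>y\<bar>\<^sup>2 + \<bar>y\<bar> ^ Suc (Suc m)"
    proof (cases "\<bar>y\<bar> \<le> \<bar>a\<bar>")
      case True
      have "\<bar>y\<bar> ^ (k + 2) * \<bar>a\<bar> ^ (m - k) = \<bar>y\<bar> ^ k * \<bar>a\<bar> ^ (m - k) * \<bar>y\<bar>\<^sup>2"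
        by (simp add: power_add power2_eq_square)
      also have "\<dots> \<le> \<bar>a\<bar> ^ k * \<bar>a\<bar> ^ (m - k) * \<bar>y\<bar>\<^sup>2"
        using True by (intro mult_right_mono power_mono) auto
      also have "\<dots> = \<bar>a\<bar> ^ m * \<bar>y\<bar>\<^sup>2" using k by (simp add: power_add[symmetric])
      finally show ?thesis by (smt (verit) zero_le_power abs_ge_zero)
    next
      case False
      have "\<bar>y\<bar> ^ (k + 2) * \<bar>a\<bar> ^ (m - k) \<le> \<bar>y\<bar> ^ (k + 2) * \<bar>y\<bar> ^ (m - k)"
        using False by (intro mult_left_mono power_mono) auto
      also have "\<dots> = \<bar>y\<bar> ^ Suc (Suc m)" using k by (simp add: power_add[symmetric] del: power_Suc)
      finally show ?thesis by (smt (verit) zero_le_power abs_ge_zero mult_nonneg_nonneg)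
    qed
    also have "\<dots> = a ^ m * y\<^sup>2 + y ^ Suc (Suc m)" using ev by (simp add: power_even_abs del: power_Suc)
    finally show ?thesis .
  qed
  let ?n = "Suc (Suc m)"
  have "(a + y) ^ ?n = (\<Sum>k\<le>?n. (?n choose k) * y ^ k * a ^ (?n - k))"
    using binomial_ring[of y a ?n] by (simp add: add.commute)
  also have "\<dots> = a ^ ?n + ?n * y * a ^ Suc m + (\<Sum>k\<le>m. (?n choose (k + 2)) * (y ^ (k + 2) * a ^ (m - k)))"
    by (subst sum.atMost_Suc_shift, subst sum.atMost_Suc_shift) (simp add: mult.assoc)
  also have "(\<Sum>k\<le>m. (?n choose (k + 2)) * (y ^ (k + 2) * a ^ (m - k)))
      \<le> (\<Sum>k\<le>m. (?n choose (k + 2)) * (a ^ m * y\<^sup>2 + y ^ ?n))"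
    by (intro sum_mono mult_left_mono monomial) auto
  also have "\<dots> = real (\<Sum>k\<le>m. (?n choose (k + 2))) * (a ^ m * y\<^sup>2 + y ^ ?n)"
    by (simp only: sum_distrib_right of_nat_sum)
  also have "real (\<Sum>k\<le>m. (?n choose (k + 2))) * (a ^ m * y\<^sup>2 + y ^ ?n)
      \<le> 4 ^ p * (a ^ m * y\<^sup>2 + y ^ ?n)"
  proof (intro mult_right_mono add_nonneg_nonneg mult_nonneg_nonneg)
    have "(\<Sum>k\<le>m. (?n choose (k + 2))) = (\<Sum>k\<in>(\<lambda>k. k + 2) ` {..m}. ?n choose k)"
      by (subst sum.reindex) (auto simp: inj_on_def)
    also have "\<dots> \<le> (\<Sum>k\<le>?n. ?n choose k)" by (intro sum_mono2) auto
    also have "\<dots> = 2 ^ ?n" by (rule choose_row_sum)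
    also have "\<dots> = 4 ^ p" unfolding n[symmetric] power_mult by simp
    finally show "real (\<Sum>k\<le>m. (?n choose (k + 2))) \<le> 4 ^ p"
      by (metis of_nat_le_iff of_nat_numeral of_nat_power)
    show "0 \<le> y ^ ?n" using ev by (intro zero_le_even_power) simp
  qed (use ev in \<open>auto intro!: zero_le_even_power\<close>)
  finally have "(a + y) ^ ?n \<le> a ^ ?n + ?n * y * a ^ Suc m + 4 ^ p * (a ^ m * y\<^sup>2 + y ^ ?n)" by simp
  moreover have "2 * real p = real ?n" using arg_cong[OF n, of real] by simp
  ultimately show ?thesis unfolding n by (simp add: mult_ac del: power_Suc of_nat_Suc)
qed

text \<open>These are terms of the binomial expansion, reassembled into one p-th power so that the
  one-variable bound can be iterated. For \<open>p = 1\<close> the last two would be the same term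
  counted twice, hence \<open>p \<ge> 2\<close>.\<close>

lemma three_term_le_power_add:
  fixes x u :: real
  assumes "x \<ge> 0" "u \<ge> 0" "p \<ge> 2"
  shows "x ^ p + p * x ^ (p - 1) * u + u ^ p \<le> (x + u) ^ p"
  using assms(3)
proof (induction p rule: dec_induct)
  case base
  then show ?case by (simp add: power2_eq_square algebra_simps)
next
  case (step p)
  then obtain q where q: "p = Suc q" by (cases p) auto
  have "x ^ Suc p + Suc p * x ^ p * u + u ^ Suc p
      \<le> (x + u) * (x ^ p + p * x ^ (p - 1) * u + u ^ p)"
    using assms(1,2) unfolding q by (simp add: algebra_simps)
  also have "\<dots> \<le> (x + u) * (x + u) ^ p" using assms step.IH by (intro mult_left_mono) auto
  finally show ?case by simp
qed

text \<open>The class has to contain both the scaled entries and their centered squares, so the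
  variance is left free and controlled through \<open>K\<close>.\<close>

definition centered_moment :: "nat \<Rightarrow> real \<Rightarrow> real measure \<Rightarrow> bool" where
  "centered_moment p K L \<longleftrightarrow> prob_space L \<and> sets L = sets borel
     \<and> integrable L (\<lambda>x. x ^ (2 * p)) \<and> (LINT x|L. x) = 0 \<and> (LINT x|L. x ^ (2 * p)) \<le> K"

text \<open>\<open>4 ^ p\<close> comes from the binomial coefficients; \<open>1 + K\<close>
  dominates the second and the 2p-th moment at once.\<close>

definition chaos_const :: "nat \<Rightarrow> real \<Rightarrow> real" where
  "chaos_const p K = 4 ^ p * (1 + K)"

lemma abs_power_le_one_plus:
  fixes x :: real
  assumes "k \<le> n"
  shows "\<bar>x\<bar> ^ k \<le> 1 + \<bar>x\<bar> ^ n"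
proof (cases "\<bar>x\<bar> \<le> 1")
  case True
  then have "\<bar>x\<bar> ^ k \<le> 1" by (intro power_le_one) auto
  then show ?thesis by (smt (verit) zero_le_power abs_ge_zero)
next
  case False
  then have "\<bar>x\<bar> ^ k \<le> \<bar>x\<bar> ^ n" using assms by (intro power_increasing) auto
  then show ?thesis by simp
qed

text \<open>The one-variable case of a hypercontractive estimate. The right side is the p-th power
  of a quadratic expression in \<open>a\<close> and \<open>b\<close>, so these may be functions of
  variables still to be integrated.\<close>

lemma centered_moment_affine:
  assumes L: "centered_moment p K L" and p: "p \<ge> 2"
  shows "(\<integral>\<^sup>+x. ennreal ((a + x * b) ^ (2 * p)) \<partial>L) \<le> ennreal ((a\<^sup>2 + chaos_const p K * b\<^sup>2) ^ p)"
proof -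
  interpret prob_space L using L by (simp add: centered_moment_def)
  have [measurable_cong]: "sets L = sets borel" and int: "integrable L (\<lambda>x. x ^ (2 * p))"
    and mean: "(LINT x|L. x) = 0" and K: "(LINT x|L. x ^ (2 * p)) \<le> K"
    using L by (auto simp: centered_moment_def)
  have int_dom: "integrable L (\<lambda>x. x ^ k)" if "k \<le> 2 * p" for k
  proof (rule Bochner_Integration.integrable_bound[where f = "\<lambda>x. 1 + x ^ (2 * p)"])
    show "integrable L (\<lambda>x. 1 + x ^ (2 * p))" using int by simp
    show "AE x in L. norm (x ^ k) \<le> norm (1 + x ^ (2 * p))"
      using abs_power_le_one_plus[OF that] by (intro AE_I2) (simp add: power_abs power_even_abs)
  qed simp
  have "1 \<le> 2 * p" "2 \<le> 2 * p" using p by auto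
  from int_dom[OF this(1)] int_dom[OF this(2)]
  have i1: "integrable L (\<lambda>x. x)" and i2: "integrable L (\<lambda>x. x\<^sup>2)" unfolding power_one_right .
  have "0 \<le> (LINT x|L. x ^ (2 * p))" by (intro Bochner_Integration.integral_nonneg) simp
  then have K0: "0 \<le> K" using K by linarith
  have var: "(LINT x|L. x\<^sup>2) \<le> 1 + K"
  proof -
    have "(LINT x|L. x\<^sup>2) \<le> (LINT x|L. 1 + x ^ (2 * p))"
      using i2 int abs_power_le_one_plus[of 2 "2 * p"] p by (intro integral_mono) (auto simp: power_even_abs)
    also have "\<dots> \<le> 1 + K" using int K by (simp add: prob_space)
    finally show ?thesis .
  qed
  let ?F = "\<lambda>x. a ^ (2 * p) + 2 * real p * a ^ (2 * p - 1) * (x * b)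
    + 4 ^ p * (a ^ (2 * p - 2) * (x * b)\<^sup>2 + (x * b) ^ (2 * p))"
  have iF: "integrable L ?F" using i1 i2 int by (simp add: power_mult_distrib)
  have le: "(a + x * b) ^ (2 * p) \<le> ?F x" for x
    using p by (intro even_power_expansion_le) simp
  have "(\<integral>\<^sup>+x. ennreal ((a + x * b) ^ (2 * p)) \<partial>L) \<le> (\<integral>\<^sup>+x. ennreal (?F x) \<partial>L)"
    by (intro nn_integral_mono ennreal_leI le)
  also have "\<dots> = ennreal (LINT x|L. ?F x)"
  proof (rule nn_integral_eq_integral[OF iF])
    show "AE x in L. 0 \<le> ?F x"
      by (intro AE_I2 order.trans[OF _ le]) simp
  qed
  \<comment> \<open>The mean zero of \<open>L\<close> removes the linear term.\<close>
  also have "(LINT x|L. ?F x) = a ^ (2 * p) + 4 ^ p * (a ^ (2 * p - 2) * b\<^sup>2 * (LINT x|L. x\<^sup>2)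
      + b ^ (2 * p) * (LINT x|L. x ^ (2 * p)))"
    using i1 i2 int by (simp add: power_mult_distrib mean prob_space mult_ac)
  also have "\<dots> \<le> a ^ (2 * p) + 4 ^ p * (a ^ (2 * p - 2) * b\<^sup>2 * (1 + K) + b ^ (2 * p) * (1 + K))"
    using var K by (intro add_left_mono mult_left_mono add_mono) (auto intro!: mult_nonneg_nonneg zero_le_even_power)
  \<comment> \<open>The constant is at least 1, so it may be raised to the power \<open>p\<close> in
    the last term; the factor \<open>p\<close> of the middle term is at least 1 too.\<close>
  also have "\<dots> \<le> (a\<^sup>2) ^ p + p * (a\<^sup>2) ^ (p - 1) * (chaos_const p K * b\<^sup>2) + (chaos_const p K * b\<^sup>2) ^ p"
  proof -
    have c1: "chaos_const p K \<ge> 1" unfolding chaos_const_def using K0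
      by (intro order.trans[OF _ mult_mono[of 1 "4 ^ p" 1 "1 + K"]]) auto
    have e: "2 * p - 2 = 2 * (p - 1)" by simp
    have "4 ^ p * (a ^ (2 * p - 2) * b\<^sup>2 * (1 + K)) = 1 * (a\<^sup>2) ^ (p - 1) * (chaos_const p K * b\<^sup>2)"
      unfolding e power_mult chaos_const_def by simp
    also have "\<dots> \<le> p * (a\<^sup>2) ^ (p - 1) * (chaos_const p K * b\<^sup>2)"
      using c1 p by (intro mult_right_mono) auto
    finally have 1: "4 ^ p * (a ^ (2 * p - 2) * b\<^sup>2 * (1 + K)) \<le> p * (a\<^sup>2) ^ (p - 1) * (chaos_const p K * b\<^sup>2)" .
    have "chaos_const p K ^ 1 \<le> chaos_const p K ^ p" using c1 p by (intro power_increasing) auto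
    then have "chaos_const p K * (b\<^sup>2) ^ p \<le> chaos_const p K ^ p * (b\<^sup>2) ^ p"
      by (intro mult_right_mono) auto
    then have 2: "4 ^ p * (b ^ (2 * p) * (1 + K)) \<le> (chaos_const p K * b\<^sup>2) ^ p"
      unfolding power_mult[of b] power_mult_distrib[of "chaos_const p K"] by (simp add: chaos_const_def mult_ac)
    show ?thesis using 1 2 by (simp add: power_mult distrib_left)
  qed
  also have "\<dots> \<le> (a\<^sup>2 + chaos_const p K * b\<^sup>2) ^ p"
    using p K0 by (intro three_term_le_power_add) (auto simp: chaos_const_def)
  finally show ?thesis by (simp add: ennreal_leI)
qed

lemma convex_on_power_nonneg: "convex_on {0 :: real..} (\<lambda>x. x ^ p)"
proof (cases "even p")
  case True
  then show ?thesis by (rule convex_on_subset[OF convex_power_even]) auto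
qed (rule convex_power_odd)

text \<open>Jensen's inequality for the p-th power at the points \<open>u / s\<close> and
  \<open>w / t\<close> with weights proportional to \<open>s\<close> and \<open>t\<close>, cleared
  of denominators.\<close>

lemma power_add_le_weighted:
  fixes u w s t :: real
  assumes u: "u \<ge> 0" and w: "w \<ge> 0" and s: "s > 0" and t: "t > 0" and p: "p \<ge> 1"
  shows "(u + w) ^ p * (s * t) ^ p \<le> (s + t) ^ (p - 1) * (s * (u * t) ^ p + t * (w * s) ^ p)"
proof -
  obtain q where Suc: "p = Suc q" using p by (cases p) auto
  have jensen: "(s * x + t * y) ^ Suc q \<le> (s + t) ^ q * (s * x ^ Suc q + t * y ^ Suc q)"
    if xy: "x \<ge> 0" "y \<ge> 0" for x y :: real
  proof -
    have st: "s + t > 0" using s t by simp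
    let ?a = "t / (s + t)"
    have a: "1 - ?a = s / (s + t)" using st by (simp add: diff_divide_eq_iff)
    have "((1 - ?a) *\<^sub>R x + ?a *\<^sub>R y) ^ Suc q \<le> (1 - ?a) * x ^ Suc q + ?a * y ^ Suc q"
      using xy s t by (intro convex_onD[OF convex_on_power_nonneg]) auto
    moreover have "(1 - ?a) *\<^sub>R x + ?a *\<^sub>R y = (s * x + t * y) / (s + t)"
      unfolding a by (simp add: add_divide_distrib)
    moreover have "(1 - ?a) * x ^ Suc q + ?a * y ^ Suc q = (s * x ^ Suc q + t * y ^ Suc q) / (s + t)"
      unfolding a by (simp add: add_divide_distrib)
    ultimately have "(s * x + t * y) ^ Suc q / (s + t) ^ Suc q \<le> (s * x ^ Suc q + t * y ^ Suc q) / (s + t)"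
      by (simp only: power_divide)
    then have "(s * x + t * y) ^ Suc q \<le> (s * x ^ Suc q + t * y ^ Suc q) / (s + t) * (s + t) ^ Suc q"
      using st by (simp only: pos_divide_le_eq[OF zero_less_power[OF st]])
    also have "\<dots> = (s + t) ^ q * (s * x ^ Suc q + t * y ^ Suc q)"
      using st by simp
    finally show ?thesis .
  qed
  have "(u + w) ^ p * (s * t) ^ p = (s * (u * t) + t * (w * s)) ^ Suc q"
    unfolding Suc power_mult_distrib[symmetric] by (simp add: algebra_simps)
  also have "\<dots> \<le> (s + t) ^ q * (s * (u * t) ^ Suc q + t * (w * s) ^ Suc q)"
    using u w s t by (intro jensen) auto
  finally show ?thesis by (simp add: Suc)
qed

text \<open>The triangle inequality in L^p for \<open>f^2\<close> and \<open>c * g^2\<close>, whose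
  norms are at most \<open>s\<close> and \<open>c * t\<close>. With Jensen weights proportional to
  these very bounds the two contributions add up to exactly \<open>(s + c * t) ^ p\<close>.\<close>

lemma nn_integral_power_add_le:
  assumes [measurable]: "f \<in> borel_measurable M" "g \<in> borel_measurable M"
    and f: "(\<integral>\<^sup>+x. ennreal ((f x :: real) ^ (2 * p)) \<partial>M) \<le> ennreal (s ^ p)"
    and g: "(\<integral>\<^sup>+x. ennreal ((g x :: real) ^ (2 * p)) \<partial>M) \<le> ennreal (t ^ p)"
    and s: "s > 0" and t: "t > 0" and c: "c > 0" and p: "p \<ge> 1"
  shows "(\<integral>\<^sup>+x. ennreal (((f x)\<^sup>2 + c * (g x)\<^sup>2) ^ p) \<partial>M) \<le> ennreal ((s + c * t) ^ p)"
proof -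
  define K1 where "K1 = (s + c * t) ^ (p - 1) * s / s ^ p"
  define K2 where "K2 = (s + c * t) ^ (p - 1) * (c * t) / t ^ p"
  have K: "K1 \<ge> 0" "K2 \<ge> 0" unfolding K1_def K2_def using s t c by auto
  have pw: "((f x)\<^sup>2 + c * (g x)\<^sup>2) ^ p \<le> K1 * f x ^ (2 * p) + K2 * g x ^ (2 * p)" for x
  proof -
    have "((f x)\<^sup>2 + c * (g x)\<^sup>2) ^ p * (s * (c * t)) ^ p
      \<le> (s + c * t) ^ (p - 1) * (s * ((f x)\<^sup>2 * (c * t)) ^ p + c * t * (c * (g x)\<^sup>2 * s) ^ p)"
      using s t c p by (intro power_add_le_weighted) auto
    also have "\<dots> = (K1 * f x ^ (2 * p) + K2 * g x ^ (2 * p)) * (s * (c * t)) ^ p"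
      using s t c unfolding K1_def K2_def power_mult power_mult_distrib by (simp add: field_simps)
    finally show ?thesis using s t c by (subst (asm) mult_le_cancel_right_pos) auto
  qed
  have "(\<integral>\<^sup>+x. ennreal (((f x)\<^sup>2 + c * (g x)\<^sup>2) ^ p) \<partial>M)
     \<le> (\<integral>\<^sup>+x. ennreal K1 * ennreal (f x ^ (2 * p)) + ennreal K2 * ennreal (g x ^ (2 * p)) \<partial>M)"
    using K by (intro nn_integral_mono) (simp add: ennreal_mult'[symmetric] ennreal_plus[symmetric] pw ennreal_leI del: ennreal_plus)
  also have "\<dots> = ennreal K1 * (\<integral>\<^sup>+x. ennreal (f x ^ (2 * p)) \<partial>M) + ennreal K2 * (\<integral>\<^sup>+x. ennreal (g x ^ (2 * p)) \<partial>M)"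
    by (simp add: nn_integral_add nn_integral_cmult)
  also have "\<dots> \<le> ennreal K1 * ennreal (s ^ p) + ennreal K2 * ennreal (t ^ p)"
    using f g by (intro add_mono mult_left_mono) auto
  also have "\<dots> = ennreal (K1 * s ^ p + K2 * t ^ p)"
    using K s t by (simp add: ennreal_mult'[symmetric] ennreal_plus[symmetric] del: ennreal_plus)
  also have "K1 * s ^ p + K2 * t ^ p = (s + c * t) ^ (p - 1) * (s + c * t)"
    using s t unfolding K1_def K2_def by (simp add: algebra_simps)
  also have "\<dots> = (s + c * t) ^ p" using p by (cases p) auto
  finally show ?thesis .
qed

section \<open>Moments of forms in independent variables, one variable at a time\<close>

context
  fixes L :: "'i \<Rightarrow> real measure" and p :: nat and K :: real
  assumes L: "\<And>i. centered_moment p K (L i)" and p: "p \<ge> 2"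
begin

lemma chaos_const_pos: "chaos_const p K > 0"
proof -
  have "0 \<le> (LINT x|L i. x ^ (2 * p))" for i by (intro Bochner_Integration.integral_nonneg) simp
  then have "K \<ge> 0" using L unfolding centered_moment_def by (meson order.trans)
  then show ?thesis by (simp add: chaos_const_def)
qed

interpretation product_sigma_finite L
  using L unfolding product_sigma_finite_def centered_moment_def
  by (auto intro: prob_space_imp_sigma_finite)

lemma sets_L [measurable_cong]: "sets (L i) = sets borel"
  using L by (auto simp: centered_moment_def)

lemma borel_measurable_PiM_component [measurable]: "i \<in> I \<Longrightarrow> (\<lambda>x. x i) \<in> borel_measurable (PiM I L)"
  using measurable_component_singleton[of i I L] measurable_cong_sets[OF refl sets_L] by blast

lemma prob_space_PiM_L: "prob_space (PiM I L)"
  using L by (intro prob_space_PiM) (auto simp: centered_moment_def)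

text \<open>
  One step of the induction over the variables: integrating out \<open>x\<^sub>j\<close> first leaves
  \<open>(f\<^sup>2 + c g\<^sup>2)\<^sup>p\<close>, and convexity of the \<open>p\<close>-th power replaces Minkowski's inequality.
\<close>

lemma nn_integral_chaos_step:
  assumes I: "finite I" "j \<notin> I"
    and [measurable]: "f \<in> borel_measurable (PiM I L)" "g \<in> borel_measurable (PiM I L)"
      "h \<in> borel_measurable (PiM (insert j I) L)"
    and h: "\<And>x y. h (x(j := y)) = f x + y * g x"
    and f: "(\<integral>\<^sup>+x. ennreal ((f x :: real) ^ (2 * p)) \<partial>PiM I L) \<le> ennreal (s ^ p)"
    and g: "(\<integral>\<^sup>+x. ennreal ((g x :: real) ^ (2 * p)) \<partial>PiM I L) \<le> ennreal (t ^ p)"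
    and st: "s > 0" "t > 0"
  shows "(\<integral>\<^sup>+x. ennreal (h x ^ (2 * p)) \<partial>PiM (insert j I) L) \<le> ennreal ((s + chaos_const p K * t) ^ p)"
proof -
  have "(\<integral>\<^sup>+x. ennreal (h x ^ (2 * p)) \<partial>PiM (insert j I) L)
      = (\<integral>\<^sup>+x. \<integral>\<^sup>+y. ennreal (h (x(j := y)) ^ (2 * p)) \<partial>L j \<partial>PiM I L)"
    by (rule product_nn_integral_insert[OF I]) measurable
  also have "\<dots> \<le> (\<integral>\<^sup>+x. ennreal (((f x)\<^sup>2 + chaos_const p K * (g x)\<^sup>2) ^ p) \<partial>PiM I L)"
    unfolding h by (intro nn_integral_mono centered_moment_affine L p)
  also have "\<dots> \<le> ennreal ((s + chaos_const p K * t) ^ p)"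
    using p st chaos_const_pos by (intro nn_integral_power_add_le f g) auto
  finally show ?thesis .
qed

text \<open>
  The hypothesis on \<open>s\<close> is strict because the step needs positive bounds for \<open>f\<close> and \<open>g\<close> even
  when all coefficients vanish; the excess is shared between the two.
\<close>

lemma moment_linear_form:
  assumes "finite I" and "s > chaos_const p K * (\<Sum>i\<in>I. (a i)\<^sup>2)"
  shows "(\<integral>\<^sup>+x. ennreal ((\<Sum>i\<in>I. a i * x i) ^ (2 * p)) \<partial>PiM I L) \<le> ennreal (s ^ p)"
  using assms
proof (induction I arbitrary: s rule: finite_induct)
  case empty
  then show ?case using p by (simp add: power_0_left)
next
  case (insert j I)
  let ?c = "chaos_const p K"
  define g where "g = s - ?c * (\<Sum>i\<in>insert j I. (a i)\<^sup>2)"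
  have g: "g > 0" using insert.prems by (simp add: g_def)
  define s1 where "s1 = ?c * (\<Sum>i\<in>I. (a i)\<^sup>2) + g / 2"
  define t where "t = (a j)\<^sup>2 + g / (2 * ?c)"
  have c: "?c > 0" by (rule chaos_const_pos)
  interpret P: prob_space "PiM I L" by (rule prob_space_PiM_L)
  have s1: "s1 > 0" "s1 > ?c * (\<Sum>i\<in>I. (a i)\<^sup>2)" and t: "t > 0" "(a j)\<^sup>2 \<le> t"
    using g c by (auto simp: s1_def t_def intro!: add_nonneg_pos sum_nonneg mult_nonneg_nonneg)
  have eq: "s1 + ?c * t = s" using insert.hyps c by (simp add: s1_def t_def g_def field_simps)
  have "(\<integral>\<^sup>+x. ennreal ((\<Sum>i\<in>insert j I. a i * x i) ^ (2 * p)) \<partial>PiM (insert j I) L) \<le> ennreal ((s1 + ?c * t) ^ p)"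
  proof (rule nn_integral_chaos_step[where f = "\<lambda>x. \<Sum>i\<in>I. a i * x i" and g = "\<lambda>x. a j"])
    show "(\<Sum>i\<in>insert j I. a i * (x(j := y)) i) = (\<Sum>i\<in>I. a i * x i) + y * a j" for x y
    proof -
      have "(\<Sum>i\<in>I. a i * (x(j := y)) i) = (\<Sum>i\<in>I. a i * x i)"
        using insert.hyps by (intro sum.cong) auto
      then show ?thesis using insert.hyps by simp
    qed
    show "(\<integral>\<^sup>+x. ennreal ((\<Sum>i\<in>I. a i * x i) ^ (2 * p)) \<partial>PiM I L) \<le> ennreal (s1 ^ p)"
      using s1 by (intro insert.IH)
    show "(\<integral>\<^sup>+x. ennreal (a j ^ (2 * p)) \<partial>PiM I L) \<le> ennreal (t ^ p)"
      using t by (simp add: P.emeasure_space_1 power_mult power_mono ennreal_leI)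
  qed (use insert.hyps s1 t in auto)
  then show ?case unfolding eq .
qed

text \<open>Setting \<open>x j\<close> apart leaves a quadratic form in the other variables plus
  \<open>x j\<close> times a linear form with coefficients \<open>a i j + a j i\<close>. The moment
  of that linear form costs one \<open>chaos_const\<close>, integrating \<open>x j\<close> a second
  one, and the 2 comes from \<open>(x + y)^2 \<le> 2 (x^2 + y^2)\<close>.\<close>

lemma moment_offdiag_quadratic_form:
  assumes "finite I" and "s > 2 * (chaos_const p K)\<^sup>2 * (\<Sum>i\<in>I. \<Sum>k\<in>I - {i}. (a i k)\<^sup>2)"
  shows "(\<integral>\<^sup>+x. ennreal ((\<Sum>i\<in>I. \<Sum>k\<in>I - {i}. a i k * x i * x k) ^ (2 * p)) \<partial>PiM I L) \<le> ennreal (s ^ p)"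
  using assms
proof (induction I arbitrary: s rule: finite_induct)
  case empty
  then show ?case using p by (simp add: power_0_left)
next
  case (insert j I)
  let ?c = "chaos_const p K"
  have split: "(\<Sum>i\<in>insert j I. \<Sum>k\<in>insert j I - {i}. F i k)
      = (\<Sum>i\<in>I. \<Sum>k\<in>I - {i}. F i k) + (\<Sum>i\<in>I. F i j + F j i)" for F :: "'i \<Rightarrow> 'i \<Rightarrow> real"
  proof -
    have 1: "(\<Sum>k\<in>insert j I - {i}. F i k) = F i j + (\<Sum>k\<in>I - {i}. F i k)" if "i \<in> I" for i
    proof -
      have "insert j I - {i} = insert j (I - {i})" using that insert.hyps by auto
      then show ?thesis using insert.hyps by simp
    qed
    have "insert j I - {j} = I" using insert.hyps by auto
    then show ?thesis using insert.hyps 1 by (simp add: sum.distrib)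
  qed
  define g where "g = s - 2 * ?c\<^sup>2 * (\<Sum>i\<in>insert j I. \<Sum>k\<in>insert j I - {i}. (a i k)\<^sup>2)"
  have g: "g > 0" using insert.prems by (simp add: g_def)
  define s1 where "s1 = 2 * ?c\<^sup>2 * (\<Sum>i\<in>I. \<Sum>k\<in>I - {i}. (a i k)\<^sup>2) + g / 2"
  \<comment> \<open>The step multiplies \<open>t\<close> by \<open>?c\<close>, which turns its
    excess into \<open>g / 2\<close>; with the \<open>g / 2\<close> in \<open>s1\<close> the slack
    \<open>g\<close> is used up exactly.\<close>
  define t where "t = ?c * (\<Sum>i\<in>I. (a i j + a j i)\<^sup>2) + g / (2 * ?c)"
  have c: "?c > 0" by (rule chaos_const_pos)
  have s1: "s1 > 0" "s1 > 2 * ?c\<^sup>2 * (\<Sum>i\<in>I. \<Sum>k\<in>I - {i}. (a i k)\<^sup>2)"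
    and t: "t > 0" "?c * (\<Sum>i\<in>I. (a i j + a j i)\<^sup>2) < t"
    using g c by (auto simp: s1_def t_def intro!: add_nonneg_pos sum_nonneg mult_nonneg_nonneg)
  have square: "(x + y)\<^sup>2 \<le> 2 * (x\<^sup>2 + y\<^sup>2)" for x y :: real
    using sum_squares_bound[of x y] by (simp add: power2_sum)
  have "(\<Sum>i\<in>I. (a i j + a j i)\<^sup>2) \<le> 2 * (\<Sum>i\<in>I. (a i j)\<^sup>2 + (a j i)\<^sup>2)"
    unfolding sum_distrib_left by (intro sum_mono square)
  then have "?c\<^sup>2 * (\<Sum>i\<in>I. (a i j + a j i)\<^sup>2) \<le> ?c\<^sup>2 * (2 * (\<Sum>i\<in>I. (a i j)\<^sup>2 + (a j i)\<^sup>2))"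
    by (intro mult_left_mono) auto
  then have le: "s1 + ?c * t \<le> s"
    using c unfolding s1_def t_def g_def split by (simp add: field_simps power2_eq_square)
  have "(\<integral>\<^sup>+x. ennreal ((\<Sum>i\<in>insert j I. \<Sum>k\<in>insert j I - {i}. a i k * x i * x k) ^ (2 * p)) \<partial>PiM (insert j I) L)
      \<le> ennreal ((s1 + ?c * t) ^ p)"
  proof (rule nn_integral_chaos_step[where f = "\<lambda>x. \<Sum>i\<in>I. \<Sum>k\<in>I - {i}. a i k * x i * x k"
        and g = "\<lambda>x. \<Sum>i\<in>I. (a i j + a j i) * x i"])
    show "(\<Sum>i\<in>insert j I. \<Sum>k\<in>insert j I - {i}. a i k * (x(j := y)) i * (x(j := y)) k)
        = (\<Sum>i\<in>I. \<Sum>k\<in>I - {i}. a i k * x i * x k) + y * (\<Sum>i\<in>I. (a i j + a j i) * x i)" for x y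
    proof -
      have 1: "(\<Sum>i\<in>I. \<Sum>k\<in>I - {i}. a i k * (x(j := y)) i * (x(j := y)) k)
          = (\<Sum>i\<in>I. \<Sum>k\<in>I - {i}. a i k * x i * x k)"
        using insert.hyps by (intro sum.cong) auto
      have 2: "(\<Sum>i\<in>I. a i j * (x(j := y)) i * (x(j := y)) j + a j i * (x(j := y)) j * (x(j := y)) i)
          = y * (\<Sum>i\<in>I. (a i j + a j i) * x i)"
        unfolding sum_distrib_left using insert.hyps by (intro sum.cong) (auto simp: algebra_simps)
      show ?thesis unfolding split 1 2 ..
    qed
    show "(\<integral>\<^sup>+x. ennreal ((\<Sum>i\<in>I. \<Sum>k\<in>I - {i}. a i k * x i * x k) ^ (2 * p)) \<partial>PiM I L) \<le> ennreal (s1 ^ p)"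
      using s1 by (intro insert.IH)
    show "(\<integral>\<^sup>+x. ennreal ((\<Sum>i\<in>I. (a i j + a j i) * x i) ^ (2 * p)) \<partial>PiM I L) \<le> ennreal (t ^ p)"
      using t insert.hyps by (intro moment_linear_form)
  qed (use insert.hyps s1 t in auto)
  also have "\<dots> \<le> ennreal (s ^ p)"
    using le s1 t c by (intro ennreal_leI power_mono) auto
  finally show ?case .
qed

end

section \<open>Moments from stretched exponential tails\<close>

text \<open>Summing (n + 1)^k P(|X| > n) over the layers n < |X| <= n + 1 bounds the k-th absolute
  moment, with the assumed tail in place of the probability. The value does not involve N or the
  position of the entry.\<close>

definition stretched_moment :: "nat \<Rightarrow> real \<Rightarrow> real \<Rightarrow> real" where
  "stretched_moment k \<theta> \<theta>' = (\<Sum>n. real (Suc n) ^ k * (\<theta>' * exp (- (real n powr (1 / \<theta>)))))"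

lemma summable_stretched_moment:
  assumes "\<theta> > 0"
  shows "summable (\<lambda>n. real (Suc n) ^ k * (\<theta>' * exp (- (real n powr (1 / \<theta>)))))"
proof -
  have "(\<lambda>n::nat. (real n + 1) powr real k * exp (- (real n powr (1 / \<theta>)))) \<in> O(\<lambda>n. 1 / real n ^ 2)"
    using assms by real_asymp
  then have "summable (\<lambda>n::nat. (real n + 1) powr real k * exp (- (real n powr (1 / \<theta>))))"
    by (rule summable_comparison_test_bigo[rotated]) (simp add: inverse_power_summable flip: inverse_eq_divide)
  then have "summable (\<lambda>n::nat. \<theta>' * ((real n + 1) powr real k * exp (- (real n powr (1 / \<theta>)))))"
    by (rule summable_mult)
  then show ?thesis by (simp add: powr_realpow add.commute mult_ac)
qed

lemma (in prob_space) moment_of_stretched_tail: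
  assumes [measurable]: "X \<in> borel_measurable M" and \<theta>: "\<theta> > 0"
    and tail: "\<And>x. x \<ge> 0 \<Longrightarrow> prob {\<omega> \<in> space M. \<bar>X \<omega>\<bar> > x} \<le> \<theta>' * exp (- (x powr (1 / \<theta>)))"
    and k: "k > 0"
  shows "integrable M (\<lambda>\<omega>. \<bar>X \<omega>\<bar> ^ k)" and "expectation (\<lambda>\<omega>. \<bar>X \<omega>\<bar> ^ k) \<le> stretched_moment k \<theta> \<theta>'"
proof -
  let ?t = "\<lambda>n. real (Suc n) ^ k * (\<theta>' * exp (- (real n powr (1 / \<theta>))))"
  let ?A = "\<lambda>n. {\<omega> \<in> space M. \<bar>X \<omega>\<bar> > real n}"
  have t0: "0 \<le> ?t n" for n
  proof -
    have "0 \<le> \<theta>' * exp (- (real n powr (1 / \<theta>)))"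
      using order.trans[OF measure_nonneg tail, of "real n"] by simp
    then show ?thesis by simp
  qed
  have layer: "ennreal (\<bar>X \<omega>\<bar> ^ k) \<le> (\<Sum>n. ennreal (real (Suc n) ^ k) * indicator (?A n) \<omega>)" if \<omega>: "\<omega> \<in> space M" for \<omega>
  proof (cases "X \<omega> = 0")
    case False
    \<comment> \<open>Rounding up and subtracting 1 gives the strict \<open>n < |X|\<close> that the
      tail event asks for. The value 0 lies in no layer, and there \<open>k > 0\<close> makes the
      left side vanish.\<close>
    define n where "n = nat (\<lceil>\<bar>X \<omega>\<bar>\<rceil> - 1)"
    have "\<lceil>\<bar>X \<omega>\<bar>\<rceil> \<ge> 1" using False by simp
    then have n: "real n < \<bar>X \<omega>\<bar>" "\<bar>X \<omega>\<bar> \<le> real (Suc n)" unfolding n_def by linarith+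
    have "ennreal (\<bar>X \<omega>\<bar> ^ k) \<le> ennreal (real (Suc n) ^ k) * indicator (?A n) \<omega>"
      using n \<omega> by (auto intro!: ennreal_leI power_mono)
    also have "\<dots> \<le> (\<Sum>n. ennreal (real (Suc n) ^ k) * indicator (?A n) \<omega>)"
    proof -
      have "f n \<le> suminf f" for f :: "nat \<Rightarrow> ennreal"
        using sum_le_suminf[of f "{n}"] by simp
      then show ?thesis .
    qed
    finally show ?thesis .
  qed (use k in \<open>simp add: power_0_left\<close>)
  have "(\<integral>\<^sup>+\<omega>. ennreal (\<bar>X \<omega>\<bar> ^ k) \<partial>M) \<le> (\<integral>\<^sup>+\<omega>. (\<Sum>n. ennreal (real (Suc n) ^ k) * indicator (?A n) \<omega>) \<partial>M)"
    by (intro nn_integral_mono layer)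
  also have "\<dots> = (\<Sum>n. ennreal (real (Suc n) ^ k) * emeasure M (?A n))"
    by (subst nn_integral_suminf) (auto simp: nn_integral_cmult_indicator)
  also have "\<dots> \<le> (\<Sum>n. ennreal (?t n))"
  proof (intro suminf_le)
    fix n
    have "real (Suc n) ^ k * prob (?A n) \<le> ?t n" by (intro mult_left_mono tail) auto
    then show "ennreal (real (Suc n) ^ k) * emeasure M (?A n) \<le> ennreal (?t n)"
      unfolding emeasure_eq_measure by (subst ennreal_mult[symmetric]) (auto intro!: ennreal_leI)
  qed auto
  also have "\<dots> = ennreal (stretched_moment k \<theta> \<theta>')"
    unfolding stretched_moment_def by (intro suminf_ennreal2 t0 summable_stretched_moment \<theta>)
  finally have le: "(\<integral>\<^sup>+\<omega>. ennreal (\<bar>X \<omega>\<bar> ^ k) \<partial>M) \<le> ennreal (stretched_moment k \<theta> \<theta>')" .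
  show int: "integrable M (\<lambda>\<omega>. \<bar>X \<omega>\<bar> ^ k)"
    using le by (intro integrableI_nonneg) (auto simp: top_unique intro: le_less_trans)
  have "0 \<le> stretched_moment k \<theta> \<theta>'"
    unfolding stretched_moment_def by (intro suminf_nonneg summable_stretched_moment \<theta> t0)
  then show "expectation (\<lambda>\<omega>. \<bar>X \<omega>\<bar> ^ k) \<le> stretched_moment k \<theta> \<theta>'"
    using le by (subst (asm) nn_integral_eq_integral[OF int]) auto
qed

section \<open>From moments to tail probabilities under independence\<close>

section \<open>Freezing independent variables\<close>

context prob_space
begin

lemma indep_vars_reindex_inj:
  assumes X: "indep_vars (\<lambda>_. N) X J" and f: "inj_on f I" "f ` I \<subseteq> J"
  shows "indep_vars (\<lambda>_. N) (\<lambda>i. X (f i)) I"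
proof -
  have "indep_vars (\<lambda>i. PiM {f i} (\<lambda>_. N)) (\<lambda>i \<omega>. \<lambda>j\<in>{f i}. X j \<omega>) I"
    using f by (intro indep_vars_restrict[OF X]) (auto simp: disjoint_family_on_def inj_on_def)
  then have "indep_vars (\<lambda>_. N) (\<lambda>i \<omega>. (\<lambda>x. x (f i)) (\<lambda>j\<in>{f i}. X j \<omega>)) I"
    by (rule indep_vars_compose2) simp
  then show ?thesis by simp
qed

lemma prob_freeze_le:
  assumes ind: "indep_var S X T Y"
    and Q: "{xy \<in> space (S \<Otimes>\<^sub>M T). Q (fst xy) (snd xy)} \<in> sets (S \<Otimes>\<^sub>M T)"
    and le: "\<And>y. y \<in> space T \<Longrightarrow> prob {\<omega> \<in> space M. Q (X \<omega>) y} \<le> c"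
  shows "prob {\<omega> \<in> space M. Q (X \<omega>) (Y \<omega>)} \<le> c"
proof -
  have X[measurable]: "random_variable S X" and Y[measurable]: "random_variable T Y"
    and eq: "distr M S X \<Otimes>\<^sub>M distr M T Y = distr M (S \<Otimes>\<^sub>M T) (\<lambda>\<omega>. (X \<omega>, Y \<omega>))"
    using ind unfolding indep_var_distribution_eq by auto
  interpret DX: prob_space "distr M S X" by (rule prob_space_distr[OF X])
  interpret DY: prob_space "distr M T Y" by (rule prob_space_distr[OF Y])
  interpret pair_sigma_finite "distr M S X" "distr M T Y" ..
  let ?B = "{xy \<in> space (S \<Otimes>\<^sub>M T). Q (fst xy) (snd xy)}"
  obtain y0 where "y0 \<in> space T" using DY.not_empty by auto
  then have c: "c \<ge> 0" using order.trans[OF measure_nonneg le] by blast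
  have "emeasure M {\<omega> \<in> space M. Q (X \<omega>) (Y \<omega>)} = emeasure (distr M (S \<Otimes>\<^sub>M T) (\<lambda>\<omega>. (X \<omega>, Y \<omega>))) ?B"
    using Q by (subst emeasure_distr) (auto intro!: arg_cong[where f = "emeasure M"]
        dest: measurable_space[OF X] measurable_space[OF Y] simp: space_pair_measure)
  also have "\<dots> = (\<integral>\<^sup>+y. emeasure (distr M S X) ((\<lambda>x. (x, y)) -` ?B) \<partial>distr M T Y)"
    unfolding eq[symmetric] using Q by (intro emeasure_pair_measure_alt2) (simp cong: sets_pair_measure_cong)
  also have "\<dots> \<le> (\<integral>\<^sup>+y. ennreal c \<partial>distr M T Y)"
  proof (intro nn_integral_mono)
    fix y assume "y \<in> space (distr M T Y)"
    then have y: "y \<in> space T" by simp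
    have "(\<lambda>x. (x, y)) -` ?B \<in> sets S"
      using sets_Pair2[OF Q] by simp
    then have "emeasure (distr M S X) ((\<lambda>x. (x, y)) -` ?B) = emeasure M {\<omega> \<in> space M. Q (X \<omega>) y}"
      using y by (subst emeasure_distr) (auto intro!: arg_cong[where f = "emeasure M"]
        dest: measurable_space[OF X] simp: space_pair_measure)
    also have "\<dots> \<le> ennreal c" unfolding emeasure_eq_measure by (intro ennreal_leI le y)
    finally show "emeasure (distr M S X) ((\<lambda>x. (x, y)) -` ?B) \<le> ennreal c" .
  qed
  also have "\<dots> = ennreal c" using DY.emeasure_space_1 by simp
  finally show ?thesis using c unfolding emeasure_eq_measure by simp
qed

lemma prob_abs_ge_even_moment:
  assumes [measurable]: "f \<in> borel_measurable M" and t: "t > 0" and B: "B \<ge> 0"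
    and m: "(\<integral>\<^sup>+\<omega>. ennreal ((f \<omega> :: real) ^ (2 * p)) \<partial>M) \<le> ennreal B"
  shows "prob {\<omega> \<in> space M. t \<le> \<bar>f \<omega>\<bar>} \<le> B / t ^ (2 * p)"
proof -
  have "emeasure M {\<omega> \<in> space M. t \<le> \<bar>f \<omega>\<bar>}
      \<le> emeasure M {\<omega> \<in> space M. 1 \<le> ennreal (1 / t ^ (2 * p)) * ennreal (f \<omega> ^ (2 * p))}"
  proof (intro emeasure_mono)
    show "{\<omega> \<in> space M. t \<le> \<bar>f \<omega>\<bar>}
        \<subseteq> {\<omega> \<in> space M. 1 \<le> ennreal (1 / t ^ (2 * p)) * ennreal (f \<omega> ^ (2 * p))}"
    proof clarify
      fix \<omega> assume "\<omega> \<in> space M" "t \<le> \<bar>f \<omega>\<bar>"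
      then have "t ^ (2 * p) \<le> \<bar>f \<omega>\<bar> ^ (2 * p)" using t by (intro power_mono) auto
      then have "1 \<le> (1 / t ^ (2 * p)) * f \<omega> ^ (2 * p)" using t by (simp add: power_even_abs)
      then show "1 \<le> ennreal (1 / t ^ (2 * p)) * ennreal (f \<omega> ^ (2 * p))"
        using t by (simp add: ennreal_mult'[symmetric] del: power_mult)
    qed
  qed measurable
  also have "\<dots> \<le> ennreal (1 / t ^ (2 * p)) * (\<integral>\<^sup>+\<omega>. ennreal (f \<omega> ^ (2 * p)) * indicator (space M) \<omega> \<partial>M)"
    by (intro nn_integral_Markov_inequality) auto
  also have "\<dots> = ennreal (1 / t ^ (2 * p)) * (\<integral>\<^sup>+\<omega>. ennreal (f \<omega> ^ (2 * p)) \<partial>M)"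
    by (intro arg_cong[where f = "\<lambda>x. _ * x"] nn_integral_cong) simp
  also have "\<dots> \<le> ennreal (1 / t ^ (2 * p)) * ennreal B" by (intro mult_left_mono m) simp
  also have "\<dots> = ennreal (B / t ^ (2 * p))" using t B by (simp add: ennreal_mult'[symmetric])
  finally show ?thesis using t B unfolding emeasure_eq_measure by simp
qed

lemma nn_integral_indep_PiM:
  assumes ind: "indep_vars (\<lambda>_. borel) X I" and I: "I \<noteq> {}"
    and L: "\<And>i. i \<in> I \<Longrightarrow> L i = distr M borel (X i)"
    and F: "F \<in> borel_measurable (PiM I (\<lambda>_. borel))"
  shows "(\<integral>\<^sup>+\<omega>. F (\<lambda>i\<in>I. X i \<omega>) \<partial>M) = (\<integral>\<^sup>+x. F x \<partial>PiM I L)"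
proof -
  have rv: "random_variable borel (X i)" if "i \<in> I" for i using ind that by (auto simp: indep_vars_def)
  have "PiM I L = PiM I (\<lambda>i. distr M borel (X i))" by (intro PiM_cong L) auto
  also have "\<dots> = distr M (PiM I (\<lambda>_. borel)) (\<lambda>\<omega>. \<lambda>i\<in>I. X i \<omega>)"
    using indep_vars_iff_distr_eq_PiM'[OF I rv] ind by simp
  finally show ?thesis using F rv by (simp add: nn_integral_distr measurable_restrict)
qed

context
  fixes X :: "'i \<Rightarrow> 'a \<Rightarrow> real" and I :: "'i set" and p :: nat and K :: real
  assumes ind: "indep_vars (\<lambda>_. borel) X I" and I: "finite I"
    and cm: "\<And>i. i \<in> I \<Longrightarrow> centered_moment p K (distr M borel (X i))" and p: "p \<ge> 2" and K: "K \<ge> 0"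
begin

lemma random_variable_component [measurable]: "i \<in> I \<Longrightarrow> X i \<in> borel_measurable M"
  using ind by (auto simp: indep_vars_def)

lemma prob_linear_form:
  assumes t: "t > 0" and s: "(\<Sum>i\<in>I. (a i)\<^sup>2) < s"
  shows "prob {\<omega> \<in> space M. t \<le> \<bar>\<Sum>i\<in>I. a i * X i \<omega>\<bar>} \<le> (chaos_const p K * s) ^ p / t ^ (2 * p)"
proof (cases "I = {}")
  case False
  then obtain i0 where i0: "i0 \<in> I" by auto
  \<comment> \<open>The moment bounds ask for a centered law at every index of the type; indices
    outside \<open>I\<close> borrow the law of \<open>i0\<close>, which is why empty
    \<open>I\<close> is treated apart.\<close>
  define L where "L i = distr M borel (X (if i \<in> I then i else i0))" for i
  have L: "centered_moment p K (L i)" for i using cm i0 by (auto simp: L_def)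
  have c: "chaos_const p K > 0" by (rule chaos_const_pos[OF L p])
  have s0: "s > 0" using s sum_nonneg[of I "\<lambda>i. (a i)\<^sup>2"] by auto
  have "(\<integral>\<^sup>+\<omega>. ennreal ((\<Sum>i\<in>I. a i * X i \<omega>) ^ (2 * p)) \<partial>M)
      = (\<integral>\<^sup>+\<omega>. ennreal ((\<Sum>i\<in>I. a i * (\<lambda>i\<in>I. X i \<omega>) i) ^ (2 * p)) \<partial>M)"
    by (intro nn_integral_cong) simp
  also have "\<dots> = (\<integral>\<^sup>+x. ennreal ((\<Sum>i\<in>I. a i * x i) ^ (2 * p)) \<partial>PiM I L)"
    by (rule nn_integral_indep_PiM[OF ind False]) (auto simp: L_def)
  also have "\<dots> \<le> ennreal ((chaos_const p K * s) ^ p)"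
    using c s by (intro moment_linear_form[OF L p I]) auto
  finally show ?thesis using t c s0 I by (intro prob_abs_ge_even_moment) auto
next
  case True
  then have "s > 0" using s by simp
  then show ?thesis using True t K by (auto simp: chaos_const_def intro!: divide_nonneg_nonneg zero_le_power)
qed

lemma prob_offdiag_quadratic_form:
  assumes t: "t > 0" and s: "(\<Sum>i\<in>I. \<Sum>k\<in>I - {i}. (a i k)\<^sup>2) < s"
  shows "prob {\<omega> \<in> space M. t \<le> \<bar>\<Sum>i\<in>I. \<Sum>k\<in>I - {i}. a i k * X i \<omega> * X k \<omega>\<bar>}
    \<le> (2 * (chaos_const p K)\<^sup>2 * s) ^ p / t ^ (2 * p)"
proof (cases "I = {}")
  case False
  then obtain i0 where i0: "i0 \<in> I" by auto
  define L where "L i = distr M borel (X (if i \<in> I then i else i0))" for i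
  have L: "centered_moment p K (L i)" for i using cm i0 by (auto simp: L_def)
  have c: "chaos_const p K > 0" by (rule chaos_const_pos[OF L p])
  have "0 \<le> (\<Sum>i\<in>I. \<Sum>k\<in>I - {i}. (a i k)\<^sup>2)" by (intro sum_nonneg) auto
  then have s0: "s > 0" using s by linarith
  have "(\<integral>\<^sup>+\<omega>. ennreal ((\<Sum>i\<in>I. \<Sum>k\<in>I - {i}. a i k * X i \<omega> * X k \<omega>) ^ (2 * p)) \<partial>M)
      = (\<integral>\<^sup>+\<omega>. ennreal ((\<Sum>i\<in>I. \<Sum>k\<in>I - {i}. a i k * (\<lambda>i\<in>I. X i \<omega>) i * (\<lambda>i\<in>I. X i \<omega>) k) ^ (2 * p)) \<partial>M)"
    by (auto intro!: nn_integral_cong arg_cong[where f = "\<lambda>x. ennreal (x ^ (2 * p))"] sum.cong)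
  also have "\<dots> = (\<integral>\<^sup>+x. ennreal ((\<Sum>i\<in>I. \<Sum>k\<in>I - {i}. a i k * x i * x k) ^ (2 * p)) \<partial>PiM I L)"
    by (rule nn_integral_indep_PiM[OF ind False]) (auto simp: L_def)
  also have "\<dots> \<le> ennreal ((2 * (chaos_const p K)\<^sup>2 * s) ^ p)"
    using c s by (intro moment_offdiag_quadratic_form[OF L p I]) auto
  finally show ?thesis using t c s0 I by (intro prob_abs_ge_even_moment) auto
next
  case True
  then have "s > 0" using s by simp
  then show ?thesis using True t by (auto intro!: divide_nonneg_nonneg zero_le_power)
qed

lemma prob_cmod_ge_le:
  assumes [measurable]: "f \<in> borel_measurable M" "g \<in> borel_measurable M"
    and f: "prob {\<omega> \<in> space M. t \<le> \<bar>f \<omega>\<bar>} \<le> c" and g: "prob {\<omega> \<in> space M. t \<le> \<bar>g \<omega>\<bar>} \<le> c"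
    and h: "\<And>\<omega>. \<omega> \<in> space M \<Longrightarrow> Re (h \<omega>) = f \<omega>" "\<And>\<omega>. \<omega> \<in> space M \<Longrightarrow> Im (h \<omega>) = g \<omega>"
  shows "prob {\<omega> \<in> space M. 2 * t \<le> cmod (h \<omega>)} \<le> 2 * c"
proof -
  have "prob {\<omega> \<in> space M. 2 * t \<le> cmod (h \<omega>)}
      \<le> prob ({\<omega> \<in> space M. t \<le> \<bar>f \<omega>\<bar>} \<union> {\<omega> \<in> space M. t \<le> \<bar>g \<omega>\<bar>})"
  proof (intro finite_measure_mono)
    have "t \<le> \<bar>f \<omega>\<bar> \<or> t \<le> \<bar>g \<omega>\<bar>" if "\<omega> \<in> space M" "2 * t \<le> cmod (h \<omega>)" for \<omega>
      using that cmod_le[of "h \<omega>"] h[OF that(1)] by linarith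
    then show "{\<omega> \<in> space M. 2 * t \<le> cmod (h \<omega>)}
        \<subseteq> {\<omega> \<in> space M. t \<le> \<bar>f \<omega>\<bar>} \<union> {\<omega> \<in> space M. t \<le> \<bar>g \<omega>\<bar>}" by auto
  qed measurable
  also have "\<dots> \<le> prob {\<omega> \<in> space M. t \<le> \<bar>f \<omega>\<bar>} + prob {\<omega> \<in> space M. t \<le> \<bar>g \<omega>\<bar>}"
    by (intro measure_Un_le) measurable
  finally show ?thesis using f g by simp
qed

lemma prob_complex_linear_form:
  fixes a :: "'i \<Rightarrow> complex"
  assumes t: "t > 0" and s: "(\<Sum>i\<in>I. (cmod (a i))\<^sup>2) < s"
  shows "prob {\<omega> \<in> space M. 2 * t \<le> cmod (\<Sum>i\<in>I. X i \<omega> * a i)} \<le> 2 * ((chaos_const p K * s) ^ p / t ^ (2 * p))"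
proof (rule prob_cmod_ge_le)
  have "(\<Sum>i\<in>I. (Re (a i))\<^sup>2) < s" "(\<Sum>i\<in>I. (Im (a i))\<^sup>2) < s"
    by (rule le_less_trans[OF sum_mono s], simp add: cmod_def)+
  then show "prob {\<omega> \<in> space M. t \<le> \<bar>\<Sum>i\<in>I. Re (a i) * X i \<omega>\<bar>} \<le> (chaos_const p K * s) ^ p / t ^ (2 * p)"
    "prob {\<omega> \<in> space M. t \<le> \<bar>\<Sum>i\<in>I. Im (a i) * X i \<omega>\<bar>} \<le> (chaos_const p K * s) ^ p / t ^ (2 * p)"
    using t by (auto intro!: prob_linear_form)
qed (auto simp: mult.commute)

lemma prob_complex_quadratic_form:
  fixes a :: "'i \<Rightarrow> 'i \<Rightarrow> complex"
  assumes t: "t > 0" and s: "(\<Sum>i\<in>I. \<Sum>k\<in>I - {i}. (cmod (a i k))\<^sup>2) < s"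
  shows "prob {\<omega> \<in> space M. 2 * t \<le> cmod (\<Sum>i\<in>I. \<Sum>k\<in>I - {i}. X i \<omega> * X k \<omega> * a i k)}
    \<le> 2 * ((2 * (chaos_const p K)\<^sup>2 * s) ^ p / t ^ (2 * p))"
proof (rule prob_cmod_ge_le)
  have "(\<Sum>i\<in>I. \<Sum>k\<in>I - {i}. (Re (a i k))\<^sup>2) < s" "(\<Sum>i\<in>I. \<Sum>k\<in>I - {i}. (Im (a i k))\<^sup>2) < s"
    by (rule le_less_trans[OF sum_mono[OF sum_mono] s], simp add: cmod_def)+
  then show "prob {\<omega> \<in> space M. t \<le> \<bar>\<Sum>i\<in>I. \<Sum>k\<in>I - {i}. Re (a i k) * X i \<omega> * X k \<omega>\<bar>}
      \<le> (2 * (chaos_const p K)\<^sup>2 * s) ^ p / t ^ (2 * p)"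
    "prob {\<omega> \<in> space M. t \<le> \<bar>\<Sum>i\<in>I. \<Sum>k\<in>I - {i}. Im (a i k) * X i \<omega> * X k \<omega>\<bar>}
      \<le> (2 * (chaos_const p K)\<^sup>2 * s) ^ p / t ^ (2 * p)"
    using t by (auto intro!: prob_offdiag_quadratic_form)
qed (auto simp: mult_ac)

end

end

section \<open>Rows of a Wigner matrix\<close>

lemma (in prob_space) centered_moment_distr:
  assumes [measurable]: "X \<in> borel_measurable M" and "integrable M (\<lambda>\<omega>. X \<omega> ^ (2 * p))"
    and "expectation X = 0" and "expectation (\<lambda>\<omega>. X \<omega> ^ (2 * p)) \<le> K"
  shows "centered_moment p K (distr M borel X)"
  using assms unfolding centered_moment_def
  by (auto intro: prob_space_distr simp: integrable_distr_eq integral_distr)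

abbreviation upper_pairs :: "nat \<Rightarrow> (nat \<times> nat) set" where
  "upper_pairs N \<equiv> {(i, j). i \<le> j \<and> j < N}"

text \<open>Independence is given for the entries on and above the diagonal, so row \<open>i\<close>
  is read there: along column \<open>i\<close> down to the diagonal and then along row
  \<open>i\<close>.\<close>

definition sorted_pair :: "nat \<Rightarrow> nat \<Rightarrow> nat \<times> nat" where
  "sorted_pair i k = (min i k, max i k)"

lemma sorted_pair_upper: "i < N \<Longrightarrow> k < N \<Longrightarrow> sorted_pair i k \<in> upper_pairs N"
  by (auto simp: sorted_pair_def)

lemma inj_sorted_pair: "inj (sorted_pair i)"
  by (auto simp: inj_on_def sorted_pair_def min_def max_def split: if_splits)

lemma symmetric_deformed_wigner:
  assumes "symmetric_mat N B"
  shows "symmetric_mat N (deformed_wigner N lam B v)"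
  using symmetric_matD[OF assms] unfolding symmetric_mat_def deformed_wigner_def
  by (auto intro!: eq_matI simp: mat_diag_def)

lemma deformed_wigner_index:
  assumes "B \<in> carrier_mat N N" "i < N" "j < N"
  shows "deformed_wigner N lam B v $$ (i, j) = B $$ (i, j) + (if i = j then lam * v i else 0)"
  using assms by (auto simp: deformed_wigner_def mat_diag_def)

text \<open>Rebuilds the isolated matrix from a vector \<open>y\<close> of upper entries, which
  makes explicit that row \<open>i\<close> is not read. It is symmetric for every \<open>y\<close>,
  so the resolvent bounds apply to each frozen value.\<close>

definition minor_of_rest :: "nat \<Rightarrow> nat \<Rightarrow> real \<Rightarrow> (nat \<Rightarrow> real) \<Rightarrow> (nat \<times> nat \<Rightarrow> real) \<Rightarrow> real mat" where
  "minor_of_rest N i lam v y = mat N N (\<lambda>(k, l).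
     if k = i \<or> l = i then 0 else y (sorted_pair k l) + (if k = l then lam * v k else 0))"

lemma symmetric_minor_of_rest: "symmetric_mat N (minor_of_rest N i lam v y)"
  unfolding symmetric_mat_def minor_of_rest_def
  by (auto intro!: eq_matI simp: sorted_pair_def min.commute max.commute)

text \<open>Bounds the 2p-th moment of X^2 - 1 by the 4p-th moment of X, through
  \<open>(x\<^sup>2 - 1) ^ (2 * p) \<le> 4 ^ p * (1 + x ^ (4 * p))\<close>.\<close>

definition square_moment :: "nat \<Rightarrow> real \<Rightarrow> real \<Rightarrow> real" where
  "square_moment p \<theta> \<theta>' = 4 ^ p * (1 + stretched_moment (2 * (2 * p)) \<theta> \<theta>')"

text \<open>One summand for each source of error: the entry \<open>W_ii\<close>, the linear form
  behind off-diagonal entries of the resolvent, the off-diagonal part of the quadratic form, and its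
  centered diagonal part.\<close>

definition entry_const :: "nat \<Rightarrow> real \<Rightarrow> real \<Rightarrow> real" where
  "entry_const p \<theta> \<theta>' =
     (let K = stretched_moment (2 * p) \<theta> \<theta>'; c = chaos_const p K; c' = chaos_const p (square_moment p \<theta> \<theta>')
      in K + 2 * (2 * c) ^ p + 2 * (4 * c\<^sup>2) ^ p + 2 * (2 * c') ^ p)"

context
  fixes M :: "'a measure" and N p :: nat and \<theta> \<theta>' lam :: real and W :: "'a \<Rightarrow> real mat" and v :: "nat \<Rightarrow> real"
  assumes W: "wigner_matrix M N \<theta> \<theta>' W" and N: "N \<ge> 1" and \<theta>: "\<theta> > 0" and p: "p \<ge> 2"
begin

interpretation prob_space M using W by (simp add: wigner_matrix_def)

lemma wigner_symmetric: "\<omega> \<in> space M \<Longrightarrow> symmetric_mat N (W \<omega>)"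
  using W by (simp add: wigner_matrix_def symmetric_mat_def)

lemma wigner_sorted_pair:
  assumes "\<omega> \<in> space M" "i < N" "j < N"
  shows "W \<omega> $$ sorted_pair i j = W \<omega> $$ (i, j)"
  using symmetric_matD(4)[OF wigner_symmetric[OF assms(1)] assms(2,3)]
  by (auto simp: sorted_pair_def min_def max_def)

lemma wigner_indep: "indep_vars (\<lambda>_. borel) (\<lambda>q \<omega>. W \<omega> $$ q) (upper_pairs N)"
  using W by (simp add: wigner_matrix_def)

lemma wigner_entry_measurable:
  assumes "i < N" "j < N"
  shows "(\<lambda>\<omega>. W \<omega> $$ (i, j)) \<in> borel_measurable M"
proof -
  have "(\<lambda>\<omega>. W \<omega> $$ sorted_pair i j) \<in> borel_measurable M"
    using wigner_indep[unfolded indep_vars_def, THEN conjunct1, THEN bspec, OF sorted_pair_upper[OF assms]] .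
  then show ?thesis by (rule measurable_eqI) (rule wigner_sorted_pair[symmetric, OF _ assms])
qed

lemma scaled_entry_moment:
  assumes ij: "i < N" "j < N" and k: "k > 0"
  shows "integrable M (\<lambda>\<omega>. (sqrt N * W \<omega> $$ (i, j)) ^ (2 * k))"
    and "expectation (\<lambda>\<omega>. (sqrt N * W \<omega> $$ (i, j)) ^ (2 * k)) \<le> stretched_moment (2 * k) \<theta> \<theta>'"
proof -
  have [measurable]: "(\<lambda>\<omega>. W \<omega> $$ (i, j)) \<in> borel_measurable M" by (rule wigner_entry_measurable[OF ij])
  have tail: "prob {\<omega> \<in> space M. \<bar>sqrt N * W \<omega> $$ (i, j)\<bar> > x} \<le> \<theta>' * exp (- (x powr (1 / \<theta>)))" if "x \<ge> 0" for x
    using W ij that unfolding wigner_matrix_def abs_mult by simp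
  have "0 < 2 * k" using k by simp
  from moment_of_stretched_tail[OF _ \<theta> tail this]
  show "integrable M (\<lambda>\<omega>. (sqrt N * W \<omega> $$ (i, j)) ^ (2 * k))"
    and "expectation (\<lambda>\<omega>. (sqrt N * W \<omega> $$ (i, j)) ^ (2 * k)) \<le> stretched_moment (2 * k) \<theta> \<theta>'"
    by (simp_all add: power_even_abs)
qed

lemma stretched_moment_nonneg:
  assumes "k > 0"
  shows "0 \<le> stretched_moment (2 * k) \<theta> \<theta>'"
proof -
  have "0 \<le> expectation (\<lambda>\<omega>. (sqrt N * W \<omega> $$ (0, 0)) ^ (2 * k))"
    by (intro Bochner_Integration.integral_nonneg) simp
  then show ?thesis using scaled_entry_moment(2)[of 0 0 k] N assms by linarith
qed

lemma square_moment_nonneg: "0 \<le> square_moment p \<theta> \<theta>'"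
  using stretched_moment_nonneg[of "2 * p"] p by (simp add: square_moment_def)

lemma scaled_entry_centered:
  assumes ij: "i < N" "j < N"
  shows "centered_moment p (stretched_moment (2 * p) \<theta> \<theta>') (distr M borel (\<lambda>\<omega>. sqrt N * W \<omega> $$ (i, j)))"
proof (rule centered_moment_distr)
  show "(\<lambda>\<omega>. sqrt N * W \<omega> $$ (i, j)) \<in> borel_measurable M"
    using wigner_entry_measurable[OF ij] by simp
  show "expectation (\<lambda>\<omega>. sqrt N * W \<omega> $$ (i, j)) = 0" using W ij by (simp add: wigner_matrix_def)
qed (use p in \<open>auto intro!: scaled_entry_moment ij\<close>)

text \<open>Off the diagonal the variance is 1/N, so subtracting 1 centers the scaled square; for
  \<open>i = j\<close> the mean of the square would be 2.\<close>

lemma scaled_square_centered: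
  assumes ij: "i < N" "j < N" "i \<noteq> j"
  shows "centered_moment p (square_moment p \<theta> \<theta>') (distr M borel (\<lambda>\<omega>. (sqrt N * W \<omega> $$ (i, j))\<^sup>2 - 1))"
proof (rule centered_moment_distr)
  let ?X = "\<lambda>\<omega>. sqrt N * W \<omega> $$ (i, j)"
  have [measurable]: "?X \<in> borel_measurable M" using wigner_entry_measurable[OF ij(1,2)] by simp
  show "(\<lambda>\<omega>. (?X \<omega>)\<^sup>2 - 1) \<in> borel_measurable M" by simp
  have i2: "integrable M (\<lambda>\<omega>. (?X \<omega>)\<^sup>2)" using scaled_entry_moment(1)[OF ij(1,2), of 1] by simp
  have "expectation (\<lambda>\<omega>. (?X \<omega>)\<^sup>2) = 1"
    using W ij N unfolding wigner_matrix_def power_mult_distrib by simp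
  then show "expectation (\<lambda>\<omega>. (?X \<omega>)\<^sup>2 - 1) = 0" using i2 by (simp add: prob_space)
  have i4: "integrable M (\<lambda>\<omega>. 4 ^ p * (1 + ?X \<omega> ^ (2 * (2 * p))))"
    using scaled_entry_moment(1)[OF ij(1,2), of "2 * p"] p by (simp del: power_mult)
  have bound: "(x\<^sup>2 - 1) ^ (2 * p) \<le> 4 ^ p * (1 + x ^ (2 * (2 * p)))" for x :: real
  proof -
    have "\<bar>x\<^sup>2 - 1\<bar> \<le> 2 * max 1 (x\<^sup>2)" using zero_le_power2[of x] by linarith
    then have "\<bar>x\<^sup>2 - 1\<bar> ^ (2 * p) \<le> (2 * max 1 (x\<^sup>2)) ^ (2 * p)" by (intro power_mono) auto
    also have "\<dots> = 4 ^ p * max 1 (x\<^sup>2) ^ (2 * p)" by (simp add: power_mult_distrib power_mult)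
    also have "\<dots> \<le> 4 ^ p * (1 + (x\<^sup>2) ^ (2 * p))"
      by (intro mult_left_mono) (auto simp: max_def)
    finally show ?thesis by (simp add: power_even_abs power_mult)
  qed
  show int: "integrable M (\<lambda>\<omega>. ((?X \<omega>)\<^sup>2 - 1) ^ (2 * p))"
  proof (rule Bochner_Integration.integrable_bound[OF i4])
    show "AE \<omega> in M. norm (((?X \<omega>)\<^sup>2 - 1) ^ (2 * p)) \<le> norm (4 ^ p * (1 + ?X \<omega> ^ (2 * (2 * p))))"
    proof (intro AE_I2)
      fix \<omega>
      have "norm (((?X \<omega>)\<^sup>2 - 1) ^ (2 * p)) = ((?X \<omega>)\<^sup>2 - 1) ^ (2 * p)"
        unfolding real_norm_def by (intro abs_of_nonneg zero_le_even_power) simp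
      then show "norm (((?X \<omega>)\<^sup>2 - 1) ^ (2 * p)) \<le> norm (4 ^ p * (1 + ?X \<omega> ^ (2 * (2 * p))))"
        using bound[of "?X \<omega>"] unfolding real_norm_def by linarith
    qed
  qed simp
  have "expectation (\<lambda>\<omega>. ((?X \<omega>)\<^sup>2 - 1) ^ (2 * p)) \<le> expectation (\<lambda>\<omega>. 4 ^ p * (1 + ?X \<omega> ^ (2 * (2 * p))))"
    by (intro integral_mono int i4 bound)
  also have "\<dots> = 4 ^ p * (1 + expectation (\<lambda>\<omega>. ?X \<omega> ^ (2 * (2 * p))))"
    using scaled_entry_moment(1)[OF ij(1,2), of "2 * p"] p
    by (simp add: prob_space del: power_mult)
  also have "\<dots> \<le> square_moment p \<theta> \<theta>'"
    unfolding square_moment_def using scaled_entry_moment(2)[OF ij(1,2), of "2 * p"] p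
    by (intro mult_left_mono add_left_mono) auto
  finally show "expectation (\<lambda>\<omega>. ((?X \<omega>)\<^sup>2 - 1) ^ (2 * p)) \<le> square_moment p \<theta> \<theta>'" .
qed

lemma wigner_row_indep:
  assumes i: "i < N"
  shows "indep_vars (\<lambda>_. borel) (\<lambda>k \<omega>. sqrt N * W \<omega> $$ sorted_pair i k) ({..<N} - {i})"
proof -
  have "indep_vars (\<lambda>_. borel) (\<lambda>k \<omega>. W \<omega> $$ sorted_pair i k) ({..<N} - {i})"
    using i by (intro indep_vars_reindex_inj[OF wigner_indep])
      (auto intro: inj_on_subset[OF inj_sorted_pair] dest: sorted_pair_upper simp: image_subset_iff)
  then show ?thesis by (rule indep_vars_compose2) simp
qed

end

section \<open>Forms in one row of the Wigner matrix with the minor frozen\<close>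

context
  fixes M :: "'a measure" and N p :: nat and \<theta> \<theta>' lam :: real and W :: "'a \<Rightarrow> real mat" and v :: "nat \<Rightarrow> real"
    and i :: nat and z :: complex
  assumes W: "wigner_matrix M N \<theta> \<theta>' W" and N: "N \<ge> 1" and \<theta>: "\<theta> > 0" and p: "p \<ge> 2"
    and i: "i < N" and z: "Im z \<noteq> 0"
begin

interpretation prob_space M using W by (simp add: wigner_matrix_def)

private abbreviation (input) others :: "nat set" where "others \<equiv> {..<N} - {i}"

private abbreviation (input) row :: "nat \<Rightarrow> 'a \<Rightarrow> real" where
  "row k \<omega> \<equiv> sqrt N * W \<omega> $$ sorted_pair i k"

private abbreviation (input) model :: "'a \<Rightarrow> real mat" where "model \<omega> \<equiv> deformed_wigner N lam (W \<omega>) v"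

private abbreviation (input) minor :: "'a \<Rightarrow> nat \<Rightarrow> nat \<Rightarrow> complex" where
  "minor \<omega> k l \<equiv> resolvent N (isolate_index N i (model \<omega>)) z $$ (k, l)"

text \<open>The row and the minor are functions of disjoint sets of upper entries. The first two
  assumptions make \<open>F\<close> jointly measurable and dependent only on the entries of the row
  off the diagonal; the third asks for the bound at every fixed \<open>H\<close> whose columns obey
  the Ward estimate, which each frozen minor does.\<close>

lemma prob_row_freeze:
  assumes meas: "\<And>(S :: ((nat \<times> nat \<Rightarrow> real) \<times> (nat \<times> nat \<Rightarrow> real)) measure) x H.
      (\<And>k. k \<in> others \<Longrightarrow> (\<lambda>s. x s k) \<in> borel_measurable S) \<Longrightarrow>
      (\<And>k l. k < N \<Longrightarrow> l < N \<Longrightarrow> (\<lambda>s. H s k l) \<in> borel_measurable S) \<Longrightarrow>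
      (\<lambda>s. F (x s) (H s)) \<in> borel_measurable S"
    and F: "\<And>x x' H. (\<And>k. k \<in> others \<Longrightarrow> x k = x' k) \<Longrightarrow> F x H = (F x' H :: real)"
    and le: "\<And>H. (\<And>j. j < N \<Longrightarrow> (\<Sum>k<N. (cmod (H k j))\<^sup>2) \<le> 1 / (Im z)\<^sup>2) \<Longrightarrow>
      prob {\<omega> \<in> space M. r \<le> F (\<lambda>k. row k \<omega>) H} \<le> c"
  shows "prob {\<omega> \<in> space M. r \<le> F (\<lambda>k. row k \<omega>) (minor \<omega>)} \<le> c"
proof -
  \<comment> \<open>\<open>R\<close> holds the positions of the row off the diagonal. The complement
    \<open>B\<close> still contains \<open>(i, i)\<close>, which \<open>minor_of_rest\<close> never
    reads.\<close>
  define R where "R = sorted_pair i ` others"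
  define B where "B = upper_pairs N - R"
  define T where "T = PiM B (\<lambda>_. borel :: real measure)"
  define S where "S = PiM R (\<lambda>_. borel :: real measure)"
  define Hy where "Hy y k l = resolvent N (minor_of_rest N i lam v y) z $$ (k, l)" for y k l
  define Rx where "Rx x k = sqrt N * x (sorted_pair i k)" for x :: "nat \<times> nat \<Rightarrow> real" and k
  have "R \<subseteq> upper_pairs N"
    unfolding R_def by (intro image_subsetI sorted_pair_upper[OF i]) simp
  then have ind: "indep_var S (\<lambda>\<omega>. \<lambda>q\<in>R. W \<omega> $$ q) T (\<lambda>\<omega>. \<lambda>q\<in>B. W \<omega> $$ q)"
    unfolding S_def T_def B_def by (intro indep_var_restrict[OF wigner_indep[OF W N \<theta> p]]) (rule Diff_disjoint, assumption, rule Diff_subset)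
  have restr: "F (Rx (\<lambda>q\<in>R. W \<omega> $$ q)) H = F (\<lambda>k. row k \<omega>) H" for \<omega> H
    by (intro F) (simp add: Rx_def R_def)
  have "prob {\<omega> \<in> space M. r \<le> F (Rx (\<lambda>q\<in>R. W \<omega> $$ q)) (Hy (\<lambda>q\<in>B. W \<omega> $$ q))} \<le> c"
  proof (rule prob_freeze_le[OF ind])
    have "(\<lambda>xy. F (Rx (fst xy)) (Hy (snd xy))) \<in> borel_measurable (S \<Otimes>\<^sub>M T)"
    proof (rule meas)
      show "(\<lambda>s. Rx (fst s) k) \<in> borel_measurable (S \<Otimes>\<^sub>M T)" if "k \<in> others" for k
        unfolding S_def Rx_def using that
        by (intro borel_measurable_times borel_measurable_const
            measurable_compose[OF measurable_fst measurable_component_singleton]) (auto simp: R_def)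
    next
      fix k l assume kl: "k < N" "l < N"
      show "(\<lambda>s. Hy (snd s) k l) \<in> borel_measurable (S \<Otimes>\<^sub>M T)"
        unfolding Hy_def
      proof (rule borel_measurable_resolvent[OF symmetric_minor_of_rest _ z kl])
        fix k l assume kl: "k < N" "l < N"
        show "(\<lambda>s. minor_of_rest N i lam v (snd s) $$ (k, l)) \<in> borel_measurable (S \<Otimes>\<^sub>M T)"
        proof (cases "k = i \<or> l = i")
          case False
          have "sorted_pair k l \<in> B"
            using False kl sorted_pair_upper[OF kl] unfolding B_def R_def
            by (auto simp: sorted_pair_def min_def max_def split: if_splits)
          then have "(\<lambda>s. snd s (sorted_pair k l)) \<in> borel_measurable (S \<Otimes>\<^sub>M T)"
            unfolding T_def by (intro measurable_compose[OF measurable_snd measurable_component_singleton])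
          then show ?thesis using False kl by (simp add: minor_of_rest_def)
        qed (use kl in \<open>simp add: minor_of_rest_def\<close>)
      qed
    qed
    then show "{xy \<in> space (S \<Otimes>\<^sub>M T). r \<le> F (Rx (fst xy)) (Hy (snd xy))} \<in> sets (S \<Otimes>\<^sub>M T)"
      unfolding borel_measurable_iff_ge by blast
  next
    fix y
    have sm: "symmetric_mat N (minor_of_rest N i lam v y)" by (rule symmetric_minor_of_rest)
    have "(\<Sum>k<N. (cmod (Hy y k j))\<^sup>2) \<le> 1 / (Im z)\<^sup>2" if "j < N" for j
    proof -
      have "(\<Sum>k<N. (cmod (Hy y k j))\<^sup>2) = (\<Sum>k<N. (cmod (Hy y j k))\<^sup>2)"
        unfolding Hy_def by (intro sum.cong refl) (simp add: resolvent_sym[OF sm z that])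
      then show ?thesis using resolvent_row_norm(2)[OF sm z that] by (simp add: Hy_def)
    qed
    then show "prob {\<omega> \<in> space M. r \<le> F (Rx (\<lambda>q\<in>R. W \<omega> $$ q)) (Hy y)} \<le> c"
      unfolding restr by (rule le)
  qed
  also have "{\<omega> \<in> space M. r \<le> F (Rx (\<lambda>q\<in>R. W \<omega> $$ q)) (Hy (\<lambda>q\<in>B. W \<omega> $$ q))}
      = {\<omega> \<in> space M. r \<le> F (\<lambda>k. row k \<omega>) (minor \<omega>)}"
  proof (intro Collect_cong conj_cong refl)
    fix \<omega> assume \<omega>: "\<omega> \<in> space M"
    have W\<omega>: "W \<omega> \<in> carrier_mat N N" using wigner_symmetric[OF W N \<theta> p \<omega>] by (rule symmetric_matD)
    have "minor_of_rest N i lam v (\<lambda>q\<in>B. W \<omega> $$ q) = isolate_index N i (model \<omega>)"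
    proof (rule eq_matI)
      fix k l assume "k < dim_row (isolate_index N i (model \<omega>))" "l < dim_col (isolate_index N i (model \<omega>))"
      then have kl: "k < N" "l < N" by (auto simp: isolate_index_def)
      have "sorted_pair k l \<in> B" if "k \<noteq> i" "l \<noteq> i"
        using that kl sorted_pair_upper[OF kl] unfolding B_def R_def
        by (auto simp: sorted_pair_def min_def max_def split: if_splits)
      then show "minor_of_rest N i lam v (\<lambda>q\<in>B. W \<omega> $$ q) $$ (k, l) = isolate_index N i (model \<omega>) $$ (k, l)"
        using kl by (simp add: minor_of_rest_def isolate_index_def deformed_wigner_index[OF W\<omega>]
            wigner_sorted_pair[OF W N \<theta> p \<omega>])
    qed (auto simp: minor_of_rest_def isolate_index_def)
    then show "(r \<le> F (Rx (\<lambda>q\<in>R. W \<omega> $$ q)) (Hy (\<lambda>q\<in>B. W \<omega> $$ q))) = (r \<le> F (\<lambda>k. row k \<omega>) (minor \<omega>))"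
      unfolding restr by (simp add: Hy_def[abs_def])
  qed
  finally show ?thesis .
qed

lemma row_centered:
  assumes "k \<in> others"
  shows "centered_moment p (stretched_moment (2 * p) \<theta> \<theta>') (distr M borel (row k))"
    and "centered_moment p (square_moment p \<theta> \<theta>') (distr M borel (\<lambda>\<omega>. (row k \<omega>)\<^sup>2 - 1))"
proof -
  have "fst (sorted_pair i k) < N" "snd (sorted_pair i k) < N" "fst (sorted_pair i k) \<noteq> snd (sorted_pair i k)"
    using assms i by (auto simp: sorted_pair_def min_def max_def)
  from scaled_entry_centered[OF W N \<theta> p this(1,2)] scaled_square_centered[OF W N \<theta> p this]
  show "centered_moment p (stretched_moment (2 * p) \<theta> \<theta>') (distr M borel (row k))"
    and "centered_moment p (square_moment p \<theta> \<theta>') (distr M borel (\<lambda>\<omega>. (row k \<omega>)\<^sup>2 - 1))"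
    by simp_all
qed

text \<open>The thresholds \<open>t\<close> are scaled so that the Markov quotient depends on
  \<open>T\<close> alone. The 2 in the hypothesis is the slack by which \<open>s\<close> exceeds the
  Ward bound, since the tail bounds for forms want a strict inequality.\<close>

lemma tail_exponent:
  fixes C s t T :: real
  assumes "s / t\<^sup>2 = 2 / T\<^sup>2"
  shows "(C * s) ^ p / t ^ (2 * p) = (2 * C) ^ p / T ^ (2 * p)"
proof -
  have "(C * s) ^ p / t ^ (2 * p) = (C * (s / t\<^sup>2)) ^ p" by (simp add: power_mult power_divide power_mult_distrib)
  also have "\<dots> = (2 * C) ^ p / T ^ (2 * p)" unfolding assms by (simp add: power_mult power_divide power_mult_distrib)
  finally show ?thesis .
qed

context
  fixes T :: real
  assumes T: "T \<ge> 1"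
begin

lemma prob_row_linear:
  assumes j: "j < N"
  shows "prob {\<omega> \<in> space M. 2 * (T / \<bar>Im z\<bar>) \<le> cmod (\<Sum>k\<in>others. row k \<omega> * minor \<omega> k j)}
    \<le> 2 * (2 * chaos_const p (stretched_moment (2 * p) \<theta> \<theta>')) ^ p / T ^ (2 * p)"
proof (rule prob_row_freeze[where F = "\<lambda>x H. cmod (\<Sum>k\<in>others. x k * H k j)"])
  fix H assume H: "\<And>j. j < N \<Longrightarrow> (\<Sum>k<N. (cmod (H k j))\<^sup>2) \<le> 1 / (Im z)\<^sup>2"
  have "(\<Sum>k\<in>others. (cmod (H k j))\<^sup>2) \<le> (\<Sum>k<N. (cmod (H k j))\<^sup>2)" by (intro sum_mono2) auto
  also have "\<dots> \<le> 1 / (Im z)\<^sup>2" by (rule H[OF j])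
  also have "\<dots> < 2 / (Im z)\<^sup>2" using z by (simp add: divide_strict_right_mono)
  finally have "prob {\<omega> \<in> space M. 2 * (T / \<bar>Im z\<bar>) \<le> cmod (\<Sum>k\<in>others. row k \<omega> * H k j)}
    \<le> 2 * ((chaos_const p (stretched_moment (2 * p) \<theta> \<theta>') * (2 / (Im z)\<^sup>2)) ^ p / (T / \<bar>Im z\<bar>) ^ (2 * p))"
    using T z stretched_moment_nonneg[OF W N \<theta> p, of p] p
    by (intro prob_complex_linear_form wigner_row_indep[OF W N \<theta> p i] row_centered) auto
  also have "\<dots> = 2 * ((2 * chaos_const p (stretched_moment (2 * p) \<theta> \<theta>')) ^ p / T ^ (2 * p))"
    using T z by (subst tail_exponent[where T = T]) (auto simp: power_divide)
  finally show "prob {\<omega> \<in> space M. 2 * (T / \<bar>Im z\<bar>) \<le> cmod (\<Sum>k\<in>others. row k \<omega> * H k j)}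
    \<le> 2 * (2 * chaos_const p (stretched_moment (2 * p) \<theta> \<theta>')) ^ p / T ^ (2 * p)" by simp
qed (use j in \<open>auto intro!: borel_measurable_times borel_measurable_sum borel_measurable_of_real
      measurable_compose[OF _ borel_measurable_norm]\<close>)

text \<open>Each of at most \<open>N\<close> columns has squared l^2 norm at most
  \<open>1 / (Im z)^2\<close>, so the whole coefficient array has l^2 size at most
  \<open>sqrt N / |Im z|\<close>, the scale of the threshold.\<close>

lemma prob_row_offdiag:
  "prob {\<omega> \<in> space M. 2 * (sqrt N * T / \<bar>Im z\<bar>)
      \<le> cmod (\<Sum>k\<in>others. \<Sum>l\<in>others - {k}. row k \<omega> * row l \<omega> * minor \<omega> l k)}
    \<le> 2 * (4 * (chaos_const p (stretched_moment (2 * p) \<theta> \<theta>'))\<^sup>2) ^ p / T ^ (2 * p)"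
proof (rule prob_row_freeze[where F = "\<lambda>x H. cmod (\<Sum>k\<in>others. \<Sum>l\<in>others - {k}. of_real (x k * x l) * H l k)"])
  let ?c = "chaos_const p (stretched_moment (2 * p) \<theta> \<theta>')"
  fix H assume H: "\<And>j. j < N \<Longrightarrow> (\<Sum>k<N. (cmod (H k j))\<^sup>2) \<le> 1 / (Im z)\<^sup>2"
  have "(\<Sum>k\<in>others. \<Sum>l\<in>others - {k}. (cmod (H l k))\<^sup>2) \<le> (\<Sum>k\<in>others. \<Sum>l<N. (cmod (H l k))\<^sup>2)"
    by (intro sum_mono sum_mono2) auto
  also have "\<dots> \<le> (\<Sum>k<N. \<Sum>l<N. (cmod (H l k))\<^sup>2)" by (intro sum_mono2) (auto intro!: sum_nonneg)
  also have "\<dots> \<le> (\<Sum>k<N. 1 / (Im z)\<^sup>2)" by (intro sum_mono H) auto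
  also have "\<dots> < 2 * N / (Im z)\<^sup>2" using z N by (simp add: divide_strict_right_mono)
  finally have "prob {\<omega> \<in> space M. 2 * (sqrt N * T / \<bar>Im z\<bar>)
      \<le> cmod (\<Sum>k\<in>others. \<Sum>l\<in>others - {k}. row k \<omega> * row l \<omega> * H l k)}
    \<le> 2 * ((2 * ?c\<^sup>2 * (2 * N / (Im z)\<^sup>2)) ^ p / (sqrt N * T / \<bar>Im z\<bar>) ^ (2 * p))"
    using T z N stretched_moment_nonneg[OF W N \<theta> p, of p] p
    by (intro prob_complex_quadratic_form wigner_row_indep[OF W N \<theta> p i] row_centered) auto
  also have "\<dots> = 2 * ((2 * (2 * ?c\<^sup>2)) ^ p / T ^ (2 * p))"
    using T z N by (subst tail_exponent[where T = T]) (auto simp: power_divide power_mult_distrib)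
  finally show "prob {\<omega> \<in> space M. 2 * (sqrt N * T / \<bar>Im z\<bar>)
      \<le> cmod (\<Sum>k\<in>others. \<Sum>l\<in>others - {k}. row k \<omega> * row l \<omega> * H l k)}
    \<le> 2 * (4 * ?c\<^sup>2) ^ p / T ^ (2 * p)" by simp
next
  show "cmod (\<Sum>k\<in>others. \<Sum>l\<in>others - {k}. of_real (x k * x l) * H l k)
      = cmod (\<Sum>k\<in>others. \<Sum>l\<in>others - {k}. of_real (x' k * x' l) * H l k)"
    if "\<And>k. k \<in> others \<Longrightarrow> x k = x' k" for x x' :: "nat \<Rightarrow> real" and H
    using that by (intro arg_cong[where f = cmod] sum.cong) auto
qed (auto intro!: borel_measurable_times borel_measurable_sum borel_measurable_of_real
      measurable_compose[OF _ borel_measurable_norm])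

text \<open>The diagonal part of the quadratic form, once its mean is removed, is linear in the
  independent centered variables \<open>(row k)^2 - 1\<close>, so the linear tail bound
  applies.\<close>

lemma prob_row_diag:
  "prob {\<omega> \<in> space M. 2 * (sqrt N * T / \<bar>Im z\<bar>) \<le> cmod (\<Sum>k\<in>others. of_real ((row k \<omega>)\<^sup>2 - 1) * minor \<omega> k k)}
    \<le> 2 * (2 * chaos_const p (square_moment p \<theta> \<theta>')) ^ p / T ^ (2 * p)"
proof (rule prob_row_freeze[where F = "\<lambda>x H. cmod (\<Sum>k\<in>others. of_real ((x k)\<^sup>2 - 1) * H k k)"])
  let ?c = "chaos_const p (square_moment p \<theta> \<theta>')"
  fix H assume H: "\<And>j. j < N \<Longrightarrow> (\<Sum>k<N. (cmod (H k j))\<^sup>2) \<le> 1 / (Im z)\<^sup>2"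
  have "(cmod (H k k))\<^sup>2 \<le> 1 / (Im z)\<^sup>2" if "k < N" for k
    using that by (intro order.trans[OF _ H[OF that]] member_le_sum) auto
  then have "(\<Sum>k\<in>others. (cmod (H k k))\<^sup>2) \<le> (\<Sum>k\<in>others. 1 / (Im z)\<^sup>2)" by (intro sum_mono) auto
  also have "\<dots> \<le> (\<Sum>k<N. 1 / (Im z)\<^sup>2)" by (intro sum_mono2) auto
  also have "\<dots> < 2 * N / (Im z)\<^sup>2" using z N by (simp add: divide_strict_right_mono)
  finally have s: "(\<Sum>k\<in>others. (cmod (H k k))\<^sup>2) < 2 * N / (Im z)\<^sup>2" .
  have ind: "indep_vars (\<lambda>_. borel) (\<lambda>k \<omega>. (row k \<omega>)\<^sup>2 - 1) others"
    by (rule indep_vars_compose2[OF wigner_row_indep[OF W N \<theta> p i]]) simp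
  have "prob {\<omega> \<in> space M. 2 * (sqrt N * T / \<bar>Im z\<bar>) \<le> cmod (\<Sum>k\<in>others. of_real ((row k \<omega>)\<^sup>2 - 1) * H k k)}
    \<le> 2 * ((?c * (2 * N / (Im z)\<^sup>2)) ^ p / (sqrt N * T / \<bar>Im z\<bar>) ^ (2 * p))"
    using T z N square_moment_nonneg[OF W N \<theta> p] p s
    by (intro prob_complex_linear_form[OF ind] row_centered) auto
  also have "\<dots> = 2 * ((2 * ?c) ^ p / T ^ (2 * p))"
    using T z N by (subst tail_exponent[where T = T]) (auto simp: power_divide power_mult_distrib)
  finally show "prob {\<omega> \<in> space M. 2 * (sqrt N * T / \<bar>Im z\<bar>) \<le> cmod (\<Sum>k\<in>others. of_real ((row k \<omega>)\<^sup>2 - 1) * H k k)}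
    \<le> 2 * (2 * ?c) ^ p / T ^ (2 * p)" by simp
next
  show "cmod (\<Sum>k\<in>others. of_real ((x k)\<^sup>2 - 1) * H k k) = cmod (\<Sum>k\<in>others. of_real ((x' k)\<^sup>2 - 1) * H k k)"
    if "\<And>k. k \<in> others \<Longrightarrow> x k = x' k" for x x' :: "nat \<Rightarrow> real" and H
    using that by (intro arg_cong[where f = cmod] sum.cong) auto
qed (auto intro!: borel_measurable_times borel_measurable_sum borel_measurable_of_real borel_measurable_diff
      borel_measurable_power measurable_compose[OF _ borel_measurable_norm] simp del: of_real_diff of_real_power)

lemma prob_diag_entry:
  "prob {\<omega> \<in> space M. T \<le> \<bar>sqrt N * W \<omega> $$ (i, i)\<bar>} \<le> stretched_moment (2 * p) \<theta> \<theta>' / T ^ (2 * p)"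
proof (rule prob_abs_ge_even_moment)
  have p0: "p > 0" using p by simp
  note m = scaled_entry_moment[OF W N \<theta> p i i p0]
  show "(\<lambda>\<omega>. sqrt N * W \<omega> $$ (i, i)) \<in> borel_measurable M"
    using wigner_entry_measurable[OF W N \<theta> p i i] by simp
  show "(\<integral>\<^sup>+\<omega>. ennreal ((sqrt N * W \<omega> $$ (i, i)) ^ (2 * p)) \<partial>M) \<le> ennreal (stretched_moment (2 * p) \<theta> \<theta>')"
    using m(2) by (subst nn_integral_eq_integral[OF m(1)]) (auto intro!: ennreal_leI)
qed (use T p stretched_moment_nonneg[OF W N \<theta> p, of p] in auto)

end

end

section \<open>The entrywise bound at a fixed spectral parameter\<close>

definition entry_error :: "nat \<Rightarrow> real \<Rightarrow> real mat \<Rightarrow> (nat \<Rightarrow> real) \<Rightarrow> complex \<Rightarrow> nat \<Rightarrow> nat \<Rightarrow> complex" where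
  "entry_error N lam B v z i j =
     (let A = deformed_wigner N lam B v in
      resolvent N A z $$ (i, j)
        - (if i = j then 1 else 0) * (1 / (complex_of_real (lam * v i) - z - stieltjes N A z)))"

lemma borel_measurable_complex_of_real:
  "f \<in> borel_measurable M \<Longrightarrow> (\<lambda>x. complex_of_real (f x)) \<in> borel_measurable M"
  by (rule measurable_compose[OF _ borel_measurable_of_real])

text \<open>Only two powers of \<open>1 / |Im z|\<close> arise here, one from \<open>G_ii\<close>
  and one from the linear form; \<open>|Im z| \<le> 3\<close> trades the missing one for a factor 3,
  and 2 * 3 fits below 9.\<close>

lemma entry_error_offdiag_bound:
  fixes T :: real
  assumes B: "symmetric_mat N B" and z: "Im z \<noteq> 0" "\<bar>Im z\<bar> \<le> 3" and ij: "i < N" "j < N" "i \<noteq> j"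
    and T: "T > 0"
    and lin: "cmod (\<Sum>k\<in>{..<N} - {i}. complex_of_real (sqrt N * B $$ (i, k))
        * resolvent N (isolate_index N i (deformed_wigner N lam B v)) z $$ (k, j)) < 2 * (T / \<bar>Im z\<bar>)"
  shows "cmod (entry_error N lam B v z i j) < 9 * T / (sqrt N * \<bar>Im z\<bar> ^ 3)"
proof -
  let ?A = "deformed_wigner N lam B v"
  let ?H = "\<lambda>k l. resolvent N (isolate_index N i ?A) z $$ (k, l)"
  have A: "symmetric_mat N ?A" by (rule symmetric_deformed_wigner[OF B])
  have pos: "\<bar>Im z\<bar> > 0" "sqrt N > 0" using z ij by auto
  have idx: "?A $$ (i, k) = B $$ (i, k)" if "k \<in> {..<N} - {i}" for k
    using that ij by (simp add: deformed_wigner_index[OF symmetric_matD(1)[OF B]])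
  have "sqrt N * cmod (\<Sum>l\<in>{..<N} - {i}. ?A $$ (i, l) * ?H l j)
      = cmod (of_real (sqrt N) * (\<Sum>l\<in>{..<N} - {i}. ?A $$ (i, l) * ?H l j))"
    by (simp add: norm_mult)
  also have "\<dots> = cmod (\<Sum>k\<in>{..<N} - {i}. complex_of_real (sqrt N * B $$ (i, k)) * ?H k j)"
    unfolding sum_distrib_left by (intro arg_cong[where f = cmod] sum.cong refl) (simp add: idx)
  also have "\<dots> < 2 * (T / \<bar>Im z\<bar>)" by (rule lin)
  finally have lt: "cmod (\<Sum>l\<in>{..<N} - {i}. ?A $$ (i, l) * ?H l j) < 2 * (T / \<bar>Im z\<bar>) / sqrt N"
    using pos by (simp add: field_simps)
  have "cmod (entry_error N lam B v z i j) = cmod (resolvent N ?A z $$ (i, j))"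
    using ij by (simp add: entry_error_def)
  also have "\<dots> \<le> cmod (\<Sum>l\<in>{..<N} - {i}. ?A $$ (i, l) * ?H l j) / \<bar>Im z\<bar>"
    using ij by (intro resolvent_offdiag_bound[OF A z(1)]) auto
  also have "\<dots> < 2 * (T / \<bar>Im z\<bar>) / sqrt N / \<bar>Im z\<bar>" using lt pos by (intro divide_strict_right_mono)
  also have "\<dots> = 2 * T * \<bar>Im z\<bar> / (sqrt N * \<bar>Im z\<bar> ^ 3)" using pos by (simp add: field_simps power3_eq_cube)
  also have "\<dots> \<le> 9 * T / (sqrt N * \<bar>Im z\<bar> ^ 3)"
  proof (intro divide_right_mono)
    have "2 * T * \<bar>Im z\<bar> \<le> 2 * T * 3" using T z by (intro mult_left_mono) auto
    then show "2 * T * \<bar>Im z\<bar> \<le> 9 * T" using T by simp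
  qed (use pos in auto)
  finally show ?thesis .
qed

text \<open>After multiplication by \<open>N\<close> the Schur error splits into the entry
  \<open>W_ii\<close>, the difference of the traces of \<open>G\<close> and of the minor, and the
  two centered parts of the quadratic form.\<close>

lemma entry_error_diag_bound:
  fixes T lam :: real and v :: "nat \<Rightarrow> real"
  assumes B: "symmetric_mat N B" and z: "Im z \<noteq> 0" "\<bar>Im z\<bar> \<le> 3" and i: "i < N" and T: "T \<ge> 1"
  defines "H \<equiv> \<lambda>k l. resolvent N (isolate_index N i (deformed_wigner N lam B v)) z $$ (k, l)"
    and "I \<equiv> {..<N} - {i}"
  assumes entry: "\<bar>sqrt N * B $$ (i, i)\<bar> < T"
    and off: "cmod (\<Sum>k\<in>I. \<Sum>l\<in>I - {k}.
        complex_of_real ((sqrt N * B $$ (i, k)) * (sqrt N * B $$ (i, l))) * H l k) < 2 * (sqrt N * T / \<bar>Im z\<bar>)"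
    and diag: "cmod (\<Sum>k\<in>I. complex_of_real ((sqrt N * B $$ (i, k))\<^sup>2 - 1) * H k k) < 2 * (sqrt N * T / \<bar>Im z\<bar>)"
  shows "cmod (entry_error N lam B v z i i) < 9 * T / (sqrt N * \<bar>Im z\<bar> ^ 3)"
proof -
  let ?A = "deformed_wigner N lam B v"
  let ?u = "\<lambda>k. sqrt N * B $$ (i, k)"
  let ?m = "stieltjes N ?A z"
  let ?tr = "\<Sum>j<N. resolvent N ?A z $$ (j, j)"
  let ?off = "\<Sum>k\<in>I. \<Sum>l\<in>I - {k}. complex_of_real (?u k * ?u l) * H l k"
  let ?diag = "\<Sum>k\<in>I. complex_of_real ((?u k)\<^sup>2 - 1) * H k k"
  have A: "symmetric_mat N ?A" by (rule symmetric_deformed_wigner[OF B])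
  have N: "real N > 0" "N \<noteq> 0" using i by auto
  have pos: "\<bar>Im z\<bar> > 0" "sqrt N > 0" using z N by auto
  have sq: "sqrt N * sqrt N = N" by simp
  note idx = deformed_wigner_index[OF symmetric_matD(1)[OF B], where lam = lam and v = v and i = i]
  let ?S = "\<Sum>k\<in>I. \<Sum>l\<in>I. ?A $$ (i, k) * ?A $$ (i, l) * H l k"
  have "of_nat N * ?S = (\<Sum>k\<in>I. \<Sum>l\<in>I. complex_of_real (?u k * ?u l) * H l k)"
    unfolding sum_distrib_left
  proof (intro sum.cong refl)
    fix k l assume kl: "k \<in> I" "l \<in> I"
    have "complex_of_real (?u k * ?u l) = complex_of_real (sqrt N * sqrt N) * (B $$ (i, k) * B $$ (i, l))"
      by (simp only: of_real_mult mult_ac)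
    then show "of_nat N * (?A $$ (i, k) * ?A $$ (i, l) * H l k) = complex_of_real (?u k * ?u l) * H l k"
      using kl i unfolding sq by (auto simp: I_def idx)
  qed
  also have "\<dots> = (\<Sum>k\<in>I. complex_of_real (?u k * ?u k) * H k k + (\<Sum>l\<in>I - {k}. complex_of_real (?u k * ?u l) * H l k))"
    by (intro sum.cong refl sum.remove) (auto simp: I_def)
  \<comment> \<open>Scaled entries off the diagonal have mean square 1; splitting off this 1 exposes
    the trace of the minor, to be compared with \<open>N\<close> times \<open>?m\<close>.\<close>
  also have "\<dots> = ?off + ?diag + (\<Sum>k\<in>I. H k k)"
    by (simp add: sum.distrib[symmetric] power2_eq_square algebra_simps)
  finally have S: "of_nat N * ?S = ?off + ?diag + (\<Sum>k\<in>I. H k k)" .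
  let ?E = "?A $$ (i, i) - lam * v i + ?m - ?S"
  have "of_nat N * ?m = ?tr" using N by (simp add: stieltjes_eq_trace[OF A z(1)])
  then have "of_nat N * ?E = of_real (real N * B $$ (i, i)) + (?tr - (\<Sum>k\<in>I. H k k)) - ?off - ?diag"
    unfolding right_diff_distrib distrib_left S using i by (simp add: idx algebra_simps)
  then have "cmod (of_nat N * ?E) \<le> cmod (of_real (real N * B $$ (i, i))) + cmod (?tr - (\<Sum>k\<in>I. H k k)) + cmod ?off + cmod ?diag"
    by (smt (verit) norm_triangle_ineq norm_triangle_ineq4)
  also have "cmod (of_real (real N * B $$ (i, i))) = sqrt N * \<bar>?u i\<bar>"
  proof -
    have "real N * B $$ (i, i) = sqrt N * ?u i" using sq by (simp only: mult.assoc[symmetric])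
    then show ?thesis by (simp only: norm_of_real abs_mult) simp
  qed
  also have "\<dots> < sqrt N * T" using entry pos by (intro mult_strict_left_mono)
  finally have "cmod (of_nat N * ?E) < sqrt N * T + 2 / \<bar>Im z\<bar> + 2 * (sqrt N * T / \<bar>Im z\<bar>) + 2 * (sqrt N * T / \<bar>Im z\<bar>)"
    using off diag resolvent_trace_minor[OF A z(1) i] unfolding H_def I_def by linarith
  also have "\<dots> \<le> 9 * (sqrt N * T / \<bar>Im z\<bar>)"
  proof -
    \<comment> \<open>In units of \<open>y\<close> the entry contributes 3 by
      \<open>|Im z| \<le> 3\<close>, the trace difference 2, and each of the two forms 2: together
      9.\<close>
    define y where "y = sqrt N * T / \<bar>Im z\<bar>"
    have "1 \<le> sqrt N * T" using N T by (intro order.trans[OF _ mult_mono[of 1 "sqrt N" 1 T]]) auto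
    then have "2 / \<bar>Im z\<bar> \<le> 2 * y" unfolding y_def using pos by (simp add: divide_right_mono)
    moreover have "sqrt N * T = y * \<bar>Im z\<bar>" unfolding y_def using pos by simp
    moreover have "y * \<bar>Im z\<bar> \<le> y * 3" unfolding y_def using z T pos by (intro mult_left_mono) auto
    ultimately show ?thesis unfolding y_def[symmetric] by linarith
  qed
  finally have "real N * cmod ?E < 9 * (sqrt N * T / \<bar>Im z\<bar>)" by (simp add: norm_mult)
  also have "\<dots> = (sqrt N * sqrt N) * (9 * T / (sqrt N * \<bar>Im z\<bar>))" using pos by (simp add: field_simps del: real_sqrt_mult_self)
  also have "sqrt N * sqrt N = N" by (rule sq)
  finally have E: "cmod ?E < 9 * T / (sqrt N * \<bar>Im z\<bar>)" using N(1) by (simp only: mult_less_cancel_left_pos)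
  have "cmod (entry_error N lam B v z i i) \<le> cmod ?E / (Im z)\<^sup>2"
    using resolvent_diag_bound[OF A z(1) i, of "lam * v i"] by (simp add: entry_error_def Let_def H_def I_def)
  also have "\<dots> < 9 * T / (sqrt N * \<bar>Im z\<bar>) / (Im z)\<^sup>2" using E z by (intro divide_strict_right_mono) auto
  also have "\<dots> = 9 * T / (sqrt N * \<bar>Im z\<bar> ^ 3)"
    unfolding power2_abs[of "Im z", symmetric] power2_eq_square power3_eq_cube by simp
  finally show ?thesis .
qed

lemma borel_measurable_entry_error:
  assumes A: "\<And>\<omega>. \<omega> \<in> space S \<Longrightarrow> symmetric_mat N (B \<omega>)"
    and m: "\<And>i j. i < N \<Longrightarrow> j < N \<Longrightarrow> (\<lambda>\<omega>. B \<omega> $$ (i, j)) \<in> borel_measurable S"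
    and v: "\<And>i. i < N \<Longrightarrow> (\<lambda>\<omega>. v \<omega> i) \<in> borel_measurable S"
    and z: "Im z \<noteq> 0" and ij: "i < N" "j < N"
  shows "(\<lambda>\<omega>. entry_error N lam (B \<omega>) (v \<omega>) z i j) \<in> borel_measurable S"
proof -
  have sym: "symmetric_mat N (deformed_wigner N lam (B \<omega>) (v \<omega>))" if "\<omega> \<in> space S" for \<omega>
    by (rule symmetric_deformed_wigner[OF A[OF that]])
  have ent: "(\<lambda>\<omega>. deformed_wigner N lam (B \<omega>) (v \<omega>) $$ (k, l)) \<in> borel_measurable S" if kl: "k < N" "l < N" for k l
  proof -
    have "(\<lambda>\<omega>. B \<omega> $$ (k, l) + (if k = l then lam * v \<omega> k else 0)) \<in> borel_measurable S"
      using m[OF kl] v[OF kl(1)] by (cases "k = l") auto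
    then show ?thesis
      by (rule measurable_eqI) (rule deformed_wigner_index[OF symmetric_matD(1)[OF A] kl])
  qed
  show ?thesis
    unfolding entry_error_def Let_def
    by (intro borel_measurable_diff borel_measurable_times borel_measurable_divide borel_measurable_const
        borel_measurable_complex_of_real borel_measurable_resolvent[OF sym ent z ij] v[OF ij(1)]
        borel_measurable_stieltjes[OF sym ent z])
qed

text \<open>The diagonal \<open>v\<close> is deterministic here. By the deterministic bounds a large
  error forces \<open>W_ii\<close> or one of the row forms over its threshold, and
  \<open>entry_const\<close> collects these tails independently of \<open>N\<close>,
  \<open>v\<close>, \<open>z\<close>, \<open>i\<close> and \<open>j\<close>.\<close>

lemma entry_error_tail:
  fixes T :: real
  assumes W: "wigner_matrix M N \<theta> \<theta>' W" and N: "N \<ge> 1" and \<theta>: "\<theta> > 0" and p: "p \<ge> 2"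
    and z: "Im z \<noteq> 0" "\<bar>Im z\<bar> \<le> 3" and ij: "i < N" "j < N" and T: "T \<ge> 1"
  shows "measure M {\<omega> \<in> space M. 9 * T / (sqrt N * \<bar>Im z\<bar> ^ 3) \<le> cmod (entry_error N lam (W \<omega>) v z i j)}
    \<le> entry_const p \<theta> \<theta>' / T ^ (2 * p)"
proof -
  interpret prob_space M using W by (simp add: wigner_matrix_def)
  note asm = W N \<theta> p
  let ?K = "stretched_moment (2 * p) \<theta> \<theta>'"
  let ?H = "\<lambda>\<omega> k l. resolvent N (isolate_index N i (deformed_wigner N lam (W \<omega>) v)) z $$ (k, l)"
  let ?row = "\<lambda>k \<omega>. sqrt N * W \<omega> $$ sorted_pair i k"
  let ?I = "{..<N} - {i}"
  have K0: "?K \<ge> 0" using stretched_moment_nonneg[OF asm, of p] p by simp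
  have Tp: "T ^ (2 * p) > 0" using T by simp
  have c: "chaos_const p ?K > 0" "chaos_const p (square_moment p \<theta> \<theta>') > 0"
    using K0 square_moment_nonneg[OF asm] by (auto simp: chaos_const_def)
  have row: "?row k \<omega> = sqrt N * W \<omega> $$ (i, k)" if "\<omega> \<in> space M" "k < N" for k \<omega>
    using wigner_sorted_pair[OF asm that(1) ij(1) that(2)] by simp
  note sym = wigner_symmetric[OF asm]
  have symA: "symmetric_mat N (isolate_index N i (deformed_wigner N lam (W \<omega>) v))" if "\<omega> \<in> space M" for \<omega>
    by (intro symmetric_isolate_index symmetric_deformed_wigner sym that)
  have mrow: "?row k \<in> borel_measurable M" if "k < N" for k
  proof -
    have "(\<lambda>\<omega>. sqrt N * W \<omega> $$ (i, k)) \<in> borel_measurable M"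
      using wigner_entry_measurable[OF asm ij(1) that] by (intro borel_measurable_times borel_measurable_const)
    then show ?thesis by (rule measurable_eqI) (rule row[OF _ that])
  qed
  have mH: "(\<lambda>\<omega>. ?H \<omega> k l) \<in> borel_measurable M" if kl: "k < N" "l < N" for k l
  proof (rule borel_measurable_resolvent[OF symA _ z(1) kl])
    fix k l assume kl: "k < N" "l < N"
    have "(\<lambda>\<omega>. if k = i \<or> l = i then 0 else W \<omega> $$ (k, l) + (if k = l then lam * v k else 0)) \<in> borel_measurable M"
      using wigner_entry_measurable[OF asm kl] by (cases "k = i \<or> l = i") auto
    then show "(\<lambda>\<omega>. isolate_index N i (deformed_wigner N lam (W \<omega>) v) $$ (k, l)) \<in> borel_measurable M"
      by (rule measurable_eqI)
        (simp add: isolate_index_def kl deformed_wigner_index[OF symmetric_matD(1)[OF sym] kl])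
  qed
  show ?thesis
  proof (cases "i = j")
    case False
    let ?L = "\<lambda>\<omega>. cmod (\<Sum>k\<in>?I. ?row k \<omega> * ?H \<omega> k j)"
    have "prob {\<omega> \<in> space M. 9 * T / (sqrt N * \<bar>Im z\<bar> ^ 3) \<le> cmod (entry_error N lam (W \<omega>) v z i j)}
       \<le> prob {\<omega> \<in> space M. 2 * (T / \<bar>Im z\<bar>) \<le> ?L \<omega>}"
    proof (intro finite_measure_mono subsetI)
      fix \<omega> assume "\<omega> \<in> {\<omega> \<in> space M. 9 * T / (sqrt N * \<bar>Im z\<bar> ^ 3) \<le> cmod (entry_error N lam (W \<omega>) v z i j)}"
      then have \<omega>: "\<omega> \<in> space M" and ge: "\<not> cmod (entry_error N lam (W \<omega>) v z i j) < 9 * T / (sqrt N * \<bar>Im z\<bar> ^ 3)"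
        by auto
      have L: "?L \<omega> = cmod (\<Sum>k\<in>?I. complex_of_real (sqrt N * W \<omega> $$ (i, k)) * ?H \<omega> k j)"
        by (intro arg_cong[where f = cmod] sum.cong refl) (simp add: row[OF \<omega>])
      have "\<not> ?L \<omega> < 2 * (T / \<bar>Im z\<bar>)"
        using entry_error_offdiag_bound[OF sym[OF \<omega>] z ij False, of T lam v] T ge unfolding L by auto
      then show "\<omega> \<in> {\<omega> \<in> space M. 2 * (T / \<bar>Im z\<bar>) \<le> ?L \<omega>}" using \<omega> by simp
    next
      have "?L \<in> borel_measurable M" using ij
        by (intro measurable_compose[OF _ borel_measurable_norm] borel_measurable_sum borel_measurable_times
            borel_measurable_complex_of_real mrow mH)
          (auto simp del: of_real_mult of_real_power of_real_diff)
      then show "{\<omega> \<in> space M. 2 * (T / \<bar>Im z\<bar>) \<le> ?L \<omega>} \<in> sets M"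
        unfolding borel_measurable_iff_ge by blast
    qed
    also have "\<dots> \<le> 2 * (2 * chaos_const p ?K) ^ p / T ^ (2 * p)"
      using prob_row_linear[OF asm ij(1) z(1) T ij(2)] .
    also have "\<dots> \<le> entry_const p \<theta> \<theta>' / T ^ (2 * p)"
      using K0 c T by (intro divide_right_mono) (auto simp: entry_const_def Let_def intro!: add_nonneg_nonneg)
    finally show ?thesis .
  next
    case True
    have i: "i < N" by (rule ij(1))
    let ?d = "\<lambda>\<omega>. \<bar>sqrt N * W \<omega> $$ (i, i)\<bar>"
    let ?Q = "\<lambda>\<omega>. cmod (\<Sum>k\<in>?I. \<Sum>l\<in>?I - {k}. ?row k \<omega> * ?row l \<omega> * ?H \<omega> l k)"
    let ?D = "\<lambda>\<omega>. cmod (\<Sum>k\<in>?I. of_real ((?row k \<omega>)\<^sup>2 - 1) * ?H \<omega> k k)"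
    let ?t = "2 * (sqrt N * T / \<bar>Im z\<bar>)"
    have s1: "{\<omega> \<in> space M. T \<le> ?d \<omega>} \<in> sets M"
      using wigner_entry_measurable[OF asm i i] by measurable
    have s2: "{\<omega> \<in> space M. ?t \<le> ?Q \<omega>} \<in> sets M"
    proof -
      have "?Q \<in> borel_measurable M"
        by (intro measurable_compose[OF _ borel_measurable_norm] borel_measurable_sum borel_measurable_times
            borel_measurable_complex_of_real mrow mH)
          (auto simp del: of_real_mult of_real_power of_real_diff)
      then show ?thesis unfolding borel_measurable_iff_ge by blast
    qed
    have s3: "{\<omega> \<in> space M. ?t \<le> ?D \<omega>} \<in> sets M"
    proof -
      have "?D \<in> borel_measurable M"
        by (intro measurable_compose[OF _ borel_measurable_norm] borel_measurable_sum borel_measurable_times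
            borel_measurable_complex_of_real borel_measurable_diff borel_measurable_power borel_measurable_const mrow mH)
          (auto simp del: of_real_mult of_real_power of_real_diff)
      then show ?thesis unfolding borel_measurable_iff_ge by blast
    qed
    have "prob {\<omega> \<in> space M. 9 * T / (sqrt N * \<bar>Im z\<bar> ^ 3) \<le> cmod (entry_error N lam (W \<omega>) v z i j)}
       \<le> prob ({\<omega> \<in> space M. T \<le> ?d \<omega>} \<union> {\<omega> \<in> space M. ?t \<le> ?Q \<omega>} \<union> {\<omega> \<in> space M. ?t \<le> ?D \<omega>})"
    proof (intro finite_measure_mono sets.Un s1 s2 s3 subsetI)
      fix \<omega> assume "\<omega> \<in> {\<omega> \<in> space M. 9 * T / (sqrt N * \<bar>Im z\<bar> ^ 3) \<le> cmod (entry_error N lam (W \<omega>) v z i j)}"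
      then have \<omega>: "\<omega> \<in> space M" and ge: "\<not> cmod (entry_error N lam (W \<omega>) v z i i) < 9 * T / (sqrt N * \<bar>Im z\<bar> ^ 3)"
        using True by auto
      have Q: "?Q \<omega> = cmod (\<Sum>k\<in>?I. \<Sum>l\<in>?I - {k}.
          complex_of_real ((sqrt N * W \<omega> $$ (i, k)) * (sqrt N * W \<omega> $$ (i, l))) * ?H \<omega> l k)"
        by (intro arg_cong[where f = cmod] sum.cong refl) (simp add: row[OF \<omega>])
      have D: "?D \<omega> = cmod (\<Sum>k\<in>?I. complex_of_real ((sqrt N * W \<omega> $$ (i, k))\<^sup>2 - 1) * ?H \<omega> k k)"
        by (intro arg_cong[where f = cmod] sum.cong refl) (simp add: row[OF \<omega>])
      have "\<not> (?d \<omega> < T \<and> ?Q \<omega> < ?t \<and> ?D \<omega> < ?t)"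
        using entry_error_diag_bound[OF sym[OF \<omega>] z i T, of lam v] ge unfolding Q D by blast
      then have "T \<le> ?d \<omega> \<or> ?t \<le> ?Q \<omega> \<or> ?t \<le> ?D \<omega>" unfolding de_Morgan_conj not_less .
      then show "\<omega> \<in> {\<omega> \<in> space M. T \<le> ?d \<omega>} \<union> {\<omega> \<in> space M. ?t \<le> ?Q \<omega>} \<union> {\<omega> \<in> space M. ?t \<le> ?D \<omega>}"
        using \<omega> by blast
    qed
    also have "\<dots> \<le> prob {\<omega> \<in> space M. T \<le> ?d \<omega>} + prob {\<omega> \<in> space M. ?t \<le> ?Q \<omega>} + prob {\<omega> \<in> space M. ?t \<le> ?D \<omega>}"
      by (intro order.trans[OF measure_Un_le] add_right_mono measure_Un_le sets.Un s1 s2 s3)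
    also have "\<dots> \<le> ?K / T ^ (2 * p) + 2 * (4 * (chaos_const p ?K)\<^sup>2) ^ p / T ^ (2 * p)
        + 2 * (2 * chaos_const p (square_moment p \<theta> \<theta>')) ^ p / T ^ (2 * p)"
      by (intro add_mono prob_diag_entry[OF asm i z(1) T] prob_row_offdiag[OF asm i z(1) T]
          prob_row_diag[OF asm i z(1) T])
    also have "\<dots> \<le> entry_const p \<theta> \<theta>' / T ^ (2 * p)"
      unfolding add_divide_distrib[symmetric]
      using c T by (intro divide_right_mono) (auto simp: entry_const_def Let_def)
    finally show ?thesis .
  qed
qed

section \<open>From a deterministic to a random diagonal\<close>

lemma entry_error_cong:
  assumes "\<And>k. k < N \<Longrightarrow> v k = v' k" and "i < N"
  shows "entry_error N lam B v z i j = entry_error N lam B v' z i j"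
proof -
  have "mat_diag N v = mat_diag N v'" using assms(1) by (auto simp: mat_diag_def intro!: eq_matI)
  then show ?thesis using assms by (simp add: entry_error_def deformed_wigner_def)
qed

text \<open>
  \<^const>\<open>prob_space.indep_var\<close> requires both variables to have the same type, hence the index set
  \<open>{..<N} \<times> {0}\<close> for the diagonal.
\<close>

lemma (in prob_space) matrix_diag_indep_var:
  assumes ind: "matrix_indep_of_diag M N W v"
    and W: "\<And>q. q \<in> upper_pairs N \<Longrightarrow> (\<lambda>\<omega>. W \<omega> $$ q) \<in> borel_measurable M"
    and v: "\<And>k. k < N \<Longrightarrow> v k \<in> borel_measurable M"
  shows "indep_var (PiM (upper_pairs N) (\<lambda>_. borel)) (\<lambda>\<omega>. \<lambda>q\<in>upper_pairs N. W \<omega> $$ q)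
    (PiM ({..<N} \<times> {0 :: nat}) (\<lambda>_. borel)) (\<lambda>\<omega>. \<lambda>q\<in>{..<N} \<times> {0 :: nat}. v (fst q) \<omega>)"
proof -
  let ?U = "PiM (upper_pairs N) (\<lambda>_. borel :: real measure)"
  let ?X = "\<lambda>\<omega>. \<lambda>q\<in>upper_pairs N. W \<omega> $$ q"
  let ?T = "PiM {..<N} (\<lambda>_. borel :: real measure)" and ?Y = "\<lambda>\<omega>. \<lambda>k\<in>{..<N}. v k \<omega>"
  let ?T' = "PiM ({..<N} \<times> {0 :: nat}) (\<lambda>_. borel :: real measure)"
  let ?Y' = "\<lambda>\<omega>. \<lambda>q\<in>{..<N} \<times> {0 :: nat}. v (fst q) \<omega>"
  let ?e = "\<lambda>x. \<lambda>q\<in>{..<N} \<times> {0 :: nat}. x (fst q)"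
  have X: "?X \<in> measurable M ?U" by (intro measurable_restrict W)
  have Y: "?Y \<in> measurable M ?T" by (intro measurable_restrict v) simp
  have e: "?e \<in> measurable ?T ?T'" by (intro measurable_restrict measurable_component_singleton) auto
  have Y'_eq: "?Y' = ?e \<circ> ?Y" by (auto simp: fun_eq_iff restrict_def)
  have Y': "?Y' \<in> measurable M ?T'" unfolding Y'_eq by (rule measurable_comp[OF Y e])
  \<comment> \<open>The reindexed vector is a measurable image of the original one, so it generates
    no larger sigma-algebra; this inclusion carries the independence over.\<close>
  have sub: "sigma_sets (space M) {?Y' -` A \<inter> space M | A. A \<in> sets ?T'} \<subseteq> sets (vimage_algebra (space M) ?Y ?T)"
    unfolding sets_vimage_algebra
  proof (rule sigma_sets_mono')
    show "{?Y' -` A \<inter> space M | A. A \<in> sets ?T'} \<subseteq> {?Y -` A \<inter> space M | A. A \<in> sets ?T}"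
    proof clarify
      fix A assume A: "A \<in> sets ?T'"
      have "?Y' -` A \<inter> space M = ?Y -` (?e -` A \<inter> space ?T) \<inter> space M"
        using measurable_space[OF Y] unfolding Y'_eq by auto
      then show "\<exists>B. ?Y' -` A \<inter> space M = ?Y -` B \<inter> space M \<and> B \<in> sets ?T"
        using measurable_sets[OF e A] by blast
    qed
  qed
  have "indep_set (sets (vimage_algebra (space M) ?X ?U)) (sets (vimage_algebra (space M) ?Y ?T))"
    using ind unfolding matrix_indep_of_diag_def .
  then have "indep_set (sets (vimage_algebra (space M) ?X ?U))
      (sigma_sets (space M) {?Y' -` A \<inter> space M | A. A \<in> sets ?T'})"
    using sub by (intro indep_setI) (auto dest: indep_setD indep_setD_ev1 indep_setD_ev2)
  then show ?thesis using X Y' unfolding indep_var_eq sets_vimage_algebra by blast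
qed

text \<open>The deterministic bound is uniform in \<open>v\<close>, so it survives averaging over
  \<open>v\<close>. The matrix is rebuilt from its upper entries because these are the vector known
  to be independent of the diagonal.\<close>

lemma entry_error_tail_random:
  fixes T :: real
  assumes W: "wigner_matrix M N \<theta> \<theta>' W" and N: "N \<ge> 1" and \<theta>: "\<theta> > 0" and p: "p \<ge> 2"
    and ind: "matrix_indep_of_diag M N W v" and v: "\<And>k. k < N \<Longrightarrow> v k \<in> borel_measurable M"
    and z: "Im z \<noteq> 0" "\<bar>Im z\<bar> \<le> 3" and ij: "i < N" "j < N" and T: "T \<ge> 1"
  shows "measure M {\<omega> \<in> space M. 9 * T / (sqrt N * \<bar>Im z\<bar> ^ 3)
      \<le> cmod (entry_error N lam (W \<omega>) (\<lambda>k. v k \<omega>) z i j)}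
    \<le> entry_const p \<theta> \<theta>' / T ^ (2 * p)"
proof -
  interpret prob_space M using W by (simp add: wigner_matrix_def)
  let ?U = "PiM (upper_pairs N) (\<lambda>_. borel :: real measure)"
  let ?X = "\<lambda>\<omega>. \<lambda>q\<in>upper_pairs N. W \<omega> $$ q"
  let ?T = "PiM ({..<N} \<times> {0 :: nat}) (\<lambda>_. borel :: real measure)"
  let ?Y = "\<lambda>\<omega>. \<lambda>q\<in>{..<N} \<times> {0 :: nat}. v (fst q) \<omega>"
  let ?mat = "\<lambda>x :: nat \<times> nat \<Rightarrow> real. mat N N (\<lambda>(k, l). x (sorted_pair k l))"
  let ?r = "9 * T / (sqrt N * \<bar>Im z\<bar> ^ 3)"
  let ?Q = "\<lambda>x y. ?r \<le> cmod (entry_error N lam (?mat x) (\<lambda>k. y (k, 0)) z i j)"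
  have sorted: "sorted_pair k l = sorted_pair l k" for k l
    by (simp add: sorted_pair_def min.commute max.commute)
  have sym: "symmetric_mat N (?mat x)" for x
    unfolding symmetric_mat_def using sorted by (auto intro!: eq_matI)
  have mat: "?mat (?X \<omega>) = W \<omega>" if \<omega>: "\<omega> \<in> space M" for \<omega>
  proof (rule eq_matI)
    note sW = symmetric_matD(1-3)[OF wigner_symmetric[OF W N \<theta> p \<omega>]]
    fix k l assume "k < dim_row (W \<omega>)" "l < dim_col (W \<omega>)"
    then have kl: "k < N" "l < N" using sW by auto
    then show "?mat (?X \<omega>) $$ (k, l) = W \<omega> $$ (k, l)"
      using sorted_pair_upper[OF kl] by (simp add: wigner_sorted_pair[OF W N \<theta> p \<omega> kl] del: mem_Collect_eq)
  qed (use symmetric_matD(2,3)[OF wigner_symmetric[OF W N \<theta> p \<omega>]] in auto)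
  have comp: "entry_error N lam (?mat (?X \<omega>)) (\<lambda>k. ?Y \<omega> (k, 0)) z i j
      = entry_error N lam (W \<omega>) (\<lambda>k. v k \<omega>) z i j" if "\<omega> \<in> space M" for \<omega>
    unfolding mat[OF that] by (intro entry_error_cong ij(1)) simp
  have indv: "indep_var ?U ?X ?T ?Y"
    using wigner_indep[OF W N \<theta> p] unfolding indep_vars_def
    by (intro matrix_diag_indep_var ind v) blast+
  have "prob {\<omega> \<in> space M. ?Q (?X \<omega>) (?Y \<omega>)} \<le> entry_const p \<theta> \<theta>' / T ^ (2 * p)"
  proof (rule prob_freeze_le[OF indv])
    have "(\<lambda>xy. entry_error N lam (?mat (fst xy)) (\<lambda>k. snd xy (k, 0)) z i j) \<in> borel_measurable (?U \<Otimes>\<^sub>M ?T)"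
    proof (rule borel_measurable_entry_error[OF sym _ _ z(1) ij])
      fix k l assume kl: "k < N" "l < N"
      have "(\<lambda>xy. fst xy (sorted_pair k l)) \<in> borel_measurable (?U \<Otimes>\<^sub>M ?T)"
        by (intro measurable_compose[OF measurable_fst measurable_component_singleton] sorted_pair_upper kl)
      then show "(\<lambda>xy. ?mat (fst xy) $$ (k, l)) \<in> borel_measurable (?U \<Otimes>\<^sub>M ?T)" using kl by simp
    next
      fix k assume "k < N"
      then show "(\<lambda>xy. snd xy (k, 0)) \<in> borel_measurable (?U \<Otimes>\<^sub>M ?T)"
        by (intro measurable_compose[OF measurable_snd measurable_component_singleton]) simp
    qed
    from measurable_compose[OF this borel_measurable_norm]
    show "{xy \<in> space (?U \<Otimes>\<^sub>M ?T). ?Q (fst xy) (snd xy)} \<in> sets (?U \<Otimes>\<^sub>M ?T)"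
      unfolding borel_measurable_iff_ge by blast
  next
    fix y
    have "{\<omega> \<in> space M. ?Q (?X \<omega>) y} = {\<omega> \<in> space M. ?r \<le> cmod (entry_error N lam (W \<omega>) (\<lambda>k. y (k, 0)) z i j)}"
      by (intro Collect_cong conj_cong refl) (simp only: mat)
    then show "prob {\<omega> \<in> space M. ?Q (?X \<omega>) y} \<le> entry_const p \<theta> \<theta>' / T ^ (2 * p)"
      using entry_error_tail[OF W N \<theta> p z ij T] by simp
  qed
  also have "{\<omega> \<in> space M. ?Q (?X \<omega>) (?Y \<omega>)}
      = {\<omega> \<in> space M. ?r \<le> cmod (entry_error N lam (W \<omega>) (\<lambda>k. v k \<omega>) z i j)}"
    by (intro Collect_cong conj_cong refl) (simp only: comp)
  finally show ?thesis .
qed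

section \<open>Uniformity in the spectral parameter\<close>

text \<open>Resolvent entries and \<open>m\<close> are Lipschitz with constant \<open>L\<close>. The
  denominator then has constant \<open>1 + L\<close>, and passing to its reciprocal costs a further
  factor \<open>L\<close> by the lower bounds at both points.\<close>

lemma entry_error_lipschitz:
  assumes B: "symmetric_mat N B" and z: "Im z \<noteq> 0" and w: "Im w \<noteq> 0" and ij: "i < N" "j < N"
  defines "L \<equiv> 1 / (\<bar>Im z\<bar> * \<bar>Im w\<bar>)"
  shows "cmod (entry_error N lam B v z i j - entry_error N lam B v w i j) \<le> cmod (z - w) * (L + (1 + L) * L)"
proof -
  let ?A = "deformed_wigner N lam B v"
  have A: "symmetric_mat N ?A" by (rule symmetric_deformed_wigner[OF B])
  define X where "X z = complex_of_real (lam * v i) - z - stieltjes N ?A z" for z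
  have pos: "\<bar>Im z\<bar> > 0" "\<bar>Im w\<bar> > 0" using z w by auto
  have X: "\<bar>Im z\<bar> \<le> cmod (X z)" "\<bar>Im w\<bar> \<le> cmod (X w)"
    unfolding X_def by (rule subordination_denominator[OF A z], rule subordination_denominator[OF A w])
  then have X0: "X z \<noteq> 0" "X w \<noteq> 0" using pos by auto
  have L0: "L \<ge> 0" using pos by (simp add: L_def)
  have G: "cmod (resolvent N ?A z $$ (i, j) - resolvent N ?A w $$ (i, j)) \<le> cmod (z - w) * L"
    using resolvent_lipschitz[OF A z w ij] by (simp add: L_def)
  have m: "cmod (stieltjes N ?A z - stieltjes N ?A w) \<le> cmod (z - w) * L"
    using stieltjes_lipschitz[OF A z w] ij by (simp add: L_def)
  have "X w - X z = (z - w) + (stieltjes N ?A z - stieltjes N ?A w)" by (simp add: X_def)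
  then have d: "cmod (X w - X z) \<le> cmod (z - w) * (1 + L)"
    using norm_triangle_ineq[of "z - w" "stieltjes N ?A z - stieltjes N ?A w"] m
    by (simp only: distrib_left)
  have "1 / X z - 1 / X w = (X w - X z) * (1 / (X z * X w))" using X0 by (simp add: field_simps)
  then have "cmod (1 / X z - 1 / X w) = cmod (X w - X z) * (1 / (cmod (X z) * cmod (X w)))"
    by (simp add: norm_mult norm_divide)
  also have "\<dots> \<le> (cmod (z - w) * (1 + L)) * L"
    unfolding L_def[symmetric] using d X pos L0
    by (intro mult_mono) (auto simp: L_def intro!: divide_left_mono mult_mono mult_pos_pos)
  finally have F: "cmod (1 / X z - 1 / X w) \<le> cmod (z - w) * (1 + L) * L" .
  define c where "c = (if i = j then 1 else (0 :: complex))"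
  have c: "cmod c \<le> 1" by (simp add: c_def)
  have "entry_error N lam B v z i j - entry_error N lam B v w i j
      = (resolvent N ?A z $$ (i, j) - resolvent N ?A w $$ (i, j)) - c * (1 / X z - 1 / X w)"
    unfolding entry_error_def Let_def X_def c_def by (simp add: algebra_simps)
  also have "cmod \<dots> \<le> cmod (resolvent N ?A z $$ (i, j) - resolvent N ?A w $$ (i, j)) + cmod (c * (1 / X z - 1 / X w))"
    by (rule norm_triangle_ineq4)
  also have "cmod (c * (1 / X z - 1 / X w)) \<le> 1 * cmod (1 / X z - 1 / X w)"
    unfolding norm_mult by (intro mult_right_mono c) simp
  finally show ?thesis using G F by (simp add: algebra_simps)
qed

text \<open>One point of \<open>S\<close> is chosen in every grid cell of side \<open>h\<close> that
  meets \<open>S\<close>. Keeping the net inside \<open>S\<close> matters: imaginary parts are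
  bounded away from 0 only there.\<close>

lemma finite_net_of_rectangle:
  assumes S: "S \<subseteq> {z. \<bar>Re z\<bar> \<le> R \<and> \<bar>Im z\<bar> \<le> R}" and h: "h > 0" and R: "R \<ge> 0"
  obtains T where "finite T" "T \<subseteq> S" "real (card T) \<le> (2 * R / h + 2)\<^sup>2"
    "\<And>z. z \<in> S \<Longrightarrow> \<exists>t\<in>T. cmod (z - t) \<le> 2 * h"
proof -
  define key where "key z = (\<lfloor>Re z / h\<rfloor>, \<lfloor>Im z / h\<rfloor>)" for z
  define J where "J = {\<lfloor>- R / h\<rfloor>..\<lfloor>R / h\<rfloor>}"
  define rep where "rep k = (SOME z. z \<in> S \<and> key z = k)" for k
  have rep: "rep (key z) \<in> S" "key (rep (key z)) = key z" if "z \<in> S" for z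
    using someI[of "\<lambda>w. w \<in> S \<and> key w = key z" z] that by (auto simp: rep_def)
  have keys: "key ` S \<subseteq> J \<times> J"
  proof (intro image_subsetI)
    fix z assume "z \<in> S"
    then have "- R \<le> Re z" "Re z \<le> R" "- R \<le> Im z" "Im z \<le> R" using S by (auto simp: abs_le_iff)
    then have "- R / h \<le> Re z / h" "Re z / h \<le> R / h" "- R / h \<le> Im z / h" "Im z / h \<le> R / h"
      using h by (intro divide_right_mono, simp, simp)+
    then show "key z \<in> J \<times> J" unfolding key_def J_def by (auto intro: floor_mono)
  qed
  have finJ: "finite (J \<times> J)" by (simp add: J_def)
  show thesis
  proof (rule that[of "rep ` key ` S"])
    show "finite (rep ` key ` S)" using finite_subset[OF keys finJ] by simp
    show "rep ` key ` S \<subseteq> S" using rep by auto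
    have "0 \<le> R / h" using R h by simp
    then have "real (card J) \<le> 2 * R / h + 2" unfolding J_def by (simp add: nat_diff_distrib) linarith
    moreover have "card (rep ` key ` S) \<le> card (J \<times> J)"
      using card_image_le[OF finite_subset[OF keys finJ]] card_mono[OF finJ keys] by (rule order.trans)
    then have "real (card (rep ` key ` S)) \<le> (real (card J))\<^sup>2"
      by (simp add: card_cartesian_product power2_eq_square flip: of_nat_mult)
    ultimately show "real (card (rep ` key ` S)) \<le> (2 * R / h + 2)\<^sup>2"
      by (meson of_nat_0_le_iff order.trans power_mono)
    fix z assume z: "z \<in> S"
    let ?t = "rep (key z)"
    have close: "\<bar>x - y\<bar> \<le> h" if "\<lfloor>x / h\<rfloor> = \<lfloor>y / h\<rfloor>" for x y :: real
    proof -
      have "\<bar>x / h - y / h\<bar> \<le> 1" using that by linarith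
      then show ?thesis using h by (simp add: diff_divide_distrib[symmetric] abs_divide)
    qed
    have "\<bar>Re z - Re ?t\<bar> \<le> h" "\<bar>Im z - Im ?t\<bar> \<le> h"
      using rep(2)[OF z] by (auto simp: key_def intro!: close)
    then have "cmod (z - ?t) \<le> 2 * h" using cmod_le[of "z - ?t"] by simp
    then show "\<exists>t\<in>rep ` key ` S. cmod (z - t) \<le> 2 * h" using z by blast
  qed
qed

text \<open>Both sides are continuous off the real axis, so the bound on a countable dense set
  implies it on the whole domain. This makes the event of the theorem measurable.\<close>

lemma entry_error_bound_closure:
  assumes B: "symmetric_mat N B" and ij: "i < N" "j < N" and z: "Im z \<noteq> 0" "z \<in> closure T"
    and T: "\<And>t. t \<in> T \<Longrightarrow> Im t \<noteq> 0"
    and le: "\<And>t. t \<in> T \<Longrightarrow> cmod (entry_error N lam B v t i j) \<le> c * \<bar>Im t\<bar> powr (- 3)"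
  shows "cmod (entry_error N lam B v z i j) \<le> c * \<bar>Im z\<bar> powr (- 3)"
proof -
  obtain t where t: "\<And>n. t n \<in> T" and lim: "t \<longlonglongrightarrow> z"
    using z(2) unfolding closure_sequential by blast
  let ?e = "\<lambda>z. entry_error N lam B v z i j"
  let ?L = "\<lambda>n. 1 / (\<bar>Im (t n)\<bar> * \<bar>Im z\<bar>)"
  have "(\<lambda>n. ?e (t n) - ?e z) \<longlonglongrightarrow> 0"
  proof (rule Lim_null_comparison)
    show "\<forall>\<^sub>F n in sequentially. norm (?e (t n) - ?e z) \<le> cmod (t n - z) * (?L n + (1 + ?L n) * ?L n)"
      using entry_error_lipschitz[OF B T[OF t] z(1) ij] by auto
    have "(\<lambda>n. cmod (t n - z) * (?L n + (1 + ?L n) * ?L n))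
        \<longlonglongrightarrow> cmod (z - z) * (1 / (\<bar>Im z\<bar> * \<bar>Im z\<bar>) + (1 + 1 / (\<bar>Im z\<bar> * \<bar>Im z\<bar>)) * (1 / (\<bar>Im z\<bar> * \<bar>Im z\<bar>)))"
      using z(1) by (intro tendsto_intros lim) auto
    then show "(\<lambda>n. cmod (t n - z) * (?L n + (1 + ?L n) * ?L n)) \<longlonglongrightarrow> 0" by simp
  qed
  then have e: "(\<lambda>n. cmod (?e (t n))) \<longlonglongrightarrow> cmod (?e z)" by (intro tendsto_norm) (simp add: LIM_zero_iff)
  have "(\<lambda>n. c * \<bar>Im (t n)\<bar> powr (- 3)) \<longlonglongrightarrow> c * \<bar>Im z\<bar> powr (- 3)"
    using z(1) by (intro tendsto_intros lim) auto
  then show ?thesis by (rule LIMSEQ_le[OF e]) (use le t in auto)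
qed

text \<open>The probabilistic bound uses only half of the exponent \<open>\<epsilon>\<close>; the
  other half absorbs 153 = 72 + 81. The 72 = 9 * 8 comes from moving the cube of the imaginary part
  from \<open>t\<close> to \<open>z\<close>, the 81 = 3 * 27 from the Lipschitz error
  \<open>3 / N\<close> together with \<open>|Im z| \<le> 3\<close>.\<close>

lemma entry_error_net_step:
  assumes B: "symmetric_mat N B" and ij: "i < N" "j < N" and N: "N \<ge> 2"
    and im: "1 / real N \<le> \<bar>Im z\<bar>" "1 / real N \<le> \<bar>Im t\<bar>" "\<bar>Im z\<bar> \<le> 3"
    and close: "cmod (z - t) \<le> 1 / real N ^ 5"
    and large: "153 \<le> real N powr (\<epsilon> / 2)"
    and t: "cmod (entry_error N lam B v t i j) < 9 * real N powr (\<epsilon> / 2) / (sqrt N * \<bar>Im t\<bar> ^ 3)"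
  shows "cmod (entry_error N lam B v z i j) \<le> real N powr (\<epsilon> - 1 / 2) * \<bar>Im z\<bar> powr (- 3)"
proof -
  let ?e = "\<lambda>z. entry_error N lam B v z i j"
  let ?n = "real N"
  define x y where "x = \<bar>Im z\<bar>" and "y = \<bar>Im t\<bar>"
  have n: "?n \<ge> 2" "?n > 0" using N by auto
  have xy: "x > 0" "y > 0" "1 / ?n \<le> x" "1 / ?n \<le> y" "x \<le> 3"
    using im n by (auto simp: x_def y_def intro: less_le_trans[OF divide_pos_pos[of 1 ?n]])
  define L where "L = 1 / (x * y)"
  have inv: "1 / x \<le> ?n" "1 / y \<le> ?n" using xy n by (auto simp: field_simps)
  have L: "0 \<le> L" "L \<le> ?n\<^sup>2"
  proof -
    show "0 \<le> L" using xy by (simp add: L_def)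
    have "L = (1 / x) * (1 / y)" by (simp add: L_def)
    also have "\<dots> \<le> ?n * ?n" using inv xy n by (intro mult_mono) auto
    finally show "L \<le> ?n\<^sup>2" by (simp add: power2_eq_square)
  qed
  have n2: "1 \<le> ?n\<^sup>2" using n by (simp add: one_le_power)
  have "L + (1 + L) * L = 2 * L + L * L" by (simp add: algebra_simps)
  also have "\<dots> \<le> 2 * (?n\<^sup>2 * ?n\<^sup>2) + ?n\<^sup>2 * ?n\<^sup>2"
  proof (intro add_mono mult_mono)
    show "L \<le> ?n\<^sup>2 * ?n\<^sup>2" using L n2 mult_left_mono[OF n2, of "?n\<^sup>2"] by simp
  qed (use L in auto)
  finally have Lsum: "L + (1 + L) * L \<le> 3 * ?n ^ 4" by (simp add: power2_eq_square power4_eq_xxxx)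
  have "Im z \<noteq> 0" "Im t \<noteq> 0" using xy by (auto simp: x_def y_def)
  from entry_error_lipschitz[OF B this ij, of lam v]
  have "cmod (?e z - ?e t) \<le> cmod (z - t) * (L + (1 + L) * L)" by (simp add: L_def x_def y_def)
  also have "\<dots> \<le> (1 / ?n ^ 5) * (3 * ?n ^ 4)" using close Lsum L by (intro mult_mono) auto
  also have "\<dots> = 3 / ?n" using n by (simp add: field_simps eval_nat_numeral)
  finally have diff: "cmod (?e z - ?e t) \<le> 3 / ?n" .
  \<comment> \<open>The mesh is small against 1/N, which is at most \<open>x\<close>; so
    \<open>x\<close> is at most \<open>2 * y\<close>, and the cubes compare with factor 8.\<close>
  have "x - y \<le> cmod (z - t)" using abs_Im_le_cmod[of "z - t"] by (simp add: x_def y_def)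
  also have "\<dots> \<le> 1 / ?n ^ 5" by (rule close)
  also have "\<dots> \<le> (1 / ?n) / 2"
  proof -
    have "?n ^ 1 \<le> ?n ^ 4" using n by (intro power_increasing) auto
    then have "2 \<le> ?n ^ 4" using n unfolding power_one_right by linarith
    then have "2 * ?n \<le> ?n ^ 4 * ?n" using n by (intro mult_right_mono) auto
    then show ?thesis using n by (simp add: field_simps eval_nat_numeral)
  qed
  also have "\<dots> \<le> x / 2" using xy by (intro divide_right_mono) auto
  finally have half: "x \<le> 2 * y" by simp
  have "x ^ 3 \<le> (2 * y) ^ 3" using half xy by (intro power_mono) auto
  then have cube: "1 / y ^ 3 \<le> 8 / x ^ 3" using xy by (simp add: field_simps power_mult_distrib)
  define a where "a = ?n powr (\<epsilon> / 2)"
  have a: "153 \<le> a" using large by (simp add: a_def)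
  have sq: "sqrt ?n > 0" "1 \<le> sqrt ?n" "sqrt ?n * sqrt ?n = ?n" using n by auto
  have "cmod (?e t) < 9 * a / sqrt ?n * (1 / y ^ 3)" using t by (simp add: a_def y_def)
  also have "\<dots> \<le> 9 * a / sqrt ?n * (8 / x ^ 3)" using a sq cube by (intro mult_left_mono) auto
  finally have et: "cmod (?e t) < 72 * (a / (sqrt ?n * x ^ 3))" by simp
  have "3 / ?n \<le> 81 * (a / (sqrt ?n * x ^ 3))"
  proof -
    have "x ^ 3 \<le> 3 ^ 3" using xy by (intro power_mono) auto
    then have "3 * (sqrt ?n * x ^ 3) \<le> 3 * (sqrt ?n * 27)" using sq by (intro mult_left_mono) auto
    also have "\<dots> \<le> 81 * (sqrt ?n * sqrt ?n)" using mult_left_mono[OF sq(2), of "sqrt ?n"] sq(1) by linarith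
    also have "\<dots> = 81 * (1 * ?n)" unfolding sq(3) by simp
    also have "\<dots> \<le> 81 * (a * ?n)" using a n by (intro mult_left_mono mult_right_mono) auto
    finally have "3 * (sqrt ?n * x ^ 3) \<le> 81 * a * ?n" by simp
    then show ?thesis using n sq xy by (simp add: field_simps)
  qed
  moreover have "cmod (?e z) \<le> cmod (?e t) + cmod (?e z - ?e t)" by (rule norm_triangle_sub)
  ultimately have "cmod (?e z) \<le> 153 * (a / (sqrt ?n * x ^ 3))" using et diff by linarith
  also have "\<dots> \<le> a * (a / (sqrt ?n * x ^ 3))" using a sq xy by (intro mult_right_mono) auto
  also have "\<dots> = ?n powr (\<epsilon> - 1 / 2) * x powr (- 3)"
  proof -
    have "a * a = ?n powr \<epsilon>" using n by (simp add: a_def flip: powr_add)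
    moreover have s: "sqrt ?n = ?n powr (1 / 2)" using n by (simp add: powr_half_sqrt)
    moreover have c: "1 / x ^ 3 = x powr (- 3)" using xy by (simp add: powr_minus_divide)
    have "a * (a / (sqrt ?n * x ^ 3)) = (a * a) / sqrt ?n * (1 / x ^ 3)" by simp
    ultimately show ?thesis unfolding c s powr_diff by (simp only:)
  qed
  finally show ?thesis unfolding x_def .
qed

section \<open>Union bound over the net\<close>

context
  fixes M :: "'a measure" and N p :: nat and \<theta> \<theta>' lam R \<delta> \<epsilon> :: real and W :: "'a \<Rightarrow> real mat"
    and v :: "nat \<Rightarrow> 'a \<Rightarrow> real"
  assumes W: "wigner_matrix M N \<theta> \<theta>' W" and N: "N \<ge> 2" and \<theta>: "\<theta> > 0" and p: "p \<ge> 2"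
    and ind: "matrix_indep_of_diag M N W v" and v: "\<And>k. k < N \<Longrightarrow> v k \<in> borel_measurable M"
    and R: "R > 0" and \<delta>: "\<delta> \<le> 1 / 4" and large: "153 \<le> real N powr (\<epsilon> / 2)"
begin

interpretation prob_space M using W by (simp add: wigner_matrix_def)

private abbreviation (input) err :: "complex \<Rightarrow> nat \<Rightarrow> nat \<Rightarrow> 'a \<Rightarrow> complex" where
  "err z i j \<omega> \<equiv> entry_error N lam (W \<omega>) (\<lambda>k. v k \<omega>) z i j"

private abbreviation (input) good :: "'a set" where
  "good \<equiv> {\<omega> \<in> space M. \<forall>z\<in>spectral_domain N \<delta> R. \<forall>i<N. \<forall>j<N.
     cmod (err z i j \<omega>) \<le> real N powr (\<epsilon> - 1 / 2) * \<bar>Im z\<bar> powr (- 3)}"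

private lemma N1: "N \<ge> 1" using N by simp

private lemma spectral_domain_Im:
  assumes "z \<in> spectral_domain N \<delta> R"
  shows "Im z \<noteq> 0" "\<bar>Im z\<bar> \<le> 3" "1 / real N \<le> \<bar>Im z\<bar>"
proof -
  have "real N powr (- 1) \<le> real N powr (- \<delta>)" using N \<delta> by (intro powr_mono) auto
  then show "1 / real N \<le> \<bar>Im z\<bar>" using assms N by (simp add: spectral_domain_def powr_minus_divide)
  moreover have "1 / real N > 0" using N by simp
  ultimately show "Im z \<noteq> 0" by auto
  show "\<bar>Im z\<bar> \<le> 3" using assms by (simp add: spectral_domain_def)
qed

private lemma wigner_sym: "\<omega> \<in> space M \<Longrightarrow> symmetric_mat N (W \<omega>)"
  by (rule wigner_symmetric[OF W N1 \<theta> p])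

private lemma err_measurable:
  assumes "Im z \<noteq> 0" "i < N" "j < N"
  shows "(\<lambda>\<omega>. cmod (err z i j \<omega>)) \<in> borel_measurable M"
  by (rule measurable_compose[OF borel_measurable_entry_error[OF wigner_sym
        wigner_entry_measurable[OF W N1 \<theta> p] v assms] borel_measurable_norm])

text \<open>
  The event is an uncountable intersection, and a non-measurable set would have \<^const>\<open>measure\<close> 0.
\<close>

lemma good_event_measurable: "good \<in> sets M"
proof -
  let ?D = "spectral_domain N \<delta> R"
  obtain T where T: "countable T" "T \<subseteq> ?D" "?D \<subseteq> closure T" by (rule separable)
  let ?c = "real N powr (\<epsilon> - 1 / 2)"
  let ?G = "\<lambda>z i j. {\<omega> \<in> space M. cmod (err z i j \<omega>) \<le> ?c * \<bar>Im z\<bar> powr (- 3)}"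
  have "good = {\<omega> \<in> space M. \<forall>z\<in>T. \<forall>i<N. \<forall>j<N. cmod (err z i j \<omega>) \<le> ?c * \<bar>Im z\<bar> powr (- 3)}"
  proof (intro Collect_cong conj_cong refl iffI ballI allI impI)
    fix \<omega> z i j
    assume \<omega>: "\<omega> \<in> space M" and le: "\<forall>z\<in>T. \<forall>i<N. \<forall>j<N. cmod (err z i j \<omega>) \<le> ?c * \<bar>Im z\<bar> powr (- 3)"
      and z: "z \<in> ?D" and ij: "i < N" "j < N"
    show "cmod (err z i j \<omega>) \<le> ?c * \<bar>Im z\<bar> powr (- 3)"
    proof (rule entry_error_bound_closure[OF wigner_sym[OF \<omega>] ij spectral_domain_Im(1)[OF z]])
      show "z \<in> closure T" using z T(3) by blast
      show "Im t \<noteq> 0" if "t \<in> T" for t using spectral_domain_Im(1) that T(2) by blast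
      show "cmod (entry_error N lam (W \<omega>) (\<lambda>k. v k \<omega>) t i j) \<le> ?c * \<bar>Im t\<bar> powr (- 3)" if "t \<in> T" for t
        using le that ij by blast
    qed
  qed (use T(2) in blast)
  also have "\<dots> = space M \<inter> (\<Inter>q\<in>T \<times> ({..<N} \<times> {..<N}). ?G (fst q) (fst (snd q)) (snd (snd q)))"
    by auto
  also have "\<dots> \<in> sets M"
  proof (cases "T = {}")
    case False
    have "?G (fst q) (fst (snd q)) (snd (snd q)) \<in> sets M" if "q \<in> T \<times> ({..<N} \<times> {..<N})" for q
    proof -
      have q: "fst q \<in> ?D" "fst (snd q) < N" "snd (snd q) < N" using that T(2) by auto
      show ?thesis
        using err_measurable[OF spectral_domain_Im(1)[OF q(1)] q(2,3), unfolded borel_measurable_iff_le]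
        by (rule spec)
    qed
    then have sub: "(\<lambda>q. ?G (fst q) (fst (snd q)) (snd (snd q))) ` (T \<times> ({..<N} \<times> {..<N})) \<subseteq> sets M"
      by (rule image_subsetI)
    have ne: "T \<times> ({..<N} \<times> {..<N}) \<noteq> {}" using False N by (auto simp: lessThan_empty_iff)
    have "countable (T \<times> ({..<N} \<times> {..<N}))" by (intro countable_SIGMA T(1) countable_finite) simp_all
    from sets.countable_INT'[OF this ne sub]
    have "(\<Inter>q\<in>T \<times> ({..<N} \<times> {..<N}). ?G (fst q) (fst (snd q)) (snd (snd q))) \<in> sets M" .
    then show ?thesis by (rule sets.Int[OF sets.top])
  qed simp
  finally show ?thesis .
qed

text \<open>The squared factor counts the net points at mesh \<open>1 / (2 N^5)\<close>, the factor
  \<open>N^2\<close> the matrix entries, and the last factor is the entry tail at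
  \<open>T = N powr (\<epsilon> / 2)\<close>.\<close>

lemma prob_good_event:
  "prob good \<ge> 1 - ((4 * R + 14) * real N ^ 5)\<^sup>2 * (real N)\<^sup>2 * (entry_const p \<theta> \<theta>' / (real N powr (\<epsilon> / 2)) ^ (2 * p))"
proof -
  let ?D = "spectral_domain N \<delta> R"
  let ?C = "entry_const p \<theta> \<theta>' / (real N powr (\<epsilon> / 2)) ^ (2 * p)"
  define h where "h = 1 / (2 * real N ^ 5)"
  have n5: "real N ^ 5 \<ge> 1" using N by (intro one_le_power) simp
  have h: "h > 0" using N by (simp add: h_def)
  have D: "?D \<subseteq> {z. \<bar>Re z\<bar> \<le> R + 3 \<and> \<bar>Im z\<bar> \<le> R + 3}"
    using R by (auto simp: spectral_domain_def)
  obtain T where T: "finite T" "T \<subseteq> ?D" "real (card T) \<le> (2 * (R + 3) / h + 2)\<^sup>2"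
    "\<And>z. z \<in> ?D \<Longrightarrow> \<exists>t\<in>T. cmod (z - t) \<le> 2 * h"
    using finite_net_of_rectangle[OF D h] R by auto
  let ?bad = "\<lambda>t i j. {\<omega> \<in> space M. 9 * real N powr (\<epsilon> / 2) / (sqrt N * \<bar>Im t\<bar> ^ 3) \<le> cmod (err t i j \<omega>)}"
  let ?I = "T \<times> ({..<N} \<times> {..<N})"
  let ?bad' = "\<lambda>q. ?bad (fst q) (fst (snd q)) (snd (snd q))"
  have bad_sets: "?bad' q \<in> sets M" if "q \<in> ?I" for q
  proof -
    have q: "fst q \<in> ?D" "fst (snd q) < N" "snd (snd q) < N" using that T(2) by auto
    show ?thesis
      using err_measurable[OF spectral_domain_Im(1)[OF q(1)] q(2,3), unfolded borel_measurable_iff_ge]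
      by (rule spec)
  qed
  have bad_prob: "prob (?bad' q) \<le> ?C" if "q \<in> ?I" for q
  proof -
    have q: "fst q \<in> ?D" using that T(2) by auto
    show ?thesis
      using that large
      by (intro entry_error_tail_random[OF W N1 \<theta> p ind v spectral_domain_Im(1,2)[OF q]]) auto
  qed
  \<comment> \<open>The quotient dominates a probability at the sample point
    \<open>z = \<i>\<close>, \<open>i = j = 0\<close>, hence is nonnegative.\<close>
  have C0: "?C \<ge> 0"
  proof -
    have "Im \<i> \<noteq> 0" "\<bar>Im \<i>\<bar> \<le> 3" "0 < N" "1 \<le> real N powr (\<epsilon> / 2)" using N large by auto
    from entry_error_tail_random[OF W N1 \<theta> p ind v this(1,2,3,3,4)]
    show ?thesis using measure_nonneg order.trans by blast
  qed
  have sub: "space M - good \<subseteq> (\<Union>q\<in>?I. ?bad' q)"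
  proof
    fix \<omega> assume "\<omega> \<in> space M - good"
    then obtain z i j where \<omega>: "\<omega> \<in> space M" and z: "z \<in> ?D" and ij: "i < N" "j < N"
      and ex: "\<not> cmod (err z i j \<omega>) \<le> real N powr (\<epsilon> - 1 / 2) * \<bar>Im z\<bar> powr (- 3)" by blast
    obtain t where t: "t \<in> T" "cmod (z - t) \<le> 2 * h" using T(4)[OF z] by blast
    then have tD: "t \<in> ?D" using T(2) by blast
    have c: "cmod (z - t) \<le> 1 / real N ^ 5" using t(2) by (simp add: h_def)
    have "\<not> cmod (err t i j \<omega>) < 9 * real N powr (\<epsilon> / 2) / (sqrt N * \<bar>Im t\<bar> ^ 3)"
      using entry_error_net_step[OF wigner_sym[OF \<omega>] ij N spectral_domain_Im(3)[OF z] spectral_domain_Im(3)[OF tD]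
          spectral_domain_Im(2)[OF z] c large] ex by blast
    then have "\<omega> \<in> ?bad t i j" using \<omega> by auto
    moreover have "(t, i, j) \<in> ?I" using t ij by auto
    ultimately show "\<omega> \<in> (\<Union>q\<in>?I. ?bad' q)" by force
  qed
  have "prob (space M - good) \<le> prob (\<Union>q\<in>?I. ?bad' q)"
    using T(1) by (intro finite_measure_mono sub sets.finite_UN bad_sets) auto
  also have "\<dots> \<le> (\<Sum>q\<in>?I. prob (?bad' q))"
    using T(1) by (intro measure_UNION_le bad_sets) auto
  also have "\<dots> \<le> (\<Sum>q\<in>?I. ?C)" by (intro sum_mono bad_prob)
  also have "\<dots> = real (card T) * (real N)\<^sup>2 * ?C" by (simp add: card_cartesian_product power2_eq_square)
  also have "\<dots> \<le> ((4 * R + 14) * real N ^ 5)\<^sup>2 * (real N)\<^sup>2 * ?C"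
  proof (intro mult_right_mono C0)
    have "2 * (R + 3) / h + 2 \<le> (4 * R + 14) * real N ^ 5"
      using n5 by (simp add: h_def algebra_simps)
    moreover have "0 \<le> 2 * (R + 3) / h + 2" using R h by simp
    ultimately show "real (card T) \<le> ((4 * R + 14) * real N ^ 5)\<^sup>2"
      using T(3) by (meson order.trans power_mono)
  qed simp
  finally show ?thesis using prob_compl[OF good_event_measurable] by linarith
qed

end

theorem theorem3:
  fixes P :: "nat \<Rightarrow> 'a measure"
    and W :: "nat \<Rightarrow> 'a \<Rightarrow> real mat"
    and v :: "nat \<Rightarrow> nat \<Rightarrow> 'a \<Rightarrow> real"
    and \<mu> :: "real measure"
    and \<theta> \<theta>' lam M \<delta> \<epsilon>' D' :: real
  assumes "\<theta> > 1" and "\<theta>' > 0"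
    and "\<And>N. N \<ge> 1 \<Longrightarrow> wigner_matrix (P N) N \<theta> \<theta>' (W N)"
    and "centered_jacobi_measure \<mu>"
    and "\<And>N. N \<ge> 1 \<Longrightarrow> iid_with_law (P N) N \<mu> (v N)"
    and "\<And>N. N \<ge> 1 \<Longrightarrow> matrix_indep_of_diag (P N) N (W N) (v N)"
    and "lam > 0"
    and "M > 0" and "0 < \<delta>" and "\<delta> \<le> 1 / 4"
    and "\<epsilon>' > 0" and "D' > 0"
  shows "\<forall>\<^sub>F N in sequentially.
    prob_space.prob (P N)
      {\<omega> \<in> space (P N). \<forall>z\<in>spectral_domain N \<delta> M.
         (let A = deformed_wigner N lam (W N \<omega>) (\<lambda>i. v N i \<omega>) in
          (MAX (i, j)\<in>{..<N} \<times> {..<N}.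
             cmod (resolvent N A z $$ (i, j)
               - (if i = j then 1 else 0)
                 * (1 / (complex_of_real (lam * v N i \<omega>) - z - stieltjes N A z))))
          \<le> real N powr (\<epsilon>' - 1 / 2) * \<bar>Im z\<bar> powr (- 3))}
    > 1 - real N powr (- D')"
proof -
  \<comment> \<open>The union bound costs N^12, namely N^10 for the net and N^2 for the entries. The
    thirteenth power leaves a factor 1/N to absorb the constant \<open>K\<close>.\<close>
  define p where "p = max 2 (nat \<lceil>(D' + 13) / \<epsilon>'\<rceil>)"
  have p: "p \<ge> 2" by (simp add: p_def)
  have pe: "D' + 13 \<le> \<epsilon>' * p"
  proof -
    have "(D' + 13) / \<epsilon>' \<le> p" unfolding p_def by linarith
    then show ?thesis using \<open>\<epsilon>' > 0\<close> by (simp add: field_simps)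
  qed
  \<comment> \<open>The absolute value spares a sign discussion of \<open>entry_const\<close>;
    \<open>K\<close> does not depend on N, so it is eventually below N.\<close>
  define K where "K = (4 * M + 14)\<^sup>2 * \<bar>entry_const p \<theta> \<theta>'\<bar>"
  have "filterlim (\<lambda>N. real N powr (\<epsilon>' / 2)) at_top sequentially"
    using \<open>\<epsilon>' > 0\<close> by real_asymp
  then have ev1: "\<forall>\<^sub>F N in sequentially. 153 \<le> real N powr (\<epsilon>' / 2)"
    unfolding filterlim_at_top by blast
  have ev2: "\<forall>\<^sub>F N in sequentially. K < real N"
    using filterlim_real_sequentially unfolding filterlim_at_top_dense by blast
  have ev3: "\<forall>\<^sub>F N :: nat in sequentially. 2 \<le> N" by (rule eventually_ge_at_top)
  show ?thesis
    using ev1 ev2 ev3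
  proof eventually_elim
    case (elim N)
    let ?n = "real N"
    have N: "N \<ge> 1" "N > 0" "?n > 0" using elim by auto
    interpret prob_space "P N" using assms(3)[OF N(1)] by (simp add: wigner_matrix_def)
    have v: "v N k \<in> borel_measurable (P N)" if "k < N" for k
      using assms(5)[OF N(1), unfolded iid_with_law_def indep_vars_def, THEN conjunct1, THEN conjunct1,
          THEN bspec, of k] that by simp
    let ?G = "{\<omega> \<in> space (P N). \<forall>z\<in>spectral_domain N \<delta> M. \<forall>i<N. \<forall>j<N.
      cmod (entry_error N lam (W N \<omega>) (\<lambda>k. v N k \<omega>) z i j) \<le> ?n powr (\<epsilon>' - 1 / 2) * \<bar>Im z\<bar> powr (- 3)}"
    have ne: "{..<N} \<times> {..<N} \<noteq> {}" using N by auto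
    \<comment> \<open>A maximum over a finite nonempty set is at most a bound exactly when every
      member is; \<open>N > 0\<close> provides nonemptiness.\<close>
    have eq: "{\<omega> \<in> space (P N). \<forall>z\<in>spectral_domain N \<delta> M.
         (let A = deformed_wigner N lam (W N \<omega>) (\<lambda>i. v N i \<omega>) in
          (MAX (i, j)\<in>{..<N} \<times> {..<N}.
             cmod (resolvent N A z $$ (i, j)
               - (if i = j then 1 else 0)
                 * (1 / (complex_of_real (lam * v N i \<omega>) - z - stieltjes N A z))))
          \<le> real N powr (\<epsilon>' - 1 / 2) * \<bar>Im z\<bar> powr (- 3))} = ?G"
      unfolding Let_def entry_error_def using ne
      by (intro Collect_cong conj_cong refl ball_cong) (subst Max_le_iff, auto)
    let ?a = "?n powr (\<epsilon>' / 2)"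
    have "((4 * M + 14) * ?n ^ 5)\<^sup>2 * ?n\<^sup>2 * (entry_const p \<theta> \<theta>' / ?a ^ (2 * p))
       \<le> ((4 * M + 14) * ?n ^ 5)\<^sup>2 * ?n\<^sup>2 * (\<bar>entry_const p \<theta> \<theta>'\<bar> / ?a ^ (2 * p))"
      by (intro mult_left_mono divide_right_mono) auto
    also have "\<dots> = K * (?n ^ 12 / ?n powr (\<epsilon>' * p))"
    proof -
      have "?a ^ (2 * p) = ?n powr (\<epsilon>' * p)" using N by (simp add: powr_realpow[symmetric] powr_powr)
      then show ?thesis by (simp add: K_def power_mult_distrib flip: power_mult power_add)
    qed
    also have "\<dots> \<le> K * (?n ^ 12 / ?n powr (D' + 13))"
      using N pe by (intro mult_left_mono divide_left_mono powr_mono) (auto simp: K_def)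
    also have "?n ^ 12 / ?n powr (D' + 13) = ?n powr (- D') / ?n"
    proof -
      have "?n ^ 12 = ?n powr 12" using N by simp
      then have "?n ^ 12 / ?n powr (D' + 13) = ?n powr (12 - (D' + 13))" by (simp only: powr_diff)
      also have "12 - (D' + 13) = - D' - 1" by simp
      finally show ?thesis using N by (simp add: powr_diff)
    qed
    also have "K * (?n powr (- D') / ?n) < ?n powr (- D')"
      using elim N by (simp add: field_simps)
    finally have "((4 * M + 14) * ?n ^ 5)\<^sup>2 * ?n\<^sup>2 * (entry_const p \<theta> \<theta>' / ?a ^ (2 * p)) < ?n powr (- D')" .
    moreover have "prob ?G \<ge> 1 - ((4 * M + 14) * ?n ^ 5)\<^sup>2 * ?n\<^sup>2 * (entry_const p \<theta> \<theta>' / ?a ^ (2 * p))"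
      using assms elim
      by (intro prob_good_event[OF assms(3)[OF N(1)] _ _ p assms(6)[OF N(1)] v]) auto
    ultimately show ?case unfolding eq by linarith
  qed
qed

end
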